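(* Let $d=1$, let $\alpha,\beta>0$, and let $m_S(x)=e^{-\frac{\alpha}{2}x^2}$ and $\widehat{m_F}(\xi)=e^{-\frac{\beta}{2}\xi^2}$. Then the concentration operator $\mathcal{K}$ on $L^2(\mathbb{R})$ associated to these masks satisfies $$\mathcal{K}=e^{-\frac12\alpha x^2}e^{\beta\Delta}e^{-\frac12\alpha x^2}=e^{-\mathrm{argsh}(\sqrt{\alpha\beta})\left[\sqrt{\frac{\alpha(1+\alpha\beta)}{\beta}}\,x^2-\sqrt{\frac{\beta}{\alpha(1+\alpha\beta)}}\,\Delta\right]} .$$ The eigenpairs $(\lambda_n,\psi_n)_{n\ge0}$ of the operator $\mathcal{K}$ are given by $$\psi_n(x)=\left(\frac{\alpha(1+\alpha\beta)}{\beta}\right)^{\frac18}\varphi_n\left(\left(\frac{\alpha(1+\alpha\beta)}{\beta}\right)^{\frac14}x\right),\qquad \lambda_n=e^{-\mathrm{argsh}(\sqrt{\alpha\beta})(2n+1)},$$ where $\varphi_n$ are the (normalized) Hermite functions.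
   Context: The Fourier transform is $\mathcal{F}[f](\xi)=\int f(x)e^{-i\xi x}dx$ with inverse $\mathcal{F}^{-1}[f](x)=(2\pi)^{-1}\int f(\xi)e^{ix\xi}d\xi$. With $\mathcal{M}_Sf=m_Sf$ and $\mathcal{M}_Ff=\mathcal{F}^{-1}[\widehat{m_F}\mathcal{F}[f]]$, the concentration operator is $\mathcal{K}=\mathcal{M}_S^*\mathcal{M}_F^*\mathcal{M}_F\mathcal{M}_S$, i.e. $(\mathcal{K}f)(x)=\overline{m_S(x)}\int_{\mathbb{R}}k(x-y)m_S(y)f(y)dy$ with $k(z)=\frac1{2\pi}\int_{\mathbb{R}}e^{i\xi z}|\widehat{m_F}(\xi)|^2d\xi$. $\Delta=\partial_x^2$; $e^{-\frac12\alpha x^2}$ denotes the multiplication operator; $e^{\beta\Delta}$ is the heat semigroup; the exponential on the right is that of the self-adjoint (harmonic oscillator) operator in the exponent, defined by functional calculus. $\mathrm{argsh}$ is the inverse hyperbolic sine. The Hermite functions $\varphi_n$, $n\ge0$, are the $L^2$-normalized eigenfunctions of $-\Delta+x^2$ with $(-\Delta+x^2)\varphi_n=(2n+1)\varphi_n$. *)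

theory Defs
  imports "HOL-Analysis.Analysis"
begin

text \<open>
  The space \<open>L\<^sup>2(\<real>)\<close> is represented by Borel functions, identified up to equality almost
  everywhere. An operator, possibly unbounded, is represented by its graph, which contains all
  representatives of its arguments and values. Hence equality of graphs is equality of operators,
  including their domains, on the Hilbert space of equivalence classes.
\<close>

definition L2 :: "(real \<Rightarrow> complex) set" where
  "L2 = {f \<in> borel_measurable lborel. integrable lborel (\<lambda>x. (cmod (f x))\<^sup>2)}"

definition L2_inner :: "(real \<Rightarrow> complex) \<Rightarrow> (real \<Rightarrow> complex) \<Rightarrow> complex" where
  "L2_inner f g = (\<integral>x. cnj (f x) * g x \<partial>lborel)"

definition L2_conv :: "(nat \<Rightarrow> real \<Rightarrow> complex) \<Rightarrow> (real \<Rightarrow> complex) \<Rightarrow> bool" where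
  "L2_conv s f \<longleftrightarrow> (\<lambda>n. \<integral>\<^sup>+x. ennreal ((cmod (s n x - f x))\<^sup>2) \<partial>lborel) \<longlonglongrightarrow> 0"

type_synonym oper = "((real \<Rightarrow> complex) \<times> (real \<Rightarrow> complex)) set"


subsection \<open>Algebra of operators\<close>

text \<open>Relational composition applies its first argument first.\<close>

abbreviation op_comp :: "oper \<Rightarrow> oper \<Rightarrow> oper"  (infixr "\<circ>\<^sub>o" 75) where
  "A \<circ>\<^sub>o B \<equiv> B O A"

definition op_scale :: "real \<Rightarrow> oper \<Rightarrow> oper"  (infixr "\<cdot>\<^sub>o" 75) where
  "c \<cdot>\<^sub>o A = {(f, g) \<in> L2 \<times> L2. \<exists>h. (f, h) \<in> A \<and> (AE x in lborel. g x = of_real c * h x)}"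

text \<open>Sums and differences have the intersection of the two domains as their domain.\<close>

definition op_add :: "oper \<Rightarrow> oper \<Rightarrow> oper"  (infixl "+\<^sub>o" 65) where
  "A +\<^sub>o B = {(f, g) \<in> L2 \<times> L2. \<exists>h k. (f, h) \<in> A \<and> (f, k) \<in> B \<and>
     (AE x in lborel. g x = h x + k x)}"

definition op_diff :: "oper \<Rightarrow> oper \<Rightarrow> oper"  (infixl "-\<^sub>o" 65) where
  "A -\<^sub>o B = {(f, g) \<in> L2 \<times> L2. \<exists>h k. (f, h) \<in> A \<and> (f, k) \<in> B \<and>
     (AE x in lborel. g x = h x - k x)}"

text \<open>The Hilbert space adjoint, for densely defined \<open>A\<close>.\<close>

definition adj :: "oper \<Rightarrow> oper" where
  "adj A = {(g, h) \<in> L2 \<times> L2. \<forall>(f, f') \<in> A. L2_inner g f' = L2_inner h f}"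

text \<open>Multiplication by \<open>m\<close>, on its maximal domain.\<close>

definition mult_op :: "(real \<Rightarrow> complex) \<Rightarrow> oper" where
  "mult_op m = {(f, g) \<in> L2 \<times> L2. AE x in lborel. g x = m x * f x}"


subsection \<open>The concentration operator\<close>

definition fourier :: "(real \<Rightarrow> complex) \<Rightarrow> real \<Rightarrow> complex" where
  "fourier f \<xi> = (\<integral>x. f x * exp (- \<i> * of_real (\<xi> * x)) \<partial>lborel)"

definition inv_fourier :: "(real \<Rightarrow> complex) \<Rightarrow> real \<Rightarrow> complex" where
  "inv_fourier f x = 1 / (2 * of_real pi) * (\<integral>\<xi>. f \<xi> * exp (\<i> * of_real (x * \<xi>)) \<partial>lborel)"

text \<open>
  The continuous extension to \<open>L\<^sup>2\<close> of a transform given by an integral on \<open>L\<^sup>1 \<inter> L\<^sup>2\<close>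
  (Plancherel).
\<close>

definition L2_extension :: "((real \<Rightarrow> complex) \<Rightarrow> real \<Rightarrow> complex) \<Rightarrow> oper" where
  "L2_extension T = {(f, g) \<in> L2 \<times> L2. \<exists>s. (\<forall>n. s n \<in> L2 \<and> integrable lborel (s n)) \<and>
     L2_conv s f \<and> L2_conv (\<lambda>n. T (s n)) g}"

definition fourier_op :: oper where
  "fourier_op = L2_extension fourier"

definition inv_fourier_op :: oper where
  "inv_fourier_op = L2_extension inv_fourier"

text \<open>The frequency mask is given through its Fourier transform \<open>mhat\<close>.\<close>

definition freq_mask_op :: "(real \<Rightarrow> complex) \<Rightarrow> oper" where
  "freq_mask_op mhat = inv_fourier_op \<circ>\<^sub>o mult_op mhat \<circ>\<^sub>o fourier_op"

definition concentration_op :: "(real \<Rightarrow> complex) \<Rightarrow> (real \<Rightarrow> complex) \<Rightarrow> oper" where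
  "concentration_op mS mFhat =
     adj (mult_op mS) \<circ>\<^sub>o adj (freq_mask_op mFhat) \<circ>\<^sub>o freq_mask_op mFhat \<circ>\<^sub>o mult_op mS"


subsection \<open>The Laplacian\<close>

definition D1 :: "(real \<Rightarrow> complex) \<Rightarrow> real \<Rightarrow> complex" where
  "D1 u x = vector_derivative u (at x)"

definition schwartz :: "(real \<Rightarrow> complex) set" where
  "schwartz = {u. \<forall>n. (\<forall>x. (D1 ^^ n) u differentiable (at x)) \<and>
     (\<forall>k. bounded (range (\<lambda>x. of_real (x ^ k) * (D1 ^^ n) u x)))}"

text \<open>
  The second derivative in the sense of tempered distributions, with maximal domain in \<open>L\<^sup>2\<close>.
  Its domain is the Sobolev space \<open>H\<^sup>2(\<real>)\<close>, and it is the self-adjoint Laplacian.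
\<close>

definition laplacian :: oper where
  "laplacian = {(f, g) \<in> L2 \<times> L2. \<forall>u \<in> schwartz.
     (\<integral>x. g x * u x \<partial>lborel) = (\<integral>x. f x * (D1 ^^ 2) u x \<partial>lborel)}"


subsection \<open>Functional calculus of self-adjoint operators\<close>

text \<open>An everywhere defined graph with \<open>adj P = P\<close> is that of a bounded (single-valued) operator.\<close>

definition orth_projection :: "oper \<Rightarrow> bool" where
  "orth_projection P \<longleftrightarrow> Domain P = L2 \<and> adj P = P \<and> P \<circ>\<^sub>o P = P"

definition spectral_measure :: "(real set \<Rightarrow> oper) \<Rightarrow> bool" where
  "spectral_measure E \<longleftrightarrow>
     (\<forall>B \<in> sets borel. orth_projection (E B)) \<and>
     E UNIV = mult_op (\<lambda>_. 1) \<and>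
     (\<forall>B f g h. range B \<subseteq> sets borel \<and> disjoint_family B \<and>
        (\<forall>n::nat. (f, g n) \<in> E (B n)) \<and> (f, h) \<in> E (\<Union>n. B n) \<longrightarrow>
        L2_conv (\<lambda>N x. \<Sum>n<N. g n x) h)"

definition op_app :: "oper \<Rightarrow> (real \<Rightarrow> complex) \<Rightarrow> real \<Rightarrow> complex" where
  "op_app A f = (SOME g. (f, g) \<in> A)"

text \<open>The scalar measure \<open>B \<mapsto> \<langle>f, E(B) f\<rangle>\<close>.\<close>

definition scalar_measure :: "(real set \<Rightarrow> oper) \<Rightarrow> (real \<Rightarrow> complex) \<Rightarrow> real measure" where
  "scalar_measure E f =
     measure_of UNIV (sets borel) (\<lambda>B. ennreal (Re (L2_inner f (op_app (E B) f))))"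

text \<open>
  The operator \<open>\<integral> \<Phi> dE\<close>, whose domain is \<open>{f. \<integral> \<Phi>\<^sup>2 d\<langle>f, E f\<rangle> < \<infinity>}\<close>: its value at \<open>f\<close> is the limit of
  the values at \<open>f\<close> of the integrals of simple functions that converge to \<open>\<Phi>\<close> in
  \<open>L\<^sup>2(d\<langle>f, E f\<rangle>)\<close>.
\<close>

definition spectral_integral :: "(real set \<Rightarrow> oper) \<Rightarrow> (real \<Rightarrow> real) \<Rightarrow> oper" where
  "spectral_integral E \<Phi> = {(f, g) \<in> L2 \<times> L2. \<exists>s :: nat \<Rightarrow> real \<Rightarrow> real.
     (\<forall>n. simple_function borel (s n)) \<and>
     (\<lambda>n. \<integral>\<^sup>+t. ennreal ((s n t - \<Phi> t)\<^sup>2) \<partial>scalar_measure E f) \<longlonglongrightarrow> 0 \<and>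
     L2_conv (\<lambda>n x. \<Sum>c\<in>range (s n). of_real c * op_app (E (s n -` {c})) f x) g}"

text \<open>
  \<open>T = \<Phi>(A)\<close> for self-adjoint \<open>A\<close>. By the spectral theorem \<open>E\<close> exists and is unique, so that
  \<open>T\<close> is determined by \<open>A\<close> and \<open>\<Phi>\<close>; if \<open>A\<close> is not self-adjoint, the relation never holds.
\<close>

definition is_function_of :: "(real \<Rightarrow> real) \<Rightarrow> oper \<Rightarrow> oper \<Rightarrow> bool" where
  "is_function_of \<Phi> A T \<longleftrightarrow> (\<exists>E. spectral_measure E \<and>
     A = spectral_integral E (\<lambda>t. t) \<and> T = spectral_integral E \<Phi>)"

abbreviation is_exp_of :: "oper \<Rightarrow> oper \<Rightarrow> bool" where
  "is_exp_of \<equiv> is_function_of exp"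


subsection \<open>Eigenpairs and Hermite functions\<close>

definition eigenpair :: "oper \<Rightarrow> complex \<Rightarrow> (real \<Rightarrow> complex) \<Rightarrow> bool" where
  "eigenpair A \<mu> f \<longleftrightarrow> (f, \<lambda>x. \<mu> * f x) \<in> A \<and> \<not> (AE x in lborel. f x = 0)"

definition orthonormal_basis :: "(nat \<Rightarrow> real \<Rightarrow> complex) \<Rightarrow> bool" where
  "orthonormal_basis e \<longleftrightarrow> range e \<subseteq> L2 \<and>
     (\<forall>m n. L2_inner (e m) (e n) = (if m = n then 1 else 0)) \<and>
     (\<forall>f \<in> L2. (\<forall>n. L2_inner (e n) f = 0) \<longrightarrow> (AE x in lborel. f x = 0))"

text \<open>This determines the \<open>n\<close>-th Hermite function up to a factor of modulus one.\<close>

definition hermite_function :: "nat \<Rightarrow> (real \<Rightarrow> complex) \<Rightarrow> bool" where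
  "hermite_function n u \<longleftrightarrow> L2_inner u u = 1 \<and>
     eigenpair ((-1) \<cdot>\<^sub>o laplacian +\<^sub>o mult_op (\<lambda>x. of_real (x\<^sup>2))) (of_nat (2 * n + 1)) u"

end

theory Submission
  imports Defs "HOL-Probability.Probability"
begin

text \<open>
  The operator \<open>K\<close> is first diagonalized explicitly. Let \<open>r = (\<alpha>(1+\<alpha>\<beta>)/\<beta>)\<^bsup>1/2\<^esup>\<close>. The three multiplications (by
  \<open>e\<^bsup>-\<alpha>x\<^sup>2/2\<^esup>\<close>, by \<open>e\<^bsup>-\<beta>\<xi>\<^sup>2\<^esup>\<close> on the Fourier side, and again by \<open>e\<^bsup>-\<alpha>x\<^sup>2/2\<^esup>\<close>) preserve polynomials times Gaussians, and
  commuting the creation operator \<open>rx - \<partial>\<close> through them gives \<open>K(rx - \<partial>) = \<rho>(rx - \<partial>)K\<close> with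
  \<open>\<rho> = (r-\<alpha>)/(r+\<alpha>) = e\<^bsup>-2 argsh \<surd>(\<alpha>\<beta>)\<^esup>\<close>; hence the Hermite functions of width \<open>r\<close> are eigenfunctions with eigenvalues
  \<open>\<rho>\<^bsup>n+1/2\<^esup>\<close>. The same functions diagonalize \<open>rx\<^sup>2 - \<Delta>/r\<close> with eigenvalues \<open>2n+1\<close>. As they form an orthonormal
  basis, both operators are diagonal in it, and the exponential is read off from the diagonal form.

  Every operator that occurs is a multiplication operator after a unitary map: the Fourier transform for
  \<open>\<Delta>\<close> and the frequency mask, the Hermite coefficients for the oscillator and for \<open>K\<close>. The spectral measure of
  such an operator consists of the multiplications by indicator functions. The Fourier transform on \<open>L\<^sup>2\<close> itself
  acts on Hermite coefficients by the factors \<open>(2\<pi>)\<^bsup>1/2\<^esup>(-i)\<^sup>n\<close>.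
\<close>
section \<open>Square-integrable functions\<close>

text \<open>The width \<open>r\<close> is the one that the masks restore. The first mask takes it to
  \<open>r + \<alpha>\<close>, the Fourier transform to \<open>1 / (r + \<alpha>)\<close>, the
  frequency mask adds \<open>2 * \<beta>\<close>, the inverse transform takes the reciprocal, the
  last mask adds \<alpha>. The chain closes exactly when \<beta>(r^2 - \<alpha>^2) = \<alpha>, which
  is the formula for \<open>r\<close>. The main obstacle is domains: a graph records its domain and
  holds all representatives, so the action on a basis does not settle an equality of operators. For
  K it is enough that the product is symmetric and everywhere defined. For the Laplacian and the
  oscillator, membership in the domain must be read off from coefficients, while x^2 f or \<xi>^2
  \<open>FV f\<close> may leave L^2. Such products are handled in the larger class of functions
  integrable against every Gaussian. Hermite functions still separate this class, by vanishing
  moments and uniqueness of characteristic functions. Measures stay abstract because the unitary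
  maps land in L^2 of the line or in l^2 over the naturals.\<close>

definition sqi :: "'a measure \<Rightarrow> ('a \<Rightarrow> complex) set" where
  "sqi M = {f \<in> borel_measurable M. integrable M (\<lambda>x. (cmod (f x))\<^sup>2)}"

definition ip :: "'a measure \<Rightarrow> ('a \<Rightarrow> complex) \<Rightarrow> ('a \<Rightarrow> complex) \<Rightarrow> complex" where
  "ip M f g = (\<integral>x. cnj (f x) * g x \<partial>M)"

definition nsq :: "'a measure \<Rightarrow> ('a \<Rightarrow> complex) \<Rightarrow> real" where
  "nsq M f = (\<integral>x. (cmod (f x))\<^sup>2 \<partial>M)"

lemma L2_eq_sqi: "L2 = sqi lborel"
  by (simp add: L2_def sqi_def)

abbreviation ipL :: "(real \<Rightarrow> complex) \<Rightarrow> (real \<Rightarrow> complex) \<Rightarrow> complex" where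
  "ipL \<equiv> ip lborel"

lemma L2_inner_eq_ip: "L2_inner = ipL"
  by (intro ext) (simp add: L2_inner_def ip_def)

lemma sqi_measurable [measurable_dest]: "f \<in> sqi M \<Longrightarrow> f \<in> borel_measurable M"
  by (simp add: sqi_def)

lemma sqi_integrable: "f \<in> sqi M \<Longrightarrow> integrable M (\<lambda>x. (cmod (f x))\<^sup>2)"
  by (simp add: sqi_def)

lemma sqiI: "f \<in> borel_measurable M \<Longrightarrow> integrable M (\<lambda>x. (cmod (f x))\<^sup>2) \<Longrightarrow> f \<in> sqi M"
  by (simp add: sqi_def)

lemma sqi_bound:
  assumes "f \<in> borel_measurable M" "integrable M g" "\<And>x. x \<in> space M \<Longrightarrow> (cmod (f x))\<^sup>2 \<le> g x"
  shows "f \<in> sqi M"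
proof (rule sqiI)
  note [measurable] = assms(1)
  show "integrable M (\<lambda>x. (cmod (f x))\<^sup>2)"
  proof (rule Bochner_Integration.integrable_bound[OF assms(2)])
    show "AE x in M. norm ((cmod (f x))\<^sup>2) \<le> norm (g x)"
      by (rule AE_I2) (use assms(3) in \<open>force intro: order_trans\<close>)
  qed measurable
qed fact

lemma sum_norm_squared_le: "(cmod (a + b))\<^sup>2 \<le> 2 * (cmod a)\<^sup>2 + 2 * (cmod b)\<^sup>2"
proof -
  have "(cmod (a + b))\<^sup>2 \<le> (cmod a + cmod b)\<^sup>2"
    by (intro power_mono norm_triangle_ineq) auto
  also have "\<dots> \<le> 2 * (cmod a)\<^sup>2 + 2 * (cmod b)\<^sup>2"
    using sum_squares_bound[of "cmod a" "cmod b"] by (simp add: power2_sum)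
  finally show ?thesis .
qed

lemma sqi_add: assumes "f \<in> sqi M" "g \<in> sqi M" shows "(\<lambda>x. f x + g x) \<in> sqi M"
  by (rule sqi_bound[where g = "\<lambda>x. 2 * (cmod (f x))\<^sup>2 + 2 * (cmod (g x))\<^sup>2"])
     (use assms sum_norm_squared_le in \<open>auto intro!: Bochner_Integration.integrable_add integrable_mult_right sqi_integrable simp: sqi_measurable\<close>)

lemma sqi_cmult: assumes "f \<in> sqi M" shows "(\<lambda>x. c * f x) \<in> sqi M"
  by (rule sqiI) (use assms in \<open>auto simp: norm_mult power_mult_distrib intro: sqi_measurable sqi_integrable\<close>)

lemma sqi_uminus: "f \<in> sqi M \<Longrightarrow> (\<lambda>x. - f x) \<in> sqi M"
  using sqi_cmult[of f M "-1"] by simp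

lemma sqi_diff: "f \<in> sqi M \<Longrightarrow> g \<in> sqi M \<Longrightarrow> (\<lambda>x. f x - g x) \<in> sqi M"
  using sqi_add[of f M "\<lambda>x. - g x"] by (simp add: sqi_uminus)

lemma sqi_zero [simp]: "(\<lambda>x. 0) \<in> sqi M"
  by (rule sqiI) auto

lemma sqi_sum: "(\<And>i. i \<in> I \<Longrightarrow> f i \<in> sqi M) \<Longrightarrow> (\<lambda>x. \<Sum>i\<in>I. f i x) \<in> sqi M"
  by (induction I rule: infinite_finite_induct) (auto intro: sqi_add)

lemma cnj_measurable [measurable]: "cnj \<in> borel_measurable borel"
  by (intro borel_measurable_continuous_onI continuous_intros)

lemma sqi_cnj: "f \<in> sqi M \<Longrightarrow> (\<lambda>x. cnj (f x)) \<in> sqi M"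
  by (auto simp: sqi_def)

lemma sqi_mult_bounded:
  assumes [measurable]: "m \<in> borel_measurable M" and "f \<in> sqi M" and "\<And>x. cmod (m x) \<le> C"
  shows "(\<lambda>x. m x * f x) \<in> sqi M"
proof (rule sqi_bound[where g = "\<lambda>x. C\<^sup>2 * (cmod (f x))\<^sup>2"])
  show "(\<lambda>x. m x * f x) \<in> borel_measurable M" using assms(2) by measurable
  fix x show "(cmod (m x * f x))\<^sup>2 \<le> C\<^sup>2 * (cmod (f x))\<^sup>2"
    using assms(3)[of x] by (auto simp: norm_mult power_mult_distrib intro!: mult_right_mono power_mono)
qed (use assms in \<open>auto intro: sqi_integrable\<close>)

lemma sqi_cong_AE:
  assumes "f \<in> sqi M" "g \<in> borel_measurable M" "AE x in M. g x = f x"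
  shows "g \<in> sqi M"
proof (rule sqiI)
  have "AE x in M. (cmod (f x))\<^sup>2 = (cmod (g x))\<^sup>2" using assms(3) by eventually_elim simp
  then show "integrable M (\<lambda>x. (cmod (g x))\<^sup>2)"
    using assms by (subst integrable_cong_AE[where g = "\<lambda>x. (cmod (f x))\<^sup>2"])
      (auto intro: sqi_integrable simp: sqi_measurable)
qed fact

lemma sqi_mult_integrable:
  assumes "f \<in> sqi M" "g \<in> sqi M"
  shows "integrable M (\<lambda>x. f x * g x)"
proof (rule Bochner_Integration.integrable_bound[where f = "\<lambda>x. (cmod (f x))\<^sup>2 + (cmod (g x))\<^sup>2"])
  show "AE x in M. cmod (f x * g x) \<le> norm ((cmod (f x))\<^sup>2 + (cmod (g x))\<^sup>2)"
  proof (rule AE_I2)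
    fix x
    have "0 \<le> cmod (f x) * cmod (g x)" by simp
    with sum_squares_bound[of "cmod (f x)" "cmod (g x)"]
    have "cmod (f x) * cmod (g x) \<le> (cmod (f x))\<^sup>2 + (cmod (g x))\<^sup>2"
      unfolding mult.assoc by linarith
    then show "cmod (f x * g x) \<le> norm ((cmod (f x))\<^sup>2 + (cmod (g x))\<^sup>2)"
      by (simp add: norm_mult)
  qed
qed (use assms in \<open>auto intro: sqi_integrable simp: sqi_measurable\<close>)

lemma ip_integrable: "f \<in> sqi M \<Longrightarrow> g \<in> sqi M \<Longrightarrow> integrable M (\<lambda>x. cnj (f x) * g x)"
  by (intro sqi_mult_integrable sqi_cnj)

lemma ip_add_right: "f \<in> sqi M \<Longrightarrow> g \<in> sqi M \<Longrightarrow> h \<in> sqi M \<Longrightarrow>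
    ip M f (\<lambda>x. g x + h x) = ip M f g + ip M f h"
  using ip_integrable[of f M g] ip_integrable[of f M h] by (simp add: ip_def ring_distribs)

lemma ip_diff_right: "f \<in> sqi M \<Longrightarrow> g \<in> sqi M \<Longrightarrow> h \<in> sqi M \<Longrightarrow>
    ip M f (\<lambda>x. g x - h x) = ip M f g - ip M f h"
  using ip_integrable[of f M g] ip_integrable[of f M h] by (simp add: ip_def ring_distribs)

lemma ip_cmult_right: "ip M f (\<lambda>x. c * g x) = c * ip M f g"
  by (simp add: ip_def mult.left_commute[of _ c])

lemma ip_commute: "ip M g f = cnj (ip M f g)"
  by (simp add: ip_def mult.commute flip: Bochner_Integration.integral_cnj)

lemma ip_cmult_left: "ip M (\<lambda>x. c * f x) g = cnj c * ip M f g"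
  using ip_cmult_right[of M g c f] ip_commute[of M "\<lambda>x. c * f x" g] ip_commute[of M f g] by simp

lemma ip_add_left: "f \<in> sqi M \<Longrightarrow> g \<in> sqi M \<Longrightarrow> h \<in> sqi M \<Longrightarrow>
    ip M (\<lambda>x. g x + h x) f = ip M g f + ip M h f"
  using ip_add_right[of f M g h] ip_commute[of M f] by (metis complex_cnj_add complex_cnj_cnj)

lemma ip_diff_left: "f \<in> sqi M \<Longrightarrow> g \<in> sqi M \<Longrightarrow> h \<in> sqi M \<Longrightarrow>
    ip M (\<lambda>x. g x - h x) f = ip M g f - ip M h f"
  using ip_diff_right[of f M g h] ip_commute[of M f] by (metis complex_cnj_diff complex_cnj_cnj)

lemma ip_zero_right [simp]: "ip M f (\<lambda>x. 0) = 0"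
  by (simp add: ip_def)

lemma ip_sum_right: "f \<in> sqi M \<Longrightarrow> (\<And>i. i \<in> I \<Longrightarrow> g i \<in> sqi M) \<Longrightarrow>
    ip M f (\<lambda>x. \<Sum>i\<in>I. g i x) = (\<Sum>i\<in>I. ip M f (g i))"
  by (induction I rule: infinite_finite_induct) (auto simp: ip_add_right sqi_sum ip_zero_right)

lemma ip_cong_AE:
  assumes "f \<in> borel_measurable M" "g \<in> borel_measurable M" "f' \<in> borel_measurable M" "g' \<in> borel_measurable M"
    and "AE x in M. f x = f' x" "AE x in M. g x = g' x"
  shows "ip M f g = ip M f' g'"
proof -
  note [measurable] = assms(1-4)
  have "AE x in M. cnj (f x) * g x = cnj (f' x) * g' x" using assms(5,6) by eventually_elim simp
  then show ?thesis
    unfolding ip_def by (intro integral_cong_AE) measurable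
qed

lemma ip_self: "ip M f f = of_real (nsq M f)"
  unfolding ip_def nsq_def by (simp add: mult.commute[of "cnj _"] flip: complex_norm_square of_real_power)

lemma nsq_nonneg [simp]: "0 \<le> nsq M f"
  by (simp add: nsq_def)

lemma nsq_eq_0D: "f \<in> sqi M \<Longrightarrow> nsq M f = 0 \<Longrightarrow> AE x in M. f x = 0"
  unfolding nsq_def using integral_nonneg_eq_0_iff_AE[of M "\<lambda>x. (cmod (f x))\<^sup>2"]
  by (auto simp: sqi_integrable)

lemma nsq_AE_0: "AE x in M. f x = 0 \<Longrightarrow> nsq M f = 0"
  unfolding nsq_def by (rule integral_eq_zero_AE) auto

lemma nsq_cong_AE:
  assumes "f \<in> borel_measurable M" "g \<in> borel_measurable M" "AE x in M. f x = g x"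
  shows "nsq M f = nsq M g"
  using ip_cong_AE[OF assms(1,1,2,2,3,3)] by (simp add: ip_self)

lemma nsq_cmult: "nsq M (\<lambda>x. c * f x) = (cmod c)\<^sup>2 * nsq M f"
  by (simp add: nsq_def norm_mult power_mult_distrib)

lemma nsq_diff_expand:
  assumes "f \<in> sqi M" "g \<in> sqi M"
  shows "nsq M (\<lambda>x. f x - g x) = nsq M f - 2 * Re (ip M f g) + nsq M g"
proof -
  have "of_real (nsq M (\<lambda>x. f x - g x)) = ip M f f - ip M f g - cnj (ip M f g) + ip M g g"
    using assms by (simp add: ip_diff_left ip_diff_right sqi_diff ip_commute[of M g f] flip: ip_self)
  also have "\<dots> = of_real (nsq M f - 2 * Re (ip M f g) + nsq M g)"
    by (simp add: ip_self complex_eq_iff)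
  finally show ?thesis by (simp only: of_real_eq_iff)
qed

lemma ip_Cauchy_Schwarz:
  assumes "f \<in> sqi M" "g \<in> sqi M"
  shows "(cmod (ip M f g))\<^sup>2 \<le> nsq M f * nsq M g"
proof -
  let ?z = "ip M f g"
  have *: "2 * (cmod ?z)\<^sup>2 * t - t\<^sup>2 * (cmod ?z)\<^sup>2 * nsq M f \<le> nsq M g" for t :: real
  proof -
    have "0 \<le> nsq M (\<lambda>x. g x - of_real t * ?z * f x)" by simp
    also have "\<dots> = nsq M g - 2 * Re (ip M g (\<lambda>x. of_real t * ?z * f x)) + nsq M (\<lambda>x. of_real t * ?z * f x)"
      by (intro nsq_diff_expand sqi_cmult assms)
    also have "ip M g (\<lambda>x. of_real t * ?z * f x) = of_real (t * (cmod ?z)\<^sup>2)"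
      using complex_norm_square[of ?z] by (simp add: ip_cmult_right ip_commute[of M g f])
    also have "nsq M (\<lambda>x. of_real t * ?z * f x) = t\<^sup>2 * (cmod ?z)\<^sup>2 * nsq M f"
      unfolding nsq_cmult by (simp add: norm_mult power_mult_distrib)
    finally show ?thesis by (simp add: algebra_simps)
  qed
  show ?thesis
  proof (cases "nsq M f = 0")
    case True
    have "ip M f g = ip M (\<lambda>x. 0) g"
      using nsq_eq_0D[OF assms(1) True] assms by (intro ip_cong_AE) (auto simp: sqi_measurable)
    then show ?thesis by (simp add: True) (simp add: ip_def)
  next
    case False
    then have p: "nsq M f > 0" using nsq_nonneg[of M f] by linarith
    \<comment> \<open>This \<open>t\<close> makes the subtracted vector the orthogonal projection of
      \<open>g\<close> on \<open>f\<close>.\<close>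
    have "(cmod ?z)\<^sup>2 / nsq M f \<le> nsq M g"
      using *[of "1 / nsq M f"] p by (simp add: power2_eq_square field_simps)
    then show ?thesis using p by (simp add: field_simps)
  qed
qed

lemma nsq_minus_commute: "nsq M (\<lambda>x. f x - g x) = nsq M (\<lambda>x. g x - f x)"
  by (simp add: nsq_def norm_minus_commute)

lemma nn_integral_eq_nsq: "f \<in> sqi M \<Longrightarrow> (\<integral>\<^sup>+x. ennreal ((cmod (f x))\<^sup>2) \<partial>M) = ennreal (nsq M f)"
  unfolding nsq_def by (intro nn_integral_eq_integral sqi_integrable) auto

section \<open>Mean-square convergence and completeness\<close>

definition sconv :: "'a measure \<Rightarrow> (nat \<Rightarrow> 'a \<Rightarrow> complex) \<Rightarrow> ('a \<Rightarrow> complex) \<Rightarrow> bool" where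
  "sconv M s f \<longleftrightarrow> (\<lambda>n. nsq M (\<lambda>x. s n x - f x)) \<longlonglongrightarrow> 0"

text \<open>The Bochner integral in \<open>nsq\<close> is 0 for non-integrable functions, so the two
  notions can be compared only inside L^2.\<close>

lemma L2_conv_iff_sconv:
  assumes "\<And>n. s n \<in> L2" "f \<in> L2"
  shows "L2_conv s f \<longleftrightarrow> sconv lborel s f"
proof -
  have "(\<integral>\<^sup>+x. ennreal ((cmod (s n x - f x))\<^sup>2) \<partial>lborel) = ennreal (nsq lborel (\<lambda>x. s n x - f x))" for n
    using assms by (intro nn_integral_eq_nsq sqi_diff) (auto simp: L2_eq_sqi)
  then show ?thesis unfolding L2_conv_def sconv_def
    using tendsto_ennreal_iff[where F = sequentially and f = "\<lambda>n. nsq lborel (\<lambda>x. s n x - f x)" and x = 0] by simp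
qed

lemma sconv_ip:
  assumes "\<And>n. s n \<in> sqi M" "f \<in> sqi M" "h \<in> sqi M" "sconv M s f"
  shows "(\<lambda>n. ip M h (s n)) \<longlonglongrightarrow> ip M h f"
proof (rule LIM_zero_cancel, rule tendsto_norm_zero_cancel)
  have "(\<lambda>n. (cmod (ip M h (s n) - ip M h f))\<^sup>2) \<longlonglongrightarrow> 0"
  proof (rule tendsto_sandwich)
    show "(\<lambda>_. 0) \<longlonglongrightarrow> (0::real)" by simp
    show "(\<lambda>n. nsq M h * nsq M (\<lambda>x. s n x - f x)) \<longlonglongrightarrow> 0"
      using assms(4) unfolding sconv_def by (rule tendsto_mult_right_zero)
    have "(cmod (ip M h (s n) - ip M h f))\<^sup>2 \<le> nsq M h * nsq M (\<lambda>x. s n x - f x)" for n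
      using ip_Cauchy_Schwarz[of h M "\<lambda>x. s n x - f x"] assms by (simp add: ip_diff_right sqi_diff)
    then show "\<forall>\<^sub>F n in sequentially. (cmod (ip M h (s n) - ip M h f))\<^sup>2 \<le> nsq M h * nsq M (\<lambda>x. s n x - f x)"
      by simp
  qed simp
  then show "(\<lambda>n. cmod (ip M h (s n) - ip M h f)) \<longlonglongrightarrow> 0"
    using tendsto_real_sqrt by fastforce
qed

text \<open>A finite distance to \<open>f\<close> already puts \<open>s n\<close> into L^2, so
  replacing the finitely many bad terms by \<open>f\<close> reduces the claim to
  \<open>sconv_ip\<close>. This form suits Fourier transforms of integrable functions, whose
  membership in L^2 is not established beforehand.\<close>

lemma L2_conv_ip:
  assumes s: "\<And>n. s n \<in> borel_measurable lborel" and f: "f \<in> L2" and h: "h \<in> L2" and c: "L2_conv s f"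
  shows "(\<lambda>n. ipL h (s n)) \<longlonglongrightarrow> ipL h f"
proof -
  have [measurable]: "\<And>n. s n \<in> borel_measurable lborel" "f \<in> borel_measurable lborel"
    using s f by (auto simp: L2_def)
  define t where "t n = (if s n \<in> L2 then s n else f)" for n
  have "\<forall>\<^sub>F n in sequentially. (\<integral>\<^sup>+x. ennreal ((cmod (s n x - f x))\<^sup>2) \<partial>lborel) < 1"
    using c unfolding L2_conv_def by (rule order_tendstoD) simp
  then have ev: "\<forall>\<^sub>F n in sequentially. t n = s n"
  proof eventually_elim
    case (elim n)
    then have "(\<integral>\<^sup>+x. ennreal ((cmod (s n x - f x))\<^sup>2) \<partial>lborel) < \<infinity>"
      using less_trans by fastforce
    then have "(\<lambda>x. s n x - f x) \<in> sqi lborel"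
      by (intro sqiI) (auto simp: integrable_iff_bounded)
    from sqi_add[OF this f[unfolded L2_eq_sqi]] have "s n \<in> L2" by (simp add: L2_eq_sqi)
    then show ?case by (simp add: t_def)
  qed
  have "L2_conv t f"
    unfolding L2_conv_def
    by (rule Lim_transform_eventually[OF c[unfolded L2_conv_def]]) (use ev in \<open>eventually_elim, simp\<close>)
  moreover have t: "t n \<in> L2" for n using f by (simp add: t_def)
  ultimately have "sconv lborel t f" using f by (simp add: L2_conv_iff_sconv)
  then have "(\<lambda>n. ipL h (t n)) \<longlonglongrightarrow> ipL h f"
    using t f h by (intro sconv_ip) (auto simp: L2_eq_sqi)
  then show ?thesis
    by (rule Lim_transform_eventually) (use ev in \<open>eventually_elim, simp\<close>)
qed

text \<open>
  The weights \<open>2\<^sup>k\<close> replace Minkowski's inequality: \<open>\<bar>g\<^sub>k\<bar> \<le> (2\<^sup>-\<^sup>k + 2\<^sup>k\<bar>g\<^sub>k\<bar>\<^sup>2) / 2\<close> makes the series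
  converge absolutely almost everywhere.
\<close>

lemma sqi_complete:
  fixes g :: "nat \<Rightarrow> 'a \<Rightarrow> complex"
  assumes g: "\<And>k. g k \<in> sqi M" and sm: "summable (\<lambda>k. 2 ^ k * nsq M (g k))"
  shows "\<exists>f \<in> sqi M. sconv M (\<lambda>n x. \<Sum>k<n. g k x) f"
proof -
  have [measurable]: "g k \<in> borel_measurable M" for k using g by (rule sqi_measurable)
  define Q where "Q k x = 2 ^ k * (cmod (g k x))\<^sup>2" for k x
  have Qint: "integrable M (Q k)" for k unfolding Q_def by (intro integrable_mult_right sqi_integrable g)
  have [measurable]: "Q k \<in> borel_measurable M" for k unfolding Q_def by measurable
  have Qnn: "(\<integral>\<^sup>+x. ennreal (Q k x) \<partial>M) = ennreal (2 ^ k * nsq M (g k))" for k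
    using Qint[of k] by (subst nn_integral_eq_integral) (auto simp: Q_def[abs_def] nsq_def)
  have Qsum: "(\<integral>\<^sup>+x. (\<Sum>k. ennreal (Q k x)) \<partial>M) = ennreal (\<Sum>k. 2 ^ k * nsq M (g k))"
  proof -
    have "(\<integral>\<^sup>+x. (\<Sum>k. ennreal (Q k x)) \<partial>M) = (\<Sum>k. \<integral>\<^sup>+x. ennreal (Q k x) \<partial>M)"
      by (rule nn_integral_suminf) (simp add: Q_def[abs_def])
    also have "\<dots> = ennreal (\<Sum>k. 2 ^ k * nsq M (g k))"
      unfolding Qnn by (rule suminf_ennreal2) (use sm in auto)
    finally show ?thesis .
  qed
  have "AE x in M. (\<Sum>k. ennreal (Q k x)) \<noteq> \<infinity>"
    by (rule nn_integral_PInf_AE) (simp_all add: Qsum)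
  then have Qs: "AE x in M. summable (\<lambda>k. Q k x)"
    by eventually_elim (auto intro!: summable_suminf_not_top simp: Q_def)
  have tailb: "(cmod (\<Sum>j. g (j + n) x))\<^sup>2 \<le> 2 * (1/2) ^ n * (\<Sum>k. Q (k + n) x)" 
    and summ: "summable (\<lambda>k. cmod (g k x))" if "summable (\<lambda>k. Q k x)" for x n
  proof -
    \<comment> \<open>Young's inequality with a free parameter \<open>e\<close>: the value 1 gives
      absolute convergence, an optimal value the tail bound.\<close>
    have b: "cmod (g k x) \<le> e / 2 * (1/2) ^ k + 1 / (2 * e) * Q k x" if "e > 0" for k e
    proof -
      define w where "w = ((1/2::real)) ^ k"
      have w: "w > 0" "2 ^ k = 1 / w" by (simp_all add: w_def power_divide)
      have "2 * (w * e) * (cmod (g k x)) \<le> (w * e)\<^sup>2 + (cmod (g k x))\<^sup>2"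
        by (rule sum_squares_bound)
      then have "cmod (g k x) \<le> e / 2 * w + 1 / (2 * e) * (1 / w * (cmod (g k x))\<^sup>2)"
        using that w(1) by (simp add: field_simps power2_eq_square)
      then show ?thesis unfolding Q_def w(2) by (simp add: w_def)
    qed
    show s: "summable (\<lambda>k. cmod (g k x))"
      by (rule summable_comparison_test'[where N = 0 and g = "\<lambda>k. 1 / 2 * (1/2) ^ k + 1 / 2 * Q k x"])
         (use b[of 1] that in \<open>auto intro!: summable_add summable_mult\<close>)
    let ?A = "\<Sum>k. cmod (g (k + n) x)" and ?B = "\<Sum>k. Q (k + n) x"
    have Qn: "summable (\<lambda>k. Q (k + n) x)" using that by (rule summable_ignore_initial_segment)
    have gn: "summable (\<lambda>k. cmod (g (k + n) x))" using s by (rule summable_ignore_initial_segment)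
    have B0: "?B \<ge> 0" using Qn by (intro suminf_nonneg) (auto simp: Q_def)
    have A0: "?A \<ge> 0" using gn by (intro suminf_nonneg) auto
    have ineq: "?A \<le> e * (1/2) ^ n + 1 / (2 * e) * ?B" if e: "e > 0" for e
    proof -
      have gs: "summable (\<lambda>k. (1/2::real) ^ (k + n))" "(\<Sum>k. (1/2::real) ^ (k + n)) = 2 * (1/2) ^ n"
        by (auto simp: power_add suminf_mult2[symmetric] suminf_geometric intro!: summable_mult2)
      have "?A \<le> (\<Sum>k. e / 2 * (1/2) ^ (k + n) + 1 / (2 * e) * Q (k + n) x)"
        by (rule suminf_le[OF b[OF e]])
           (use gn Qn gs(1) in \<open>auto intro!: summable_add summable_mult summable_divide\<close>)
      also have "\<dots> = e / 2 * (\<Sum>k. (1/2) ^ (k + n)) + 1 / (2 * e) * ?B"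
        using gs(1) Qn by (simp only: suminf_add[symmetric] suminf_mult summable_mult)
      finally show ?thesis using gs(2) by simp
    qed
    have "?A\<^sup>2 \<le> 2 * (1/2) ^ n * ?B"
    proof (cases "?B = 0")
      case True
      then have "?A \<le> e * (1/2)^n" if "e > 0" for e using ineq[OF that] by simp
      then have "?A \<le> 0 + e" if "e > 0" for e
        using that[THEN divide_pos_pos, of "(1/2)^n"] by (metis add_0 divide_pos_pos half_gt_zero_iff nonzero_divide_eq_eq order_less_irrefl that zero_less_one zero_less_power)
      then have "?A \<le> 0" by (rule field_le_epsilon)
      then show ?thesis using A0 True by simp
    next
      case False
      with B0 have B: "?B > 0" by simp
      define w where "w = ((1/2::real)) ^ n"
      have w: "w > 0" by (simp add: w_def)
      \<comment> \<open>The minimizer of the right side of \<open>ineq\<close>; it makes both terms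
        equal to \<open>e * w\<close>.\<close>
      define e where "e = sqrt (?B / (2 * w))"
      have e: "e > 0" using B w by (simp add: e_def)
      have e2: "e\<^sup>2 = ?B / (2 * w)" using B w by (simp add: e_def)
      have "?A \<le> e * w + 1 / (2 * e) * ?B" using ineq[OF e] by (simp add: w_def)
      also have "1 / (2 * e) * ?B = e * w" using e e2 w by (simp add: field_simps power2_eq_square)
      finally have "?A\<^sup>2 \<le> (2 * (e * w))\<^sup>2" using A0 by (intro power_mono) auto
      also have "\<dots> = 2 * w * ?B" using e2 w by (simp add: power_mult_distrib field_simps power2_eq_square)
      finally show ?thesis by (simp add: w_def)
    qed
    moreover have "(cmod (\<Sum>j. g (j + n) x))\<^sup>2 \<le> ?A\<^sup>2"
      using gn by (intro power_mono summable_norm) auto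
    ultimately show "(cmod (\<Sum>j. g (j + n) x))\<^sup>2 \<le> 2 * (1/2) ^ n * ?B" by linarith
  qed
  define f where "f x = lim (\<lambda>n. \<Sum>k<n. g k x)" for x
  have fm [measurable]: "f \<in> borel_measurable M" unfolding f_def by measurable
  have bd: "(\<integral>\<^sup>+x. ennreal ((cmod (f x - (\<Sum>k<n. g k x)))\<^sup>2) \<partial>M) \<le>
      ennreal (2 * (1/2) ^ n * (\<Sum>k. 2 ^ k * nsq M (g k)))" for n
  proof -
    have "(\<integral>\<^sup>+x. ennreal ((cmod (f x - (\<Sum>k<n. g k x)))\<^sup>2) \<partial>M) \<le>
      (\<integral>\<^sup>+x. ennreal (2 * (1/2) ^ n) * (\<Sum>k. ennreal (Q k x)) \<partial>M)"
    proof (rule nn_integral_mono_AE, use Qs in eventually_elim)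
      case (elim x)
      have s: "summable (\<lambda>k. g k x)" using summ[OF elim] by (rule summable_norm_cancel)
      have "f x - (\<Sum>k<n. g k x) = (\<Sum>j. g (j + n) x)"
        using limI[OF summable_LIMSEQ[OF s]] suminf_split_initial_segment[OF s, of n] by (simp add: f_def)
      then have "(cmod (f x - (\<Sum>k<n. g k x)))\<^sup>2 \<le> 2 * (1/2) ^ n * (\<Sum>k. Q (k + n) x)"
        using tailb[OF elim, of n] by simp
      also have "\<dots> \<le> 2 * (1/2) ^ n * (\<Sum>k. Q k x)"
      proof (intro mult_left_mono)
        have "0 \<le> (\<Sum>k<n. Q k x)" by (intro sum_nonneg) (simp add: Q_def)
        then show "(\<Sum>k. Q (k + n) x) \<le> (\<Sum>k. Q k x)"
          using suminf_split_initial_segment[OF elim, of n] by simp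
      qed simp
      finally show ?case using elim
        by (subst suminf_ennreal2) (auto simp: Q_def ennreal_mult'[symmetric] intro: ennreal_leI)
    qed
    also have "\<dots> = ennreal (2 * (1/2) ^ n * (\<Sum>k. 2 ^ k * nsq M (g k)))"
      by (subst nn_integral_cmult) (simp_all add: Qsum ennreal_mult')
    finally show ?thesis .
  qed
  have fS: "(\<lambda>x. f x - (\<Sum>k<n. g k x)) \<in> sqi M" for n
    using bd[of n] by (intro sqiI) (auto simp: integrable_iff_bounded top.extremum_strict le_less_trans[OF bd])
  have f: "f \<in> sqi M" using fS[of 0] by simp
  have "nsq M (\<lambda>x. (\<Sum>k<n. g k x) - f x) \<le> 2 * (1/2) ^ n * (\<Sum>k. 2 ^ k * nsq M (g k))" for n
  proof -
    have "0 \<le> (\<Sum>k. 2 ^ k * nsq M (g k))" using sm by (intro suminf_nonneg) auto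
    then show ?thesis
      using bd[of n] nn_integral_eq_nsq[OF fS[of n]] nsq_minus_commute[of M f "\<lambda>x. \<Sum>k<n. g k x"] by simp
  qed
  moreover have "(\<lambda>n. 2 * (1/2) ^ n * (\<Sum>k. 2 ^ k * nsq M (g k))) \<longlonglongrightarrow> 0"
    by (intro tendsto_mult_left_zero tendsto_mult_right_zero LIMSEQ_realpow_zero) auto
  ultimately have "sconv M (\<lambda>n x. \<Sum>k<n. g k x) f"
    unfolding sconv_def by (intro Lim_null_comparison[where f = "\<lambda>n. nsq M (\<lambda>x. (\<Sum>k<n. g k x) - f x)"]) auto
  with f show ?thesis by blast
qed

section \<open>Orthonormal bases\<close>

locale hilbert_basis =
  fixes M :: "'a measure" and e :: "nat \<Rightarrow> 'a \<Rightarrow> complex"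
  assumes e_sqi [simp, intro]: "e n \<in> sqi M"
    and e_orthonormal: "ip M (e m) (e n) = (if m = n then 1 else 0)"
    and e_total: "f \<in> sqi M \<Longrightarrow> (\<And>n. ip M (e n) f = 0) \<Longrightarrow> AE x in M. f x = 0"
begin

definition psum :: "(nat \<Rightarrow> complex) \<Rightarrow> nat \<Rightarrow> 'a \<Rightarrow> complex" where
  "psum c N x = (\<Sum>n<N. c n * e n x)"

lemma psum_sqi [simp, intro]: "psum c N \<in> sqi M"
  unfolding psum_def[abs_def] by (intro sqi_sum sqi_cmult e_sqi)

lemma eqI_AE:
  assumes "f \<in> sqi M" "g \<in> sqi M" "\<And>n. ip M (e n) f = ip M (e n) g"
  shows "AE x in M. f x = g x"
  using e_total[of "\<lambda>x. f x - g x"] assms by (simp add: sqi_diff ip_diff_right)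

lemma ip_block:
  assumes "f \<in> sqi M" shows "ip M f (\<lambda>x. \<Sum>n\<in>I. c n * e n x) = (\<Sum>n\<in>I. c n * ip M f (e n))"
  using assms by (simp add: ip_sum_right sqi_cmult ip_cmult_right)

lemma nsq_block:
  assumes "finite I" shows "nsq M (\<lambda>x. \<Sum>n\<in>I. c n * e n x) = (\<Sum>n\<in>I. (cmod (c n))\<^sup>2)"
proof -
  let ?g = "\<lambda>x. \<Sum>n\<in>I. c n * e n x"
  have g: "?g \<in> sqi M" by (intro sqi_sum sqi_cmult e_sqi)
  have "of_real (nsq M ?g) = (\<Sum>n\<in>I. c n * cnj (ip M (e n) ?g))"
  proof -
    have "ip M ?g (e n) = cnj (ip M (e n) ?g)" for n by (rule ip_commute)
    then show ?thesis unfolding ip_self[symmetric] ip_block[OF g] by simp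
  qed
  also have "\<dots> = (\<Sum>n\<in>I. c n * cnj (\<Sum>m\<in>I. c m * (if n = m then 1 else 0)))"
    by (simp add: ip_block e_orthonormal)
  also have "\<dots> = (\<Sum>n\<in>I. c n * cnj (c n))"
    using assms by (intro sum.cong refl) (simp add: if_distrib[of "\<lambda>x. _ * x"] sum.delta cong: if_cong)
  also have "\<dots> = of_real (\<Sum>n\<in>I. (cmod (c n))\<^sup>2)"
    by (simp only: of_real_sum complex_norm_square)
  finally show ?thesis by (simp only: of_real_eq_iff)
qed

lemma ip_psum: "f \<in> sqi M \<Longrightarrow> ip M f (psum c N) = (\<Sum>n<N. c n * ip M f (e n))"
  unfolding psum_def[abs_def] by (rule ip_block)

lemma nsq_psum: "nsq M (psum c N) = (\<Sum>n<N. (cmod (c n))\<^sup>2)"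
  unfolding psum_def[abs_def] by (rule nsq_block) simp

lemma ip_e_psum: "ip M (e k) (psum c N) = (if k < N then c k else 0)"
  by (simp add: ip_psum e_orthonormal if_distrib[of "\<lambda>x. _ * x"] sum.delta cong: if_cong)

lemma nsq_diff_psum:
  assumes f: "f \<in> sqi M" and c: "\<And>n. ip M (e n) f = c n"
  shows "nsq M (\<lambda>x. f x - psum c N x) = nsq M f - (\<Sum>n<N. (cmod (c n))\<^sup>2)"
proof -
  have "ip M f (e n) = cnj (c n)" for n using ip_commute[of M f "e n"] c by simp
  then have "ip M f (psum c N) = (\<Sum>n<N. c n * cnj (c n))"
    using f by (simp add: ip_psum)
  also have "\<dots> = of_real (\<Sum>n<N. (cmod (c n))\<^sup>2)"
    by (simp only: of_real_sum complex_norm_square)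
  finally show ?thesis
    using nsq_diff_expand[OF f psum_sqi, of c N] by (simp add: nsq_psum)
qed

lemma coeff_summable: "f \<in> sqi M \<Longrightarrow> summable (\<lambda>n. (cmod (ip M (e n) f))\<^sup>2)"
proof (rule summableI_nonneg_bounded[where x = "nsq M f"])
  fix N assume f: "f \<in> sqi M"
  show "(\<Sum>n<N. (cmod (ip M (e n) f))\<^sup>2) \<le> nsq M f"
    using nsq_diff_psum[OF f refl, of N] nsq_nonneg[of M "\<lambda>x. f x - psum (\<lambda>n. ip M (e n) f) N x"]
    by linarith
qed simp

text \<open>\<open>sqi_complete\<close> asks for geometric decay, so the series is cut into blocks
  whose coefficient tails are below 4^(-k). This gives a limit along a subsequence of partial sums;
  the error of the full sequence is decreasing by Pythagoras and hence tends to 0 as well.\<close>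

lemma riesz_fischer:
  assumes sm: "summable (\<lambda>n. (cmod (c n))\<^sup>2)"
  shows "\<exists>f \<in> sqi M. (\<forall>n. ip M (e n) f = c n) \<and> sconv M (psum c) f"
proof -
  let ?a = "\<lambda>n. (cmod (c n))\<^sup>2"
  have "\<forall>k. \<exists>N. \<forall>n\<ge>N. norm (\<Sum>i. ?a (i + n)) < (1/4) ^ Suc k"
    by (intro allI suminf_exist_split[OF _ sm]) simp
  then obtain N where N: "\<And>k n. n \<ge> N k \<Longrightarrow> norm (\<Sum>i. ?a (i + n)) < (1/4) ^ Suc k" by metis
  \<comment> \<open>The \<open>Suc\<close> makes the cut points strictly increasing, so that
    \<open>r k\<close> is at least \<open>k\<close>, and \<open>r (Suc k)\<close> lies beyond
    \<open>N k\<close>.\<close>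
  define r where "r k = (\<Sum>j<k. Suc (N j))" for k
  have rS: "r (Suc k) = r k + Suc (N k)" for k by (simp add: r_def)
  have rk: "k \<le> r k" for k by (induction k) (auto simp: rS)
  define g where "g k x = (\<Sum>n\<in>{r k..<r (Suc k)}. c n * e n x)" for k x
  have gs: "g k \<in> sqi M" for k unfolding g_def[abs_def] by (intro sqi_sum sqi_cmult e_sqi)
  have gsum: "(\<Sum>k<n. g k x) = psum c (r n) x" for n x
  proof (induction n)
    case (Suc n)
    have "psum c (r (Suc n)) x = psum c (r n) x + g n x"
      unfolding psum_def g_def lessThan_atLeast0 by (subst sum.atLeastLessThan_concat) (auto simp: rS)
    then show ?case using Suc by simp
  qed (simp add: r_def psum_def)
  define T where "T = (\<Sum>i. ?a i)"
  have T0: "T \<ge> 0" unfolding T_def using sm by (intro suminf_nonneg) auto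
  have gb: "nsq M (g k) \<le> (1 + T) * (1/4) ^ k" for k
  proof -
    have sk: "summable (\<lambda>i. ?a (i + r k))" using sm by (rule summable_ignore_initial_segment)
    have "nsq M (g k) = (\<Sum>n\<in>{r k..<r (Suc k)}. ?a n)"
      unfolding g_def[abs_def] by (rule nsq_block) simp
    also have "\<dots> = (\<Sum>i\<in>{0..<r (Suc k) - r k}. ?a (i + r k))"
      using sum.shift_bounds_nat_ivl[of ?a 0 "r k" "Suc (N k)"]
      by (simp add: rS add.commute[of "r k"] del: sum.op_ivl_Suc)
    also have "\<dots> \<le> (\<Sum>i. ?a (i + r k))"
      by (rule sum_le_suminf[OF sk]) auto
    also have "\<dots> \<le> (1 + T) * (1/4) ^ k"
    proof (cases k)
      case 0
      then show ?thesis using T0 by (simp add: r_def T_def)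
    next
      case (Suc j)
      have "(\<Sum>i. ?a (i + r k)) \<le> (1/4) ^ k"
        using N[of j "r k"] Suc by (simp add: rS)
      also have "\<dots> \<le> (1 + T) * (1/4) ^ k" using T0 by (simp add: field_simps)
      finally show ?thesis .
    qed
    finally show ?thesis .
  qed
  have "summable (\<lambda>k. 2 ^ k * nsq M (g k))"
  proof (rule summable_comparison_test'[where N = 0])
    show "summable (\<lambda>k. (1 + T) * (1/2::real) ^ k)" by (intro summable_mult summable_geometric) simp
    fix k
    have "2 ^ k * nsq M (g k) \<le> 2 ^ k * ((1 + T) * (1/4) ^ k)" by (intro mult_left_mono gb) simp
    also have "\<dots> = (1 + T) * (2 * (1/4)) ^ k" unfolding power_mult_distrib by simp
    finally show "norm (2 ^ k * nsq M (g k)) \<le> (1 + T) * (1/2) ^ k" by simp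
  qed
  from sqi_complete[OF gs this] obtain f where f: "f \<in> sqi M" and cv: "sconv M (\<lambda>n. psum c (r n)) f"
    unfolding gsum by blast
  have fc: "ip M (e n) f = c n" for n
  proof (rule LIMSEQ_unique)
    show "(\<lambda>k. ip M (e n) (psum c (r k))) \<longlonglongrightarrow> ip M (e n) f"
      by (rule sconv_ip[OF _ f _ cv]) auto
    have "\<forall>\<^sub>F k in sequentially. c n = ip M (e n) (psum c (r k))"
      using eventually_gt_at_top[of n] by eventually_elim (use rk le_less_trans in \<open>auto simp: ip_e_psum intro: less_le_trans\<close>)
    then show "(\<lambda>k. ip M (e n) (psum c (r k))) \<longlonglongrightarrow> c n"
      by (rule Lim_transform_eventually[OF tendsto_const])
  qed
  define d where "d n = nsq M (\<lambda>x. psum c n x - f x)" for n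
  have dd: "d n = nsq M f - (\<Sum>n<n. ?a n)" for n
    using nsq_diff_psum[OF f fc, of n] by (simp add: d_def nsq_minus_commute)
  have anti: "d m \<le> d n" if "n \<le> m" for m n
    unfolding dd using that by (auto intro!: sum_mono2)
  have dr: "(\<lambda>k. d (r k)) \<longlonglongrightarrow> 0" using cv by (simp add: sconv_def d_def)
  have "d \<longlonglongrightarrow> 0"
  proof (rule decreasing_tendsto)
    show "\<forall>\<^sub>F n in sequentially. 0 \<le> d n" by (simp add: d_def)
    fix x :: real assume "0 < x"
    then obtain k where k: "d (r k) < x"
      using order_tendstoD(2)[OF dr, of x] eventually_happens' sequentially_bot by blast
    show "\<forall>\<^sub>F n in sequentially. d n < x"
      using eventually_ge_at_top[of "r k"] by eventually_elim (use anti k in \<open>force intro: le_less_trans\<close>)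
  qed
  then show ?thesis using f fc by (intro bexI[of _ f]) (auto simp: sconv_def d_def[abs_def])
qed

text \<open>The function that \<open>riesz_fischer\<close> builds from the coefficients of
  \<open>f\<close> has the same coefficients, so totality identifies it with \<open>f\<close> almost
  everywhere.\<close>

lemma sconv_psum:
  assumes "f \<in> sqi M" shows "sconv M (psum (\<lambda>n. ip M (e n) f)) f"
proof -
  obtain g where g: "g \<in> sqi M" "\<And>n. ip M (e n) g = ip M (e n) f" "sconv M (psum (\<lambda>n. ip M (e n) f)) g"
    using riesz_fischer[OF coeff_summable[OF assms]] by blast
  have ae: "AE x in M. f x = g x" using g assms by (intro eqI_AE) auto
  have "nsq M (\<lambda>x. psum c n x - f x) = nsq M (\<lambda>x. psum c n x - g x)" for c n
  proof (rule nsq_cong_AE)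
    show "(\<lambda>x. psum c n x - f x) \<in> borel_measurable M" "(\<lambda>x. psum c n x - g x) \<in> borel_measurable M"
      by (intro sqi_measurable[of _ M] sqi_diff psum_sqi assms g(1))+
    show "AE x in M. psum c n x - f x = psum c n x - g x" using ae by eventually_elim simp
  qed
  then show ?thesis using g(3) by (simp add: sconv_def)
qed

lemma parseval:
  assumes "f \<in> sqi M" "g \<in> sqi M"
  shows "(\<lambda>n. cnj (ip M (e n) f) * ip M (e n) g) sums ip M f g"
proof -
  have "ip M f (e n) = cnj (ip M (e n) f)" for n by (rule ip_commute)
  then show ?thesis
    using sconv_ip[OF psum_sqi assms(2,1) sconv_psum[OF assms(2)]] assms(1)
    by (simp add: sums_def ip_psum mult.commute)
qed

definition syn :: "(nat \<Rightarrow> complex) \<Rightarrow> 'a \<Rightarrow> complex" where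
  "syn c = (SOME f. f \<in> sqi M \<and> (\<forall>n. ip M (e n) f = c n))"

lemma
  assumes "summable (\<lambda>n. (cmod (c n))\<^sup>2)"
  shows syn_sqi: "syn c \<in> sqi M" and ip_e_syn: "ip M (e n) (syn c) = c n"
proof -
  have "\<exists>f. f \<in> sqi M \<and> (\<forall>n. ip M (e n) f = c n)" using riesz_fischer[OF assms] by blast
  from someI_ex[OF this] show "syn c \<in> sqi M" "ip M (e n) (syn c) = c n" unfolding syn_def by auto
qed

end

section \<open>Unitary diagonalization and functional calculus\<close>

lemmas L2_diff = sqi_diff[where M = "lborel :: real measure", folded L2_eq_sqi]
lemmas L2_cmult = sqi_cmult[where M = "lborel :: real measure", folded L2_eq_sqi]

text \<open>\<open>V\<close> acts on representatives, so it can be linear only up to null sets.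
  Preservation of inner products and a right inverse already make it unitary on classes; linearity
  is derived below.\<close>

locale diagonalization =
  fixes M :: "'b measure" and V :: "(real \<Rightarrow> complex) \<Rightarrow> 'b \<Rightarrow> complex"
    and W :: "('b \<Rightarrow> complex) \<Rightarrow> real \<Rightarrow> complex"
  assumes V_sqi: "f \<in> L2 \<Longrightarrow> V f \<in> sqi M"
    and W_L2: "F \<in> sqi M \<Longrightarrow> W F \<in> L2"
    and V_W: "F \<in> sqi M \<Longrightarrow> AE x in M. V (W F) x = F x"
    and ip_V: "f \<in> L2 \<Longrightarrow> g \<in> L2 \<Longrightarrow> ip M (V f) (V g) = ipL f g"
begin

lemma V_measurable: "f \<in> L2 \<Longrightarrow> V f \<in> borel_measurable M"
  using V_sqi sqi_measurable by blast

lemma nsq_V: "f \<in> L2 \<Longrightarrow> nsq M (V f) = nsq lborel f"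
  using ip_V[of f f] by (simp add: ip_self)

text \<open>Expanding both squares into inner products gives the isometry on differences before
  linearity of \<open>V\<close> is available.\<close>

lemma nsq_V_diff: "f \<in> L2 \<Longrightarrow> g \<in> L2 \<Longrightarrow> nsq M (\<lambda>x. V f x - V g x) = nsq lborel (\<lambda>x. f x - g x)"
  using nsq_diff_expand[OF V_sqi V_sqi, of f g] nsq_diff_expand[of f lborel g]
  by (simp add: nsq_V ip_V L2_eq_sqi)

lemma V_cong_iff:
  assumes "f \<in> L2" "g \<in> L2"
  shows "(AE x in M. V f x = V g x) \<longleftrightarrow> (AE x in lborel. f x = g x)"
proof
  assume "AE x in M. V f x = V g x"
  then have "nsq M (\<lambda>x. V f x - V g x) = 0" by (intro nsq_AE_0) simp
  then have "nsq lborel (\<lambda>x. f x - g x) = 0" using assms by (simp add: nsq_V_diff)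
  then show "AE x in lborel. f x = g x"
    using assms nsq_eq_0D[of "\<lambda>x. f x - g x" lborel] by (simp add: L2_eq_sqi sqi_diff)
next
  assume "AE x in lborel. f x = g x"
  then have "nsq lborel (\<lambda>x. f x - g x) = 0" by (intro nsq_AE_0) simp
  then have "nsq M (\<lambda>x. V f x - V g x) = 0" using assms by (simp add: nsq_V_diff)
  then show "AE x in M. V f x = V g x"
    using assms nsq_eq_0D[of "\<lambda>x. V f x - V g x" M] by (simp add: V_sqi sqi_diff)
qed

text \<open>The difference \<open>u\<close> of the two sides equals \<open>V (W u)\<close> almost
  everywhere, so testing against the range of \<open>V\<close> includes testing \<open>u\<close>
  against itself.\<close>

lemma V_eqI:
  assumes G: "G \<in> sqi M" and f: "f \<in> L2" and eq: "\<And>k. k \<in> L2 \<Longrightarrow> ip M (V k) G = ipL k f"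
  shows "AE x in M. V f x = G x"
proof -
  let ?u = "\<lambda>x. V f x - G x"
  have u: "?u \<in> sqi M" by (intro sqi_diff V_sqi f G)
  have "ip M ?u ?u = ip M (V (W ?u)) ?u"
    by (rule ip_cong_AE) (use u V_W[OF u] W_L2 V_sqi in \<open>auto intro: sqi_measurable\<close>)
  also have "\<dots> = 0"
    using W_L2[OF u] eq f G by (simp add: ip_diff_right V_sqi ip_V)
  finally have "nsq M ?u = 0" by (simp add: ip_self)
  from nsq_eq_0D[OF u this] show ?thesis by simp
qed

lemma V_cmult:
  assumes "f \<in> L2" shows "AE x in M. V (\<lambda>x. c * f x) x = c * V f x"
  using assms by (intro V_eqI) (auto simp: ip_cmult_right V_sqi ip_V sqi_cmult L2_cmult)

lemma V_sum:
  assumes "finite I" "\<And>i. i \<in> I \<Longrightarrow> f i \<in> L2"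
  shows "AE x in M. V (\<lambda>x. \<Sum>i\<in>I. f i x) x = (\<Sum>i\<in>I. V (f i) x)"
  using assms by (intro V_eqI) (auto simp: ip_sum_right V_sqi ip_V sqi_sum L2_eq_sqi)

definition dg :: "('b \<Rightarrow> complex) \<Rightarrow> oper" where
  "dg m = {(f, g) \<in> L2 \<times> L2. AE x in M. V g x = m x * V f x}"

lemma dg_iff: "(f, g) \<in> dg m \<longleftrightarrow> f \<in> L2 \<and> g \<in> L2 \<and> (AE x in M. V g x = m x * V f x)"
  by (auto simp: dg_def)

lemma dg_cong: "(\<And>x. m x = n x) \<Longrightarrow> dg m = dg n"
  by (simp add: dg_def)

lemma dg_closed_right:
  assumes "(f, g) \<in> dg m" "g' \<in> L2" "AE x in lborel. g x = g' x"
  shows "(f, g') \<in> dg m"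
proof -
  have "AE x in M. V g x = V g' x" using assms by (simp add: V_cong_iff dg_iff)
  moreover have "AE x in M. V g x = m x * V f x" using assms by (simp add: dg_iff)
  ultimately have "AE x in M. V g' x = m x * V f x" by eventually_elim simp
  then show ?thesis using assms by (simp add: dg_iff)
qed

lemma dg_exists:
  assumes "f \<in> L2" "(\<lambda>x. m x * V f x) \<in> sqi M"
  shows "\<exists>g. (f, g) \<in> dg m"
  using W_L2[OF assms(2)] V_W[OF assms(2)] assms(1) by (auto simp: dg_iff)

lemma dg_total:
  assumes "m \<in> borel_measurable M" "\<And>x. cmod (m x) \<le> C" "f \<in> L2"
  shows "\<exists>g. (f, g) \<in> dg m"
  using assms by (intro dg_exists sqi_mult_bounded V_sqi) auto

text \<open>Boundedness puts every \<open>k\<close> into the domain of \<open>dg m\<close>, so the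
  adjoint relation can be tested against all of L^2 and \<open>V_eqI\<close> applies.\<close>

lemma adj_dg:
  assumes m [measurable]: "m \<in> borel_measurable M" and b: "\<And>x. cmod (m x) \<le> C"
  shows "adj (dg m) = dg (\<lambda>x. cnj (m x))"
proof (intro set_eqI iffI)
  fix p assume p: "p \<in> adj (dg m)"
  obtain g h where gh: "p = (g, h)" by (cases p)
  with p have g: "g \<in> L2" and h: "h \<in> L2"
    and a: "\<And>f f'. (f, f') \<in> dg m \<Longrightarrow> ipL g f' = ipL h f"
    by (auto simp: adj_def L2_inner_eq_ip)
  have [measurable]: "V g \<in> borel_measurable M" using g by (rule V_measurable)
  have "AE x in M. V h x = cnj (m x) * V g x"
  proof (rule V_eqI)
    show "(\<lambda>x. cnj (m x) * V g x) \<in> sqi M" by (rule sqi_mult_bounded) (use b g V_sqi in auto)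
    fix k assume k: "k \<in> L2"
    obtain k' where k': "(k, k') \<in> dg m" using dg_total[OF m b k] by blast
    have [measurable]: "V k \<in> borel_measurable M" "V k' \<in> borel_measurable M"
      using k k' by (auto simp: dg_iff V_measurable)
    have "ip M (V k) (\<lambda>x. cnj (m x) * V g x) = ip M (\<lambda>x. m x * V k x) (V g)"
      by (simp add: ip_def mult_ac)
    also have "\<dots> = ip M (V k') (V g)"
      using k' by (intro ip_cong_AE) (auto simp: dg_iff)
    also have "\<dots> = ipL k' g" using k' g by (simp add: ip_V dg_iff)
    also have "\<dots> = ipL k h"
      using a[OF k'] ip_commute[of lborel k' g] ip_commute[of lborel k h] by simp
    finally show "ip M (V k) (\<lambda>x. cnj (m x) * V g x) = ipL k h" .
  qed (rule h)
  then show "p \<in> dg (\<lambda>x. cnj (m x))" using g h by (simp add: gh dg_iff)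
next
  fix p assume p: "p \<in> dg (\<lambda>x. cnj (m x))"
  obtain g h where gh: "p = (g, h)" by (cases p)
  with p have g: "g \<in> L2" and h: "h \<in> L2" and e: "AE x in M. V h x = cnj (m x) * V g x"
    by (auto simp: dg_iff)
  have "ipL g f' = ipL h f" if f: "(f, f') \<in> dg m" for f f'
  proof -
    have [measurable]: "V g \<in> borel_measurable M" "V h \<in> borel_measurable M"
       "V f \<in> borel_measurable M" "V f' \<in> borel_measurable M"
      using f g h by (auto simp: dg_iff V_measurable)
    have "ipL g f' = ip M (V g) (V f')" using f g by (simp add: ip_V dg_iff)
    also have "\<dots> = ip M (V g) (\<lambda>x. m x * V f x)"
      using f by (intro ip_cong_AE) (auto simp: dg_iff)
    also have "\<dots> = ip M (\<lambda>x. cnj (m x) * V g x) (V f)" by (simp add: ip_def mult_ac)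
    also have "\<dots> = ip M (V h) (V f)"
      using e by (intro ip_cong_AE) auto
    also have "\<dots> = ipL h f" using f h by (simp add: ip_V dg_iff)
    finally show ?thesis .
  qed
  then show "p \<in> adj (dg m)" using g h by (auto simp: gh adj_def L2_inner_eq_ip)
qed

text \<open>Boundedness of the factor applied first supplies the intermediate vector for every
  argument; otherwise the composition could have the smaller domain.\<close>

lemma dg_comp:
  assumes "m \<in> borel_measurable M" "\<And>x. cmod (m x) \<le> C"
  shows "dg n \<circ>\<^sub>o dg m = dg (\<lambda>x. n x * m x)"
proof (intro set_eqI iffI)
  fix p assume "p \<in> dg n \<circ>\<^sub>o dg m"
  then obtain f h g where p: "p = (f, g)" "(f, h) \<in> dg m" "(h, g) \<in> dg n" by auto
  then have "AE x in M. V h x = m x * V f x" "AE x in M. V g x = n x * V h x" by (auto simp: dg_iff)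
  then have "AE x in M. V g x = n x * m x * V f x" by eventually_elim simp
  then show "p \<in> dg (\<lambda>x. n x * m x)" using p by (simp add: dg_iff)
next
  fix p assume p: "p \<in> dg (\<lambda>x. n x * m x)"
  obtain f g where fg: "p = (f, g)" by (cases p)
  obtain h where h: "(f, h) \<in> dg m" using dg_total[OF assms, of f] p fg by (auto simp: dg_iff)
  have "AE x in M. V h x = m x * V f x" "AE x in M. V g x = n x * m x * V f x" 
    using h p by (auto simp: dg_iff fg)
  then have "AE x in M. V g x = n x * V h x" by eventually_elim simp
  then have "(h, g) \<in> dg n" using h p by (auto simp: dg_iff fg)
  then show "p \<in> dg n \<circ>\<^sub>o dg m" using h fg by auto
qed

lemma dg_one: "dg (\<lambda>_. 1) = mult_op (\<lambda>_. 1)"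
  by (auto simp: dg_def mult_op_def V_cong_iff)

text \<open>For \<open>c = 0\<close> the left side would keep the domain of \<open>dg m\<close>,
  while the right side would be defined everywhere.\<close>

lemma dg_scale:
  assumes "c \<noteq> 0" shows "c \<cdot>\<^sub>o dg m = dg (\<lambda>x. of_real c * m x)"
proof (intro set_eqI iffI)
  fix p assume "p \<in> c \<cdot>\<^sub>o dg m"
  then obtain f g h where p: "p = (f, g)" "f \<in> L2" "g \<in> L2" "(f, h) \<in> dg m"
    and ae: "AE x in lborel. g x = of_real c * h x" by (auto simp: op_scale_def)
  have h: "h \<in> L2" using p by (simp add: dg_iff)
  have "AE x in M. V g x = V (\<lambda>x. of_real c * h x) x"
    using ae p h by (subst V_cong_iff) (auto simp: L2_eq_sqi sqi_cmult)
  moreover have "AE x in M. V (\<lambda>x. of_real c * h x) x = of_real c * V h x" by (rule V_cmult[OF h])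
  moreover have "AE x in M. V h x = m x * V f x" using p by (simp add: dg_iff)
  ultimately have "AE x in M. V g x = of_real c * m x * V f x" by eventually_elim simp
  then show "p \<in> dg (\<lambda>x. of_real c * m x)" using p by (simp add: dg_iff)
next
  fix p assume p: "p \<in> dg (\<lambda>x. of_real c * m x)"
  obtain f g where fg: "p = (f, g)" by (cases p)
  have g: "g \<in> L2" and f: "f \<in> L2" using p fg by (auto simp: dg_iff)
  let ?h = "\<lambda>x. of_real (1 / c) * g x"
  have "AE x in M. V ?h x = of_real (1 / c) * V g x" by (rule V_cmult[OF g])
  moreover have "AE x in M. V g x = of_real c * m x * V f x" using p by (simp add: fg dg_iff)
  ultimately have "AE x in M. V ?h x = m x * V f x"
    by eventually_elim (use assms in simp)
  then have "(f, ?h) \<in> dg m" using f g by (simp add: dg_iff L2_eq_sqi sqi_cmult del: of_real_divide)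
  moreover have "AE x in lborel. g x = of_real c * ?h x" using assms by simp
  ultimately show "p \<in> c \<cdot>\<^sub>o dg m" using f g unfolding op_scale_def fg by blast
qed

section \<open>Spectral measure and functional calculus of a diagonal operator\<close>

definition spec :: "('b \<Rightarrow> real) \<Rightarrow> real set \<Rightarrow> oper" where
  "spec a B = dg (\<lambda>x. indicator B (a x))"

context
  fixes a :: "'b \<Rightarrow> real"
  assumes a [measurable]: "a \<in> borel_measurable M"
begin

lemma ind_measurable:
  assumes [measurable]: "B \<in> sets borel"
  shows "(\<lambda>x. indicator B (a x) :: complex) \<in> borel_measurable M"
  by measurable

lemma ind_bounded: "cmod (indicator B y) \<le> 1"
  by (simp add: indicator_def)

lemma spec_app:
  assumes "B \<in> sets borel" "f \<in> L2" shows "(f, op_app (spec a B) f) \<in> spec a B"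
  unfolding op_app_def spec_def
  by (rule someI_ex[OF dg_total[OF ind_measurable[OF assms(1)] ind_bounded assms(2)]])

lemma orth_projection_spec:
  assumes B: "B \<in> sets borel" shows "orth_projection (spec a B)"
  unfolding orth_projection_def
proof (intro conjI)
  show "Domain (spec a B) = L2"
    using spec_app[OF B] by (fastforce simp: spec_def dg_def)
  have c: "cnj (indicator B y) = indicator B y" for y :: real by (simp add: indicator_def)
  show "adj (spec a B) = spec a B"
    unfolding spec_def adj_dg[OF ind_measurable[OF B] ind_bounded] c ..
  show "spec a B \<circ>\<^sub>o spec a B = spec a B"
    unfolding spec_def dg_comp[OF ind_measurable[OF B] ind_bounded] indicator_inter_arith[symmetric] by simp
qed

lemma L2_conv_iff_V:
  assumes "\<And>n. s n \<in> L2" "g \<in> L2" "\<And>n. S n \<in> borel_measurable M" "\<And>n. AE x in M. V (s n) x = S n x"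
  shows "L2_conv s g \<longleftrightarrow> (\<lambda>n. \<integral>\<^sup>+x. ennreal ((cmod (S n x - V g x))\<^sup>2) \<partial>M) \<longlonglongrightarrow> 0"
proof -
  have "(\<integral>\<^sup>+x. ennreal ((cmod (S n x - V g x))\<^sup>2) \<partial>M) = (\<integral>\<^sup>+x. ennreal ((cmod (s n x - g x))\<^sup>2) \<partial>lborel)" for n
  proof -
    have "(\<integral>\<^sup>+x. ennreal ((cmod (S n x - V g x))\<^sup>2) \<partial>M) = (\<integral>\<^sup>+x. ennreal ((cmod (V (s n) x - V g x))\<^sup>2) \<partial>M)"
      by (rule nn_integral_cong_AE) (use assms(4)[of n] in \<open>eventually_elim, simp\<close>)
    also have "\<dots> = (\<integral>\<^sup>+x. ennreal ((cmod (s n x - g x))\<^sup>2) \<partial>lborel)"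
      using assms nsq_V_diff[of "s n" g]
      by (simp add: nn_integral_eq_nsq[OF sqi_diff[OF V_sqi V_sqi]]
          nn_integral_eq_nsq[OF L2_diff[unfolded L2_eq_sqi], folded L2_eq_sqi])
    finally show ?thesis .
  qed
  then show ?thesis by (simp add: L2_conv_def)
qed

text \<open>For countable additivity, the partial sums correspond to \<open>V f\<close> cut off to
  growing unions: pointwise eventually constant, with squared error at most |V f|^2, so dominated
  convergence applies.\<close>

lemma spectral_measure_spec: "spectral_measure (spec a)"
  unfolding spectral_measure_def
proof (intro conjI ballI allI impI orth_projection_spec)
  show "spec a UNIV = mult_op (\<lambda>_. 1)" by (simp add: spec_def flip: dg_one)
next
  fix B f g h
  assume "range B \<subseteq> sets borel \<and> disjoint_family B \<and> (\<forall>n::nat. (f, g n) \<in> spec a (B n)) \<and>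
     (f, h) \<in> spec a (\<Union>n. B n)"
  then have B [measurable]: "\<And>n. B n \<in> sets borel" and d: "disjoint_family B"
    and g: "\<And>n. (f, g n) \<in> spec a (B n)" and h: "(f, h) \<in> spec a (\<Union>n. B n)" by auto
  have f: "f \<in> L2" and gL: "\<And>n. g n \<in> L2" and hL: "h \<in> L2" using g h by (auto simp: spec_def dg_iff)
  have [measurable]: "V f \<in> borel_measurable M" "V h \<in> borel_measurable M" using f hL by (auto simp: V_measurable)
  have [measurable]: "(\<Union>n<N. B n) \<in> sets borel" for N by auto
  let ?S = "\<lambda>N x. indicator (\<Union>n<N. B n) (a x) * V f x"
  have sL: "(\<lambda>x. \<Sum>n<N. g n x) \<in> L2" for N using gL by (simp add: L2_eq_sqi sqi_sum)
  have S: "AE x in M. V (\<lambda>x. \<Sum>n<N. g n x) x = ?S N x" for N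
  proof -
    have "AE x in M. \<forall>n\<in>{..<N}. V (g n) x = indicator (B n) (a x) * V f x"
      using g by (intro AE_ball_countable') (auto simp: spec_def dg_iff)
    moreover have "AE x in M. V (\<lambda>x. \<Sum>n<N. g n x) x = (\<Sum>n<N. V (g n) x)"
      using gL by (intro V_sum) auto
    ultimately show ?thesis
    proof eventually_elim
      case (elim x)
      have "(indicator (\<Union>n<N. B n) (a x) :: complex) = (\<Sum>n<N. indicator (B n) (a x))"
        by (rule indicator_UN_disjoint) (use d in \<open>auto simp: disjoint_family_on_def\<close>)
      then show ?case using elim by (simp add: sum_distrib_right)
    qed
  qed
  have "(\<lambda>N. \<integral>\<^sup>+x. ennreal ((cmod (?S N x - V h x))\<^sup>2) \<partial>M) \<longlonglongrightarrow> (\<integral>\<^sup>+x. 0 \<partial>M)"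
  proof (rule nn_integral_dominated_convergence[where w = "\<lambda>x. ennreal ((cmod (V f x))\<^sup>2)"])
    have hae: "AE x in M. V h x = indicator (\<Union>n. B n) (a x) * V f x" using h by (simp add: spec_def dg_iff)
    show "AE x in M. ennreal ((cmod (?S N x - V h x))\<^sup>2) \<le> ennreal ((cmod (V f x))\<^sup>2)" for N
      using hae
    proof eventually_elim
      case (elim x)
      show ?case unfolding elim by (auto simp: indicator_def intro!: ennreal_leI)
    qed
    show "AE x in M. (\<lambda>N. ennreal ((cmod (?S N x - V h x))\<^sup>2)) \<longlonglongrightarrow> 0"
      using hae
    proof eventually_elim
      case (elim x)
      have "\<forall>\<^sub>F N in sequentially. 0 = ennreal ((cmod (?S N x - V h x))\<^sup>2)"
      proof (cases "a x \<in> (\<Union>n. B n)")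
        case True
        then obtain n where n: "a x \<in> B n" by blast
        show ?thesis using eventually_gt_at_top[of n]
        proof eventually_elim
          case (elim N)
          then have "a x \<in> (\<Union>n<N. B n)" using n by auto
          then show ?case using True \<open>V h x = _\<close> by (simp add: indicator_def)
        qed
      next
        case False
        then show ?thesis using elim by (auto simp: indicator_def)
      qed
      then show ?case by (rule Lim_transform_eventually[OF tendsto_const])
    qed
    show "(\<integral>\<^sup>+x. ennreal ((cmod (V f x))\<^sup>2) \<partial>M) < \<infinity>"
      using nn_integral_eq_nsq[OF V_sqi[OF f]] by simp
  qed auto
  then show "L2_conv (\<lambda>N x. \<Sum>n<N. g n x) h"
    by (subst L2_conv_iff_V[OF sL hL _ S]) simp_all
qed

text \<open>By unitarity, the mass of \<open>B\<close> is the integral of |V f|^2 over the preimage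
  of \<open>B\<close> under \<open>a\<close>. Integrals against the scalar measure thus become
  integrals over \<open>M\<close>.\<close>

lemma scalar_measure_spec:
  assumes f: "f \<in> L2"
  shows "scalar_measure (spec a) f = distr (density M (\<lambda>x. ennreal ((cmod (V f x))\<^sup>2))) borel a"
    (is "_ = ?D")
proof -
  have [measurable]: "V f \<in> borel_measurable M" using f by (rule V_measurable)
  have "ennreal (Re (L2_inner f (op_app (spec a B) f))) = emeasure ?D B" if B [measurable]: "B \<in> sets borel" for B
  proof -
    let ?g = "op_app (spec a B) f"
    have g: "(f, ?g) \<in> spec a B" by (rule spec_app[OF B f])
    then have gL: "?g \<in> L2" and ae: "AE x in M. V ?g x = indicator B (a x) * V f x" by (auto simp: spec_def dg_iff)
    have [measurable]: "V ?g \<in> borel_measurable M" using gL by (rule V_measurable)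
    have i: "integrable M (\<lambda>x. indicator B (a x) * (cmod (V f x))\<^sup>2)"
      by (rule Bochner_Integration.integrable_bound[OF sqi_integrable[OF V_sqi[OF f]]]) (auto simp: indicator_def)
    have "L2_inner f ?g = ip M (V f) (V ?g)" using f gL by (simp add: L2_inner_eq_ip ip_V)
    also have "\<dots> = ip M (V f) (\<lambda>x. indicator B (a x) * V f x)"
      using ae by (intro ip_cong_AE) auto
    also have "\<dots> = (\<integral>x. of_real (indicator B (a x) * (cmod (V f x))\<^sup>2) \<partial>M)"
      unfolding ip_def
      by (intro Bochner_Integration.integral_cong refl) (simp add: complex_norm_square indicator_def mult.commute del: of_real_power)
    also have "\<dots> = of_real (\<integral>x. indicator B (a x) * (cmod (V f x))\<^sup>2 \<partial>M)"
      by (rule integral_complex_of_real)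
    finally have "ennreal (Re (L2_inner f ?g)) = ennreal (\<integral>x. indicator B (a x) * (cmod (V f x))\<^sup>2 \<partial>M)" by simp
    also have "\<dots> = (\<integral>\<^sup>+x. ennreal (indicator B (a x) * (cmod (V f x))\<^sup>2) \<partial>M)"
      using i by (intro nn_integral_eq_integral[symmetric]) auto
    also have "\<dots> = emeasure ?D B"
      by (subst emeasure_distr, simp, simp, subst emeasure_density)
         (auto intro!: nn_integral_cong simp: indicator_def)
    finally show ?thesis .
  qed
  then have "scalar_measure (spec a) f = measure_of UNIV (sets borel) (emeasure ?D)"
    unfolding scalar_measure_def by (intro measure_of_eq) (auto simp: sets.sigma_sets_eq[of borel, simplified])
  also have "\<dots> = ?D" using measure_of_of_measure[of ?D] by simp
  finally show ?thesis .
qed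

lemma nn_integral_scalar_measure_spec:
  assumes f: "f \<in> L2" and [measurable]: "q \<in> borel_measurable borel"
  shows "(\<integral>\<^sup>+t. q t \<partial>scalar_measure (spec a) f) = (\<integral>\<^sup>+x. ennreal ((cmod (V f x))\<^sup>2) * q (a x) \<partial>M)"
proof -
  have [measurable]: "V f \<in> borel_measurable M" using f by (rule V_measurable)
  show ?thesis
    unfolding scalar_measure_spec[OF f] by (subst nn_integral_distr) (auto simp: nn_integral_density)
qed

text \<open>The level sets of \<open>s\<close> are disjoint, so at \<open>x\<close> only the value
  \<open>c = s (a x)\<close> contributes.\<close>

lemma simple_spectral_sum:
  assumes s: "simple_function borel s" and f: "f \<in> L2"
  shows "(f, \<lambda>x. \<Sum>c\<in>range s. of_real c * op_app (spec a (s -` {c})) f x) \<in> dg (\<lambda>x. of_real (s (a x)))"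
proof -
  let ?h = "\<lambda>c. op_app (spec a (s -` {c})) f"
  have fin: "finite (range s)" using simple_functionD(1)[OF s] by simp
  have B: "s -` {c} \<in> sets borel" for c using simple_functionD(2)[OF s, of "{c}"] by simp
  have h: "(f, ?h c) \<in> spec a (s -` {c})" for c by (rule spec_app[OF B f])
  have hL: "?h c \<in> L2" for c using h[of c] by (simp add: spec_def dg_iff)
  have chL: "(\<lambda>x. of_real c * ?h c x) \<in> L2" for c using hL by (simp add: L2_eq_sqi sqi_cmult)
  have "AE x in M. V (\<lambda>x. \<Sum>c\<in>range s. of_real c * ?h c x) x = (\<Sum>c\<in>range s. V (\<lambda>x. of_real c * ?h c x) x)"
    by (rule V_sum[OF fin chL])
  moreover have "AE x in M. \<forall>c\<in>range s. V (\<lambda>x. of_real c * ?h c x) x = of_real c * V (?h c) x"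
    using fin by (intro AE_ball_countable' V_cmult hL countable_finite)
  moreover have "AE x in M. \<forall>c\<in>range s. V (?h c) x = indicator (s -` {c}) (a x) * V f x"
    using fin h by (intro AE_ball_countable' countable_finite) (auto simp: spec_def dg_iff)
  ultimately have "AE x in M. V (\<lambda>x. \<Sum>c\<in>range s. of_real c * ?h c x) x = of_real (s (a x)) * V f x"
  proof eventually_elim
    case (elim x)
    have "(\<Sum>c\<in>range s. of_real c * (indicator (s -` {c}) (a x) * V f x)) =
        (\<Sum>c\<in>range s. if c = s (a x) then of_real (s (a x)) * V f x else 0)"
      by (intro sum.cong) (auto simp: indicator_def)
    also have "\<dots> = of_real (s (a x)) * V f x" using fin by (simp add: sum.delta')
    finally show ?case using elim by simp
  qed
  then show ?thesis using f chL by (simp add: dg_iff L2_eq_sqi sqi_sum)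
qed

text \<open>From left to right, the defect \<open>?C\<close> does not depend on \<open>n\<close> and
  is at most twice the sum of two errors that tend to 0. Conversely, simple functions dominated by a
  multiple of \<Phi> converge by dominated convergence, since \<Phi>(a) V f is square
  integrable.\<close>

lemma spectral_integral_spec:
  assumes \<Phi> [measurable]: "\<Phi> \<in> borel_measurable borel"
  shows "spectral_integral (spec a) \<Phi> = dg (\<lambda>x. of_real (\<Phi> (a x)))"
proof (intro set_eqI iffI)
  let ?S = "\<lambda>s f x. \<Sum>c\<in>range s. of_real c * op_app (spec a (s -` {c})) f x"
  fix p assume p: "p \<in> spectral_integral (spec a) \<Phi>"
  obtain f g where fg: "p = (f, g)" by (cases p)
  obtain s :: "nat \<Rightarrow> real \<Rightarrow> real" where f: "f \<in> L2" and g: "g \<in> L2" and s: "\<And>n. simple_function borel (s n)"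
    and l1: "(\<lambda>n. \<integral>\<^sup>+t. ennreal ((s n t - \<Phi> t)\<^sup>2) \<partial>scalar_measure (spec a) f) \<longlonglongrightarrow> 0"
    and l2: "L2_conv (\<lambda>n. ?S (s n) f) g"
    using p unfolding fg spectral_integral_def by blast
  have [measurable]: "s n \<in> borel_measurable borel" for n using s by (rule borel_measurable_simple_function)
  have [measurable]: "V f \<in> borel_measurable M" "V g \<in> borel_measurable M" using f g by (auto simp: V_measurable)
  let ?A = "\<lambda>n x. (cmod (of_real (s n (a x)) * V f x - V g x))\<^sup>2"
  let ?B = "\<lambda>n x. (cmod (V f x))\<^sup>2 * (s n (a x) - \<Phi> (a x))\<^sup>2"
  let ?C = "\<lambda>x. (cmod (of_real (\<Phi> (a x)) * V f x - V g x))\<^sup>2"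
  have d: "(f, ?S (s n) f) \<in> dg (\<lambda>x. of_real (s n (a x)))" for n by (rule simple_spectral_sum[OF s f])
  have "(\<lambda>n. \<integral>\<^sup>+x. ennreal (?A n x) \<partial>M) \<longlonglongrightarrow> 0"
    using l2 by (subst (asm) L2_conv_iff_V[where S = "\<lambda>n x. of_real (s n (a x)) * V f x"]) (use d g in \<open>auto simp: dg_iff\<close>)
  moreover have "(\<lambda>n. \<integral>\<^sup>+x. ennreal (?B n x) \<partial>M) \<longlonglongrightarrow> 0"
    using l1 f by (simp add: nn_integral_scalar_measure_spec ennreal_mult')
  ultimately have lim: "(\<lambda>n. 2 * (\<integral>\<^sup>+x. ennreal (?A n x) \<partial>M) +
     2 * (\<integral>\<^sup>+x. ennreal (?B n x) \<partial>M)) \<longlonglongrightarrow> 2 * 0 + 2 * 0"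
    by (intro tendsto_add ennreal_tendsto_cmult) auto
  have "(\<integral>\<^sup>+x. ennreal (?C x) \<partial>M) \<le> 2 * 0 + 2 * 0"
  proof (rule LIMSEQ_le_const[OF lim], intro exI allI impI)
    fix n
    have "ennreal (?C x) \<le>
      2 * ennreal (?A n x) + 2 * ennreal (?B n x)" for x
    proof -
      have "?C x =
        (cmod ((of_real (s n (a x)) * V f x - V g x) + of_real (\<Phi> (a x) - s n (a x)) * V f x))\<^sup>2"
        by (simp add: algebra_simps)
      also have "\<dots> \<le> 2 * ?A n x + 2 * (cmod (of_real (\<Phi> (a x) - s n (a x)) * V f x))\<^sup>2"
        by (rule sum_norm_squared_le)
      also have "(cmod (of_real (\<Phi> (a x) - s n (a x)) * V f x))\<^sup>2 = ?B n x"
        unfolding norm_mult norm_of_real power_mult_distrib by (simp add: power2_commute)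
      finally have "ennreal (?C x) \<le>
         ennreal (2 * ?A n x + 2 * (?B n x))"
        by (rule ennreal_leI)
      also have "\<dots> = 2 * ennreal (?A n x) + 2 * ennreal (?B n x)"
        by (subst ennreal_plus) (simp_all only: ennreal_mult' ennreal_numeral zero_le_numeral mult_nonneg_nonneg zero_le_power2)
      finally show ?thesis .
    qed
    then have "(\<integral>\<^sup>+x. ennreal (?C x) \<partial>M) \<le>
      (\<integral>\<^sup>+x. 2 * ennreal (?A n x) + 2 * ennreal (?B n x) \<partial>M)"
      by (intro nn_integral_mono) auto
    also have "\<dots> = 2 * (\<integral>\<^sup>+x. ennreal (?A n x) \<partial>M) +
     2 * (\<integral>\<^sup>+x. ennreal (?B n x) \<partial>M)"
      by (subst nn_integral_add, measurable) (subst (1 2) nn_integral_cmult, auto)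
    finally show "(\<integral>\<^sup>+x. ennreal (?C x) \<partial>M) \<le>
      2 * (\<integral>\<^sup>+x. ennreal (?A n x) \<partial>M) +
     2 * (\<integral>\<^sup>+x. ennreal (?B n x) \<partial>M)" .
  qed
  then have "(\<integral>\<^sup>+x. ennreal (?C x) \<partial>M) = 0" by simp
  then have "AE x in M. ennreal (?C x) = 0"
    by (subst (asm) nn_integral_0_iff_AE) measurable
  then have "AE x in M. V g x = of_real (\<Phi> (a x)) * V f x"
    by eventually_elim (simp add: ennreal_eq_0_iff)
  then show "p \<in> dg (\<lambda>x. of_real (\<Phi> (a x)))" using f g by (simp add: fg dg_iff)
next
  let ?S = "\<lambda>s f x. \<Sum>c\<in>range s. of_real c * op_app (spec a (s -` {c})) f x"
  fix p assume p: "p \<in> dg (\<lambda>x. of_real (\<Phi> (a x)))"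
  obtain f g where fg: "p = (f, g)" by (cases p)
  have f: "f \<in> L2" and g: "g \<in> L2" and ae: "AE x in M. V g x = of_real (\<Phi> (a x)) * V f x"
    using p by (auto simp: fg dg_iff)
  have [measurable]: "V f \<in> borel_measurable M" "V g \<in> borel_measurable M" using f g by (auto simp: V_measurable)
  \<comment> \<open>The bound by twice |\<Phi>| gives |s n - \<Phi>| at most 3|\<Phi>|, whence the
    integrable majorant 9|V g|^2.\<close>
  obtain s where s: "\<And>n. simple_function borel (s n)" and sl: "\<And>t. (\<lambda>n. s n t) \<longlonglongrightarrow> \<Phi> t"
    and sb: "\<And>n t. \<bar>s n t\<bar> \<le> 2 * \<bar>\<Phi> t\<bar>"
    using borel_measurable_implies_sequence_metric[OF \<Phi>, of 0] by auto
  have [measurable]: "s n \<in> borel_measurable borel" for n using s by (rule borel_measurable_simple_function)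
  let ?A = "\<lambda>n x. (cmod (of_real (s n (a x)) * V f x - V g x))\<^sup>2"
  let ?B = "\<lambda>n x. (cmod (V f x))\<^sup>2 * (s n (a x) - \<Phi> (a x))\<^sup>2"
  have d: "(f, ?S (s n) f) \<in> dg (\<lambda>x. of_real (s n (a x)))" for n by (rule simple_spectral_sum[OF s f])
  have "(\<lambda>n. \<integral>\<^sup>+x. ennreal (?B n x) \<partial>M) \<longlonglongrightarrow> (\<integral>\<^sup>+x. 0 \<partial>M)"
  proof (rule nn_integral_dominated_convergence[where w = "\<lambda>x. ennreal (9 * (cmod (V g x))\<^sup>2)"])
    show "AE x in M. ennreal (?B n x) \<le> ennreal (9 * (cmod (V g x))\<^sup>2)" for n
      using ae
    proof eventually_elim
      case (elim x)
      have "(s n (a x) - \<Phi> (a x))\<^sup>2 \<le> (3 * \<Phi> (a x))\<^sup>2"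
        using sb[of n "a x"] by (intro power2_le_iff_abs_le[THEN iffD2, unfolded abs_mult] iffD1[OF abs_le_square_iff]) auto
      then have "?B n x \<le> (cmod (V f x))\<^sup>2 * (3 * \<Phi> (a x))\<^sup>2"
        by (intro mult_left_mono) auto
      also have "\<dots> = 9 * (cmod (V g x))\<^sup>2"
        unfolding elim norm_mult norm_of_real by (simp add: power_mult_distrib)
      finally show ?case by (rule ennreal_leI)
    qed
    show "AE x in M. (\<lambda>n. ennreal (?B n x)) \<longlonglongrightarrow> 0"
    proof (rule AE_I2)
      fix x
      have "(\<lambda>n. ?B n x) \<longlonglongrightarrow> (cmod (V f x))\<^sup>2 * (\<Phi> (a x) - \<Phi> (a x))\<^sup>2"
        by (intro tendsto_intros sl)
      then show "(\<lambda>n. ennreal (?B n x)) \<longlonglongrightarrow> 0"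
        using tendsto_ennrealI by fastforce
    qed
    have "(\<integral>\<^sup>+x. ennreal (9 * (cmod (V g x))\<^sup>2) \<partial>M) = 9 * ennreal (nsq M (V g))"
      by (simp add: ennreal_mult' nn_integral_cmult nn_integral_eq_nsq[OF V_sqi[OF g]])
    then show "(\<integral>\<^sup>+x. ennreal (9 * (cmod (V g x))\<^sup>2) \<partial>M) < \<infinity>" by (simp add: ennreal_mult_less_top)
  qed auto
  then have l1: "(\<lambda>n. \<integral>\<^sup>+x. ennreal (?B n x) \<partial>M) \<longlonglongrightarrow> 0" by simp
  have "(\<integral>\<^sup>+x. ennreal (?A n x) \<partial>M) =
    (\<integral>\<^sup>+x. ennreal (?B n x) \<partial>M)" for n
  proof (rule nn_integral_cong_AE, use ae in eventually_elim)
    case (elim x)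
    have "of_real (s n (a x)) * V f x - V g x = of_real (s n (a x) - \<Phi> (a x)) * V f x"
      unfolding elim by (simp add: algebra_simps)
    then show ?case by (simp add: norm_mult power_mult_distrib mult.commute del: of_real_diff)
  qed
  then have "L2_conv (\<lambda>n. ?S (s n) f) g"
    using l1 by (subst L2_conv_iff_V[where S = "\<lambda>n x. of_real (s n (a x)) * V f x"]) (use d g in \<open>auto simp: dg_iff\<close>)
  moreover have "(\<lambda>n. \<integral>\<^sup>+t. ennreal ((s n t - \<Phi> t)\<^sup>2) \<partial>scalar_measure (spec a) f) \<longlonglongrightarrow> 0"
    using l1 f by (simp add: nn_integral_scalar_measure_spec ennreal_mult')
  ultimately show "p \<in> spectral_integral (spec a) \<Phi>"
    using f g s unfolding fg spectral_integral_def by blast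
qed

lemma is_function_of_dg:
  assumes "\<Phi> \<in> borel_measurable borel"
  shows "is_function_of \<Phi> (dg (\<lambda>x. of_real (a x))) (dg (\<lambda>x. of_real (\<Phi> (a x))))"
  unfolding is_function_of_def
  using spectral_measure_spec spectral_integral_spec[OF assms] spectral_integral_spec[of "\<lambda>t. t"] by auto

end

end

section \<open>Polynomials times Gaussians\<close>

text \<open>With the polynomial as a parameter, differentiation, multiplication by x or by a
  Gaussian, and the Fourier transform all become algebra on \<open>p\<close> and \<open>a\<close>.
  The halved exponent makes the Fourier transform send width \<open>a\<close> to
  \<open>1 / a\<close>.\<close>

definition gf :: "real \<Rightarrow> complex poly \<Rightarrow> real \<Rightarrow> complex" where
  "gf a p x = poly p (of_real x) * of_real (exp (- (a / 2) * x\<^sup>2))"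

definition gD :: "real \<Rightarrow> complex poly \<Rightarrow> complex poly" where
  "gD a p = pderiv p - smult (of_real a) (pCons 0 p)"

lemma gf_add: "gf a (p + q) x = gf a p x + gf a q x"
  by (simp add: gf_def ring_distribs)

lemma gf_diff: "gf a (p - q) x = gf a p x - gf a q x"
  by (simp add: gf_def ring_distribs)

lemma gf_smult: "gf a (smult c p) x = c * gf a p x"
  by (simp add: gf_def)

lemma gf_X: "gf a (pCons 0 p) x = of_real x * gf a p x"
  by (simp add: gf_def)

lemma gf_0 [simp]: "gf a 0 x = 0"
  by (simp add: gf_def)

lemma gf_pCons: "gf a (pCons c p) x = c * gf a 1 x + gf a (pCons 0 p) x"
  by (simp add: gf_def ring_distribs)

lemma gf_mult_gauss: "of_real (exp (- (b / 2) * x\<^sup>2)) * gf a p x = gf (a + b) p x"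
proof -
  have "exp (- (b / 2) * x\<^sup>2) * exp (- (a / 2) * x\<^sup>2) = exp (- ((a + b) / 2) * x\<^sup>2)"
    by (simp add: algebra_simps add_divide_distrib flip: exp_add)
  then show ?thesis by (simp add: gf_def flip: of_real_mult)
qed

lemma gf_times: "gf a p x * gf b q x = gf (a + b) (p * q) x"
proof -
  have "exp (- (a / 2) * x\<^sup>2) * exp (- (b / 2) * x\<^sup>2) = exp (- ((a + b) / 2) * x\<^sup>2)"
    by (simp add: algebra_simps add_divide_distrib flip: exp_add)
  then show ?thesis by (simp add: gf_def flip: of_real_mult)
qed

lemma gf_deriv: "(gf a p has_vector_derivative gf a (gD a p) x) (at x)"
proof -
  have 1: "((\<lambda>x. poly p (of_real x)) has_vector_derivative poly (pderiv p) (of_real x)) (at x)"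
    by (rule has_vector_derivative_real_field[OF poly_DERIV])
  have "((\<lambda>x. exp (- (a / 2) * x\<^sup>2)) has_real_derivative - a * x * exp (- (a / 2) * x\<^sup>2)) (at x)"
    by (auto intro!: derivative_eq_intros)
  then have 2: "((\<lambda>x. complex_of_real (exp (- (a / 2) * x\<^sup>2))) has_vector_derivative of_real (- a * x * exp (- (a / 2) * x\<^sup>2))) (at x)"
    by (intro has_vector_derivative_of_real) (simp add: has_real_derivative_iff_has_vector_derivative)
  show ?thesis
    unfolding gf_def[abs_def]
    by (rule has_vector_derivative_eq_rhs[OF has_vector_derivative_mult[OF 1 2]])
       (simp add: gD_def algebra_simps)
qed

lemma gf_continuous: "continuous_on UNIV (gf a p)"
  using gf_deriv by (intro continuous_at_imp_continuous_on) (auto intro: has_vector_derivative_continuous)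

lemma gf_isCont: "isCont (gf a p) x"
  using gf_deriv by (rule has_vector_derivative_continuous)

lemma gf_measurable [measurable]: "gf a p \<in> borel_measurable borel"
  by (rule borel_measurable_continuous_onI[OF gf_continuous])

text \<open>Each degree costs a little Gaussian decay. Keeping \<open>b\<close> arbitrary lets the
  induction hypothesis be used at the midpoint of \<open>b\<close> and \<open>a\<close>, with the
  rest of the gap absorbing the factor x.\<close>

lemma gf_bound:
  assumes "b < a" shows "\<exists>C\<ge>0. \<forall>x. cmod (gf a p x) \<le> C * exp (- (b / 2) * x\<^sup>2)"
  using assms
proof (induction p arbitrary: b)
  case 0
  then show ?case by (intro exI[of _ 0]) simp
next
  case (pCons c p)
  let ?b = "(a + b) / 2"
  from pCons.prems have b: "b < ?b" "?b < a" by auto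
  from pCons.IH[OF b(2)] obtain C where C: "C \<ge> 0" "\<And>x. cmod (gf a p x) \<le> C * exp (- (?b / 2) * x\<^sup>2)" by auto
  define d where "d = ?b - b"
  have d: "d > 0" "?b = b + d" using b(1) unfolding d_def by linarith+
  \<comment> \<open>Chosen so that K(1 + d x^2/2) multiplies out to a bound for 1 + x^2/2, which
    dominates |x|.\<close>
  define K where "K = 1 + 1 / d"
  have "cmod (gf a (pCons c p) x) \<le> (cmod c + C * K) * exp (- (b / 2) * x\<^sup>2)" for x
  proof -
    have "\<bar>x\<bar> \<le> 1 + x\<^sup>2 / 2"
      using zero_le_power2[of "\<bar>x\<bar> - 1"] by (simp add: power2_diff)
    also have "\<dots> \<le> 1 + x\<^sup>2 / 2 + (1 / d + d / 2 * x\<^sup>2)"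
      using d by simp
    also have "\<dots> = K * (1 + d / 2 * x\<^sup>2)"
      using d by (simp add: K_def algebra_simps)
    also have "\<dots> \<le> K * exp (d / 2 * x\<^sup>2)"
      using d by (intro mult_left_mono exp_ge_add_one_self) (auto simp: K_def)
    finally have x: "\<bar>x\<bar> \<le> K * exp (d / 2 * x\<^sup>2)" .
    have "cmod (of_real x * gf a p x) \<le> K * exp (d / 2 * x\<^sup>2) * (C * exp (- (?b / 2) * x\<^sup>2))"
      unfolding norm_mult norm_of_real by (rule mult_mono[OF x C(2)]) (use d in \<open>auto simp: K_def\<close>)
    also have "\<dots> = C * K * (exp (d / 2 * x\<^sup>2) * exp (- (?b / 2) * x\<^sup>2))" by simp
    also have "exp (d / 2 * x\<^sup>2) * exp (- (?b / 2) * x\<^sup>2) = exp (- (b / 2) * x\<^sup>2)"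
      unfolding exp_add[symmetric] d(2) by (rule arg_cong[of _ _ exp]) (simp add: field_simps)
    finally have 2: "cmod (of_real x * gf a p x) \<le> C * K * exp (- (b / 2) * x\<^sup>2)" .
    have "a * x\<^sup>2 \<ge> b * x\<^sup>2" using pCons.prems by (intro mult_right_mono) auto
    then have "cmod (c * gf a 1 x) \<le> cmod c * exp (- (b / 2) * x\<^sup>2)"
      unfolding norm_mult by (intro mult_left_mono) (auto simp: gf_def)
    with 2 show ?thesis
      unfolding gf_pCons[of a c] gf_X using norm_triangle_ineq[of "c * gf a 1 x" "of_real x * gf a p x"]
      by (simp add: ring_distribs)
  qed
  moreover have "cmod c + C * K \<ge> 0" using C d by (auto simp: K_def)
  ultimately show ?case by blast
qed

lemma gauss_integrable: "b > 0 \<Longrightarrow> integrable lborel (\<lambda>x::real. exp (- (b / 2) * x\<^sup>2))"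
proof -
  assume b: "b > 0"
  have "integrable lborel (\<lambda>x. sqrt (2 * pi / b) * normal_density 0 (1 / sqrt b) x)"
    by (intro integrable_mult_right integrable_normal_density) (use b in auto)
  moreover have "sqrt (2 * pi / b) * normal_density 0 (1 / sqrt b) x = exp (- (b / 2) * x\<^sup>2)" for x
    using b by (simp add: normal_density_def real_sqrt_divide real_sqrt_mult power_divide)
  ultimately show ?thesis by simp
qed

lemma gf_integrable: assumes "a > 0" shows "integrable lborel (gf a p)"
proof -
  obtain C where C: "\<And>x. cmod (gf a p x) \<le> C * exp (- ((a/2) / 2) * x\<^sup>2)" using gf_bound[of "a/2" a p] assms by auto
  show ?thesis
    by (rule Bochner_Integration.integrable_bound[OF integrable_mult_right[OF gauss_integrable[of "a/2"], of C]])
       (use assms in \<open>auto intro!: AE_I2 order_trans[OF C] simp: gf_measurable simp del: minus_mult_left[symmetric]\<close>)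
qed

lemma gf_L2: assumes "a > 0" shows "gf a p \<in> L2"
proof -
  obtain C where C: "C \<ge> 0" "\<And>x. cmod (gf a p x) \<le> C * exp (- ((a/2) / 2) * x\<^sup>2)" using gf_bound[of "a/2" a p] assms by auto
  show ?thesis unfolding L2_eq_sqi
  proof (rule sqi_bound[OF _ integrable_mult_right[OF gauss_integrable[of a], of "C\<^sup>2"]])
    fix x
    have "(cmod (gf a p x))\<^sup>2 \<le> (C * exp (- ((a/2) / 2) * x\<^sup>2))\<^sup>2" by (intro power_mono C) auto
    also have "\<dots> = C\<^sup>2 * exp (- (a / 2) * x\<^sup>2)"
      by (simp add: power_mult_distrib flip: exp_double)
    finally show "(cmod (gf a p x))\<^sup>2 \<le> C\<^sup>2 * exp (- (a / 2) * x\<^sup>2)" .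
  qed (use assms in \<open>auto simp: gf_measurable\<close>)
qed

lemma gf_tendsto:
  assumes "a > 0" "F = at_top \<or> F = at_bot"
  shows "(gf a p \<longlongrightarrow> 0) F"
proof -
  obtain C where C: "\<And>x. cmod (gf a p x) \<le> C * exp (- ((a/2) / 2) * x\<^sup>2)" using gf_bound[of "a/2" a p] assms by auto
  have "((\<lambda>x::real. exp (- ((a/2) / 2) * x\<^sup>2)) \<longlongrightarrow> 0) F" using assms by (auto; real_asymp)
  from tendsto_mult_right_zero[OF this, of C] show ?thesis
    by (rule Lim_null_comparison[rotated]) (use C in auto)
qed

lemma integral_derivative_eq_0:
  fixes F :: "real \<Rightarrow> complex"
  assumes "\<And>x. (F has_vector_derivative f x) (at x)" "\<And>x. isCont f x" "integrable lborel f"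
    and "(F \<longlongrightarrow> 0) at_top" "(F \<longlongrightarrow> 0) at_bot"
  shows "(\<integral>x. f x \<partial>lborel) = 0"
proof -
  have "(LBINT x=-\<infinity>..\<infinity>. f x) = 0 - 0"
    by (rule interval_integral_FTC_integrable[where F = F])
       (use assms in \<open>auto simp: ereal_tendsto_simps set_integrable_def\<close>)
  then show ?thesis by (simp add: interval_lebesgue_integral_def set_lebesgue_integral_def)
qed

lemma integral_gf_gD: "a > 0 \<Longrightarrow> (\<integral>x. gf a (gD a p) x \<partial>lborel) = 0"
  by (rule integral_derivative_eq_0[OF gf_deriv gf_isCont gf_integrable gf_tendsto gf_tendsto]) auto

section \<open>Fourier transforms of polynomials times Gaussians\<close>

lemma iexp_deriv: "((\<lambda>x. exp (- \<i> * of_real (\<xi> * x))) has_vector_derivative - \<i> * of_real \<xi> * exp (- \<i> * of_real (\<xi> * x))) (at x)"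
proof -
  have "((\<lambda>z. exp (- \<i> * of_real \<xi> * z)) has_field_derivative - \<i> * of_real \<xi> * exp (- \<i> * of_real \<xi> * of_real x)) (at (of_real x))"
    by (auto intro!: derivative_eq_intros)
  from has_vector_derivative_real_field[OF this] show ?thesis by (simp add: mult.assoc)
qed

lemma norm_iexp [simp]: "cmod (exp (- \<i> * of_real y)) = 1" "cmod (exp (\<i> * of_real y)) = 1"
  by (simp_all add: norm_exp_eq_Re)

lemma iexp_measurable [measurable]: "(\<lambda>x. exp (- \<i> * of_real (\<xi> * x))) \<in> borel_measurable (borel :: real measure)"
  by (intro borel_measurable_continuous_onI continuous_intros)

lemma fourier_integrable:
  assumes "integrable lborel f"
  shows "integrable lborel (\<lambda>x. f x * exp (- \<i> * of_real (\<xi> * x)))"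
proof (rule Bochner_Integration.integrable_bound[OF assms])
  note [measurable] = borel_measurable_integrable[OF assms]
  show "(\<lambda>x. f x * exp (- \<i> * of_real (\<xi> * x))) \<in> borel_measurable lborel" by measurable
qed (simp add: norm_mult)

lemma fourier_add: "integrable lborel f \<Longrightarrow> integrable lborel g \<Longrightarrow>
    fourier (\<lambda>x. f x + g x) \<xi> = fourier f \<xi> + fourier g \<xi>"
  unfolding fourier_def ring_distribs by (intro Bochner_Integration.integral_add fourier_integrable)

lemma fourier_diff: "integrable lborel f \<Longrightarrow> integrable lborel g \<Longrightarrow>
    fourier (\<lambda>x. f x - g x) \<xi> = fourier f \<xi> - fourier g \<xi>"
  unfolding fourier_def left_diff_distrib by (intro Bochner_Integration.integral_diff fourier_integrable)

lemma fourier_cmult: "fourier (\<lambda>x. c * f x) \<xi> = c * fourier f \<xi>"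
  by (simp add: fourier_def mult.assoc)

lemma fourier_gf_add: "a > 0 \<Longrightarrow> fourier (gf a (p + q)) \<xi> = fourier (gf a p) \<xi> + fourier (gf a q) \<xi>"
  using fourier_add[of "gf a p" "gf a q"] by (simp add: gf_integrable gf_add[abs_def])

lemma fourier_gf_diff: "a > 0 \<Longrightarrow> fourier (gf a (p - q)) \<xi> = fourier (gf a p) \<xi> - fourier (gf a q) \<xi>"
  using fourier_diff[of "gf a p" "gf a q"] by (simp add: gf_integrable gf_diff[abs_def])

lemma fourier_gf_smult: "fourier (gf a (smult c p)) \<xi> = c * fourier (gf a p) \<xi>"
  using fourier_cmult[of c "gf a p"] by (simp add: gf_smult[abs_def])

lemma fourier_gf_0 [simp]: "fourier (gf a 0) \<xi> = 0"
  by (simp add: fourier_def)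

lemma fourier_gf_gD:
  assumes a: "a > 0" shows "fourier (gf a (gD a p)) \<xi> = \<i> * of_real \<xi> * fourier (gf a p) \<xi>"
proof -
  let ?e = "\<lambda>x. exp (- \<i> * of_real (\<xi> * x))"
  have cont: "isCont ?e x" for x using iexp_deriv by (rule has_vector_derivative_continuous)
  have i: "integrable lborel (\<lambda>x. gf a q x * ?e x)" for q
    using gf_integrable[OF a] by (rule fourier_integrable)
  have t: "((\<lambda>x. gf a p x * ?e x) \<longlongrightarrow> 0) F" if "F = at_top \<or> F = at_bot" for F
    by (rule tendsto_norm_zero_cancel) (use tendsto_norm_zero[OF gf_tendsto[OF a that, of p]] in \<open>simp add: norm_mult\<close>)
  have "(\<integral>x. gf a p x * (- \<i> * of_real \<xi> * ?e x) + gf a (gD a p) x * ?e x \<partial>lborel) = 0"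
  proof (rule integral_derivative_eq_0)
    show "((\<lambda>x. gf a p x * ?e x) has_vector_derivative gf a p x * (- \<i> * of_real \<xi> * ?e x) + gf a (gD a p) x * ?e x) (at x)" for x
      by (rule has_vector_derivative_mult[OF gf_deriv iexp_deriv])
    show "integrable lborel (\<lambda>x. gf a p x * (- \<i> * of_real \<xi> * ?e x) + gf a (gD a p) x * ?e x)"
      using integrable_mult_right[OF i[of p], of "- \<i> * of_real \<xi>"] i[of "gD a p"] by (simp add: mult_ac)
    show "isCont (\<lambda>x. gf a p x * (- \<i> * of_real \<xi> * ?e x) + gf a (gD a p) x * ?e x) x" for x
      by (intro continuous_intros gf_isCont)
    show "((\<lambda>x. gf a p x * ?e x) \<longlongrightarrow> 0) at_top" "((\<lambda>x. gf a p x * ?e x) \<longlongrightarrow> 0) at_bot"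
      by (rule t; simp)+
  qed
  also have "(\<lambda>x. gf a p x * (- \<i> * of_real \<xi> * ?e x) + gf a (gD a p) x * ?e x) =
     (\<lambda>x. (- \<i> * of_real \<xi>) * (gf a p x * ?e x) + gf a (gD a p) x * ?e x)" by (simp add: mult_ac)
  finally have "(- \<i> * of_real \<xi>) * fourier (gf a p) \<xi> + fourier (gf a (gD a p)) \<xi> = 0"
    unfolding fourier_def using integrable_mult_right[OF i[of p], of "- \<i> * of_real \<xi>"] i[of "gD a p"]
    by (subst (asm) Bochner_Integration.integral_add) auto
  then show ?thesis by (simp add: add_eq_0_iff)
qed

text \<open>The substitution y = sqrt(a) x turns the characteristic function of the standard normal
  law, taken at -\<xi>/sqrt(a), into this transform.\<close>

lemma fourier_gauss:
  assumes a: "a > 0" shows "fourier (gf a 1) \<xi> = of_real (sqrt (2 * pi / a)) * gf (1 / a) 1 \<xi>"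
proof -
  let ?t = "- \<xi> / sqrt a"
  let ?g = "\<lambda>y. std_normal_density y *\<^sub>R iexp (?t * y)"
  have "of_real (exp (- (?t\<^sup>2) / 2)) = char std_normal_distribution ?t"
    by (simp only: char_std_normal_distribution)
  also have "\<dots> = (\<integral>y. ?g y \<partial>lborel)"
    unfolding char_def by (subst integral_density) auto
  also have "\<dots> = sqrt a *\<^sub>R (\<integral>x. ?g (0 + sqrt a * x) \<partial>lborel)"
    using a by (subst lborel_integral_real_affine[where c = "sqrt a" and t = 0]) auto
  also have "(\<lambda>x. ?g (0 + sqrt a * x)) = (\<lambda>x. of_real (1 / sqrt (2 * pi)) * (gf a 1 x * exp (- \<i> * of_real (\<xi> * x))))"
    using a by (intro ext) (simp add: std_normal_density_def gf_def scaleR_conv_of_real power_mult_distrib mult_ac)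
  also have "sqrt a *\<^sub>R (\<integral>x. of_real (1 / sqrt (2 * pi)) * (gf a 1 x * exp (- \<i> * of_real (\<xi> * x))) \<partial>lborel) =
      of_real (sqrt a / sqrt (2 * pi)) * fourier (gf a 1) \<xi>"
    unfolding fourier_def by (simp add: scaleR_conv_of_real)
  also have "exp (- (?t\<^sup>2) / 2) = exp (- (1 / a / 2) * \<xi>\<^sup>2)"
    using a by (simp add: power_divide field_simps)
  also have "of_real (exp (- (1 / a / 2) * \<xi>\<^sup>2)) = gf (1 / a) 1 \<xi>" by (simp add: gf_def)
  finally have e: "gf (1 / a) 1 \<xi> = of_real (sqrt a / sqrt (2 * pi)) * fourier (gf a 1) \<xi>" .
  have "complex_of_real (sqrt (2 * pi / a)) * of_real (sqrt a / sqrt (2 * pi)) = 1"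
    using a by (simp add: real_sqrt_divide flip: of_real_mult)
  then show ?thesis unfolding e mult.assoc[symmetric] by simp
qed

lemma gD_pCons: "gD a (pCons 0 p) = p + pCons 0 (gD a p)"
  by (simp add: gD_def pderiv_pCons smult_diff_right)

text \<open>
  Let \<open>f\<^sub>p = p e\<^bsup>-ax\<^sup>2/2\<^esup>\<close>. Partial integration gives \<open>a \<F>[x f\<^sub>p] = \<F>[f\<^sub>q] - i\<xi> \<F>[f\<^sub>p]\<close> with \<open>q = p'\<close>, so the rule
  follows by induction on the degree of \<open>p\<close>, without differentiating under the integral sign.
\<close>

lemma fourier_gf_deriv:
  assumes a: "a > 0"
  shows "(fourier (gf a p) has_vector_derivative - \<i> * fourier (gf a (pCons 0 p)) \<xi>) (at \<xi>)"
proof (induction "degree p" arbitrary: p \<xi> rule: less_induct)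
  case less
  have rec: "of_real a * fourier (gf a (pCons 0 q)) \<xi> = fourier (gf a (pderiv q)) \<xi> - \<i> * of_real \<xi> * fourier (gf a q) \<xi>" for q \<xi>
    using fourier_gf_gD[OF a, of q \<xi>] unfolding gD_def fourier_gf_diff[OF a] fourier_gf_smult
    by (simp add: diff_eq_eq eq_diff_eq add.commute)
  \<comment> \<open>The recursion lowers only the part divisible by x; constants rest on the
    explicit transform of the Gaussian.\<close>
  have const: "(fourier (gf a [:c:]) has_vector_derivative - \<i> * fourier (gf a (pCons 0 [:c:])) \<xi>) (at \<xi>)" for c \<xi>
  proof -
    have e: "[:c:] = smult c 1" by simp
    have f: "fourier (gf a [:c:]) = (\<lambda>\<xi>. c * of_real (sqrt (2 * pi / a)) * gf (1 / a) 1 \<xi>)"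
      unfolding e fourier_gf_smult[abs_def] fourier_gauss[OF a] by (simp add: mult.assoc)
    have "of_real a * fourier (gf a (pCons 0 [:c:])) \<xi> = - \<i> * of_real \<xi> * fourier (gf a [:c:]) \<xi>"
      by (subst rec) (simp add: pderiv_pCons)
    then have g: "fourier (gf a (pCons 0 [:c:])) \<xi> = - \<i> * of_real (\<xi> / a) * fourier (gf a [:c:]) \<xi>"
      using a by (simp add: field_simps)
    have "(fourier (gf a [:c:]) has_vector_derivative c * of_real (sqrt (2 * pi / a)) * gf (1 / a) (gD (1 / a) 1) \<xi>) (at \<xi>)"
      unfolding f by (intro has_vector_derivative_mult_right gf_deriv)
    moreover have "c * of_real (sqrt (2 * pi / a)) * gf (1 / a) (gD (1 / a) 1) \<xi> = - \<i> * fourier (gf a (pCons 0 [:c:])) \<xi>"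
      unfolding g f using a by (simp add: gD_def gf_def field_simps)
    ultimately show ?thesis by simp
  qed
  obtain c q where p: "p = pCons c q" by (cases p)
  show ?case
  proof (cases "q = 0")
    case True
    then show ?thesis using const p by simp
  next
    case False
    have dq: "degree q < degree p" "degree (pderiv q) < degree p"
      using False degree_pderiv[of q] by (auto simp: p intro: le_less_trans)
    have pe: "p = [:c:] + pCons 0 q" by (simp add: p)
    have F: "fourier (gf a p) = (\<lambda>\<xi>. fourier (gf a [:c:]) \<xi> + (fourier (gf a (pderiv q)) \<xi> - \<i> * of_real \<xi> * fourier (gf a q) \<xi>) / of_real a)"
      using rec[of q] a by (intro ext) (simp add: pe fourier_gf_add[OF a] del: add_pCons flip: rec)
    have idv: "((\<lambda>\<xi>. \<i> * of_real \<xi>) has_vector_derivative \<i>) (at \<xi>)"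
      by (auto intro!: derivative_eq_intros)
    have "(fourier (gf a p) has_vector_derivative
        (- \<i> * fourier (gf a (pCons 0 [:c:])) \<xi> +
         (- \<i> * fourier (gf a (pCons 0 (pderiv q))) \<xi> -
          (\<i> * of_real \<xi> * (- \<i> * fourier (gf a (pCons 0 q)) \<xi>) + \<i> * fourier (gf a q) \<xi>)) / of_real a)) (at \<xi>)"
      unfolding F
      by (intro has_vector_derivative_add const has_vector_derivative_divide has_vector_derivative_diff
          less.hyps dq has_vector_derivative_mult[OF idv])
    moreover have "of_real a * fourier (gf a (pCons 0 (pCons 0 q))) \<xi> =
        fourier (gf a q) \<xi> + fourier (gf a (pCons 0 (pderiv q))) \<xi> - \<i> * of_real \<xi> * fourier (gf a (pCons 0 q)) \<xi>"
      by (subst rec) (simp add: pderiv_pCons fourier_gf_add[OF a])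
    then have "fourier (gf a (pCons 0 p)) \<xi> = fourier (gf a (pCons 0 [:c:])) \<xi> +
       (fourier (gf a q) \<xi> + fourier (gf a (pCons 0 (pderiv q))) \<xi> - \<i> * of_real \<xi> * fourier (gf a (pCons 0 q)) \<xi>) / of_real a"
    proof -
      assume *: "of_real a * fourier (gf a (pCons 0 (pCons 0 q))) \<xi> =
        fourier (gf a q) \<xi> + fourier (gf a (pCons 0 (pderiv q))) \<xi> - \<i> * of_real \<xi> * fourier (gf a (pCons 0 q)) \<xi>"
      have "pCons 0 p = pCons 0 [:c:] + pCons 0 (pCons 0 q)" by (simp add: p)
      then have "fourier (gf a (pCons 0 p)) \<xi> = fourier (gf a (pCons 0 [:c:])) \<xi> + fourier (gf a (pCons 0 (pCons 0 q))) \<xi>"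
        by (metis fourier_gf_add[OF a])
      then show ?thesis using a by (simp flip: *)
    qed
    note eq = this
    have "- \<i> * fourier (gf a (pCons 0 p)) \<xi> = - \<i> * fourier (gf a (pCons 0 [:c:])) \<xi> +
         (- \<i> * fourier (gf a (pCons 0 (pderiv q))) \<xi> -
          (\<i> * of_real \<xi> * (- \<i> * fourier (gf a (pCons 0 q)) \<xi>) + \<i> * fourier (gf a q) \<xi>)) / of_real a"
      by (subst eq) (use a in \<open>simp add: field_simps\<close>)
    ultimately show ?thesis by simp
  qed
qed

text \<open>The derivative of the transform is known twice: by \<open>fourier_gf_deriv\<close>, and
  from the explicit form \<open>gf b q\<close>. Uniqueness of derivatives compares them.\<close>

lemma fourier_gf_X:
  assumes a: "a > 0" and F: "\<And>\<xi>. fourier (gf a p) \<xi> = gf b q \<xi>"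
  shows "fourier (gf a (pCons 0 p)) \<xi> = \<i> * gf b (gD b q) \<xi>"
proof -
  have "(gf b q has_vector_derivative - \<i> * fourier (gf a (pCons 0 p)) \<xi>) (at \<xi>)"
    using fourier_gf_deriv[OF a, of p \<xi>] ext[of "fourier (gf a p)" "gf b q", OF F] by simp
  from vector_derivative_unique_at[OF this gf_deriv]
  have "gf b (gD b q) \<xi> = - \<i> * fourier (gf a (pCons 0 p)) \<xi>" by simp
  then show ?thesis by simp
qed

lemma inv_fourier_eq: "inv_fourier f x = fourier f (- x) / (2 * of_real pi)"
  by (simp add: inv_fourier_def fourier_def)

section \<open>Uniqueness from moments\<close>

lemma iexp_integrable:
  assumes "integrable lborel u"
  shows "integrable lborel (\<lambda>x. u x * iexp (t * x))"
  using fourier_integrable[OF assms, of "- t"] by simp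

text \<open>The positive and negative parts of \<open>w\<close> have equal mass. Normalized, they
  are probability densities with the same characteristic function, so Levy's uniqueness theorem
  identifies them.\<close>

lemma real_L1_fourier_unique:
  fixes w :: "real \<Rightarrow> real"
  assumes w: "integrable lborel w"
    and z: "\<And>t. (\<integral>x. of_real (w x) * iexp (t * x) \<partial>lborel) = 0"
  shows "AE x in lborel. w x = 0"
proof -
  note [measurable] = borel_measurable_integrable[OF w]
  define p where "p x = max 0 (w x)" for x
  define m where "m x = max 0 (- w x)" for x
  have wpm: "w x = p x - m x" for x by (auto simp: p_def m_def max_def)
  have pos: "0 \<le> p x" "0 \<le> m x" for x by (auto simp: p_def m_def)
  have p: "integrable lborel p" and m: "integrable lborel m"
    using w unfolding p_def[abs_def] m_def[abs_def] by auto
  note [measurable] = borel_measurable_integrable[OF p] borel_measurable_integrable[OF m]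
  define c where "c = (\<integral>x. p x \<partial>lborel)"
  \<comment> \<open>Frequency 0 gives the equality of the two masses.\<close>
  have "of_real (\<integral>x. w x \<partial>lborel) = (0::complex)" using z[of 0] by (simp add: integral_complex_of_real)
  then have cm: "(\<integral>x. m x \<partial>lborel) = c" using p m by (simp add: wpm[abs_def] c_def)
  show ?thesis
  proof (cases "c = 0")
    case True
    have "AE x in lborel. p x = 0" "AE x in lborel. m x = 0"
      using integral_nonneg_eq_0_iff_AE[OF p] integral_nonneg_eq_0_iff_AE[OF m] pos True cm c_def by auto
    then show ?thesis by eventually_elim (simp add: wpm)
  next
    case False
    have "c \<ge> 0" unfolding c_def using pos by (intro Bochner_Integration.integral_nonneg)
    with False have c0: "c > 0" by simp
    define P where "P f = density lborel (\<lambda>x. ennreal (f x / c))" for f :: "real \<Rightarrow> real"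
    have RD: "real_distribution (P f)" if f: "integrable lborel f" "\<And>x. f x \<ge> 0" "(\<integral>x. f x \<partial>lborel) = c" for f
    proof -
      have [measurable]: "f \<in> borel_measurable borel" using f(1) by auto
      have "emeasure (P f) (space (P f)) = (\<integral>\<^sup>+x. ennreal (f x / c) \<partial>lborel)"
        by (simp add: P_def emeasure_density)
      also have "\<dots> = ennreal (\<integral>x. f x / c \<partial>lborel)"
        using f c0 by (intro nn_integral_eq_integral) auto
      also have "\<dots> = 1" using f c0 by simp
      finally have "prob_space (P f)" by (rule prob_spaceI)
      then show ?thesis by (simp add: real_distribution_def real_distribution_axioms_def P_def)
    qed
    have ch: "char (P f) t = (\<integral>x. of_real (f x) * iexp (t * x) \<partial>lborel) / of_real c"
      if f: "integrable lborel f" "\<And>x. f x \<ge> 0" for f t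
    proof -
      have [measurable]: "f \<in> borel_measurable borel" using f(1) by auto
      have "char (P f) t = (\<integral>x. (f x / c) *\<^sub>R iexp (t * x) \<partial>lborel)"
        unfolding char_def P_def using f c0 by (subst integral_density) auto
      also have "\<dots> = (\<integral>x. of_real (f x) * iexp (t * x) / of_real c \<partial>lborel)"
        by (simp add: scaleR_conv_of_real)
      finally show ?thesis by simp
    qed
    have "char (P p) = char (P m)"
    proof
      fix t
      let ?F = "\<lambda>f. (\<integral>x. of_real (f x) * iexp (t * x) \<partial>lborel)"
      have "0 = (\<integral>x. of_real (p x) * iexp (t * x) - of_real (m x) * iexp (t * x) \<partial>lborel)"
        using z[of t] by (simp add: wpm left_diff_distrib)
      also have "\<dots> = ?F p - ?F m"
        by (intro Bochner_Integration.integral_diff iexp_integrable integrable_of_real p m)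
      finally show "char (P p) t = char (P m) t" using p m pos by (simp add: ch)
    qed
    then have "P p = P m" using p m pos cm by (intro Levy_uniqueness RD) (auto simp: c_def)
    then have "AE x in lborel. ennreal (p x / c) = ennreal (m x / c)"
      unfolding P_def by (intro sigma_finite_measure.density_unique[OF lborel.sigma_finite_measure_axioms]) auto
    then show ?thesis
    proof eventually_elim
      case (elim x)
      then have "p x = m x" using c0 pos[of x] by (simp add: field_simps)
      then show ?case by (simp add: wpm)
    qed
  qed
qed

text \<open>Conjugation reflects the frequency, so the transform of the conjugate vanishes too, and
  with it those of the real and imaginary parts.\<close>

lemma L1_fourier_unique:
  assumes u: "integrable lborel u"
    and z: "\<And>t. (\<integral>x. u x * iexp (t * x) \<partial>lborel) = 0"
  shows "AE x in lborel. u x = 0"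
proof -
  have zc: "(\<integral>x. cnj (u x) * iexp (t * x) \<partial>lborel) = 0" for t
  proof -
    have "(\<integral>x. cnj (u x) * iexp (t * x) \<partial>lborel) =
        (\<integral>x. cnj (u x * iexp (- t * x)) \<partial>lborel)"
      by (simp add: exp_cnj)
    also have "\<dots> = cnj (\<integral>x. u x * iexp (- t * x) \<partial>lborel)"
      by (rule Bochner_Integration.integral_cnj)
    finally show ?thesis by (simp only: z complex_cnj_zero)
  qed
  have i: "integrable lborel (\<lambda>x. u x * iexp (t * x))"
    "integrable lborel (\<lambda>x. cnj (u x) * iexp (t * x))" for t
    using u by (auto intro!: iexp_integrable simp del: of_real_mult)
  have "AE x in lborel. Re (u x) = 0"
  proof (rule real_L1_fourier_unique)
    fix t
    have "of_real (Re (u x)) * iexp (t * x) =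
      (1/2) * (u x * iexp (t * x) + cnj (u x) * iexp (t * x))" for x
      unfolding distrib_right[symmetric] complex_add_cnj by simp
    then show "(\<integral>x. of_real (Re (u x)) * iexp (t * x) \<partial>lborel) = 0"
      using i[of t] by (simp only: integral_mult_right_zero Bochner_Integration.integral_add z zc) simp
  qed (use u in auto)
  moreover have "AE x in lborel. Im (u x) = 0"
  proof (rule real_L1_fourier_unique)
    fix t
    have "of_real (Im (u x)) * iexp (t * x) =
      (- \<i>/2) * (u x * iexp (t * x) - cnj (u x) * iexp (t * x))" for x
      unfolding left_diff_distrib[symmetric] complex_diff_cnj by (simp add: complex_eq_iff algebra_simps)
    then show "(\<integral>x. of_real (Im (u x)) * iexp (t * x) \<partial>lborel) = 0"
      using i[of t] by (simp only: integral_mult_right_zero Bochner_Integration.integral_diff z zc) simp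
  qed (use u in auto)
  ultimately show ?thesis by eventually_elim (simp add: complex_eq_iff)
qed

text \<open>The power series of \<open>e\<^bsup>itx\<^esup>\<close> may be integrated termwise against \<open>u\<close>, so vanishing moments
  force the Fourier transform of \<open>u\<close> to vanish.\<close>

lemma moments_unique:
  fixes u :: "real \<Rightarrow> complex"
  assumes u [measurable]: "u \<in> borel_measurable lborel"
    and e: "\<And>c. integrable lborel (\<lambda>x. cmod (u x) * exp (c * \<bar>x\<bar>))"
    and m: "\<And>n. (\<integral>x. u x * of_real x ^ n \<partial>lborel) = 0"
  shows "AE x in lborel. u x = 0"
proof (rule L1_fourier_unique)
  show "integrable lborel u"
    using e[of 0] by (simp add: integrable_norm_iff)
  fix t :: real
  let ?term = "\<lambda>n x. (\<i> * of_real (t * x)) ^ n /\<^sub>R fact n"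
  have bnd: "cmod (\<Sum>n<N. ?term n x) \<le> exp (\<bar>t\<bar> * \<bar>x\<bar>)" for N x
  proof -
    have "cmod (\<Sum>n<N. ?term n x) \<le> (\<Sum>n<N. (\<bar>t\<bar> * \<bar>x\<bar>) ^ n /\<^sub>R fact n)"
      by (rule order_trans[OF norm_sum]) (simp add: norm_mult norm_power abs_mult)
    also have "\<dots> \<le> (\<Sum>n. (\<bar>t\<bar> * \<bar>x\<bar>) ^ n /\<^sub>R fact n)"
      by (intro sum_le_suminf summable_exp_generic) auto
    also have "\<dots> = exp (\<bar>t\<bar> * \<bar>x\<bar>)" by (simp add: exp_def)
    finally show ?thesis .
  qed
  have i: "integrable lborel (\<lambda>x. u x * of_real x ^ n)" for n
  proof (rule Bochner_Integration.integrable_bound[OF integrable_mult_right[OF e[of 1], of "fact n"]])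
    have "\<bar>x\<bar> ^ n \<le> fact n * exp \<bar>x\<bar>" for x :: real
    proof -
      have "\<bar>x\<bar> ^ n /\<^sub>R fact n \<le> (\<Sum>k. \<bar>x\<bar> ^ k /\<^sub>R fact k)"
        using sum_le_suminf[OF summable_exp_generic, of "{n}" "\<bar>x\<bar>"] by auto
      then have "\<bar>x\<bar> ^ n / fact n \<le> exp \<bar>x\<bar>" by (simp add: exp_def divide_inverse mult.commute)
      then show ?thesis by (simp add: divide_le_eq mult.commute)
    qed
    then have "cmod (u x) * \<bar>x\<bar> ^ n \<le> cmod (u x) * (fact n * exp \<bar>x\<bar>)" for x by (intro mult_left_mono) auto
    then show "AE x in lborel. cmod (u x * of_real x ^ n) \<le> norm (fact n * (cmod (u x) * exp (1 * \<bar>x\<bar>)))"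
      by (intro AE_I2) (simp add: norm_mult norm_power abs_mult mult_ac)
  qed measurable
  have "(\<lambda>N. \<integral>x. u x * (\<Sum>n<N. ?term n x) \<partial>lborel) \<longlonglongrightarrow> (\<integral>x. u x * iexp (t * x) \<partial>lborel)"
  proof (rule integral_dominated_convergence[OF _ _ e[of "\<bar>t\<bar>"]])
    show "AE x in lborel. (\<lambda>N. u x * (\<Sum>n<N. ?term n x)) \<longlonglongrightarrow> u x * iexp (t * x)"
      by (intro AE_I2 tendsto_mult_left) (use summable_LIMSEQ[OF summable_exp_generic] in \<open>simp add: exp_def\<close>)
    show "AE x in lborel. cmod (u x * (\<Sum>n<N. ?term n x)) \<le> cmod (u x) * exp (\<bar>t\<bar> * \<bar>x\<bar>)" for N
      unfolding norm_mult by (intro AE_I2 mult_left_mono bnd) auto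
  qed measurable
  moreover have "(\<integral>x. u x * (\<Sum>n<N. ?term n x) \<partial>lborel) = 0" for N
  proof -
    have "(\<integral>x. u x * (\<Sum>n<N. ?term n x) \<partial>lborel) =
      (\<integral>x. (\<Sum>n<N. ((\<i> * of_real t) ^ n /\<^sub>R fact n) * (u x * of_real x ^ n)) \<partial>lborel)"
      by (intro Bochner_Integration.integral_cong refl)
         (simp add: sum_distrib_left power_mult_distrib mult_ac scaleR_conv_of_real)
    also have "\<dots> = (\<Sum>n<N. \<integral>x. ((\<i> * of_real t) ^ n /\<^sub>R fact n) * (u x * of_real x ^ n) \<partial>lborel)"
      by (intro Bochner_Integration.integral_sum integrable_mult_right i)
    also have "\<dots> = 0" by (simp add: m)
    finally show ?thesis .
  qed
  ultimately have "(\<lambda>N. 0) \<longlonglongrightarrow> (\<integral>x. u x * iexp (t * x) \<partial>lborel)"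
    by simp
  then show "(\<integral>x. u x * iexp (t * x) \<partial>lborel) = 0"
    by (rule LIMSEQ_unique) simp
qed

text \<open>This class contains L^2 and is closed under multiplication by x^2, which L^2 is not.
  Hermite coefficients can thus identify x^2 f before it is known to be square integrable.\<close>

definition gauss_int :: "(real \<Rightarrow> complex) \<Rightarrow> bool" where
  "gauss_int f \<longleftrightarrow> f \<in> borel_measurable lborel \<and>
     (\<forall>b>0. integrable lborel (\<lambda>x. cmod (f x) * exp (- (b / 2) * x\<^sup>2)))"

lemma gauss_int_L2: assumes f: "f \<in> L2" shows "gauss_int f"
  unfolding gauss_int_def
proof (intro conjI allI impI)
  show [measurable]: "f \<in> borel_measurable lborel" using f by (simp add: L2_def)
  fix b :: real assume "b > 0"
  then have "integrable lborel (\<lambda>x. f x * gf b 1 x)"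
    using f gf_L2[of b 1] by (intro sqi_mult_integrable) (auto simp: L2_eq_sqi)
  then have "integrable lborel (\<lambda>x. cmod (f x * gf b 1 x))" by (rule integrable_norm)
  then show "integrable lborel (\<lambda>x. cmod (f x) * exp (- (b / 2) * x\<^sup>2))"
    by (simp add: norm_mult gf_def)
qed

lemma gauss_int_diff:
  assumes f: "gauss_int f" and g: "gauss_int g" shows "gauss_int (\<lambda>x. f x - g x)"
  unfolding gauss_int_def
proof (intro conjI allI impI)
  have [measurable]: "f \<in> borel_measurable lborel" "g \<in> borel_measurable lborel"
    using f g by (auto simp: gauss_int_def)
  show "(\<lambda>x. f x - g x) \<in> borel_measurable lborel" by measurable
  fix b :: real assume b: "b > 0"
  have "cmod (f x - g x) * e \<le> cmod (f x) * e + cmod (g x) * e" if "e \<ge> 0" for x e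
    using mult_right_mono[OF norm_triangle_ineq4[of "f x" "g x"] that] by (simp add: ring_distribs)
  moreover have "integrable lborel (\<lambda>x. cmod (f x) * exp (- (b / 2) * x\<^sup>2) + cmod (g x) * exp (- (b / 2) * x\<^sup>2))"
    using f g b by (intro Bochner_Integration.integrable_add) (auto simp: gauss_int_def)
  ultimately show "integrable lborel (\<lambda>x. cmod (f x - g x) * exp (- (b / 2) * x\<^sup>2))"
    by (elim Bochner_Integration.integrable_bound) (auto intro!: AE_I2 simp del: minus_mult_left[symmetric])
qed

lemma gauss_int_sq: assumes f: "gauss_int f" shows "gauss_int (\<lambda>x. of_real (x\<^sup>2) * f x)"
  unfolding gauss_int_def
proof (intro conjI allI impI)
  have [measurable]: "f \<in> borel_measurable lborel" using f by (auto simp: gauss_int_def)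
  show "(\<lambda>x. of_real (x\<^sup>2) * f x) \<in> borel_measurable lborel" by measurable
  fix b :: real assume b: "b > 0"
  have "x\<^sup>2 * exp (- (b / 2) * x\<^sup>2) \<le> 4 / b * exp (- (b / 2 / 2) * x\<^sup>2)" for x :: real
  proof -
    have "b / 4 * x\<^sup>2 \<le> exp (b / 4 * x\<^sup>2)" using exp_ge_add_one_self[of "b / 4 * x\<^sup>2"] by linarith
    then have "x\<^sup>2 \<le> 4 / b * exp (b / 4 * x\<^sup>2)" using b by (simp add: field_simps)
    then have "x\<^sup>2 * exp (- (b / 2) * x\<^sup>2) \<le> 4 / b * exp (b / 4 * x\<^sup>2) * exp (- (b / 2) * x\<^sup>2)"
      by (rule mult_right_mono) simp
    also have "\<dots> = 4 / b * exp (- (b / 2 / 2) * x\<^sup>2)"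
      unfolding mult.assoc exp_add[symmetric] by (simp add: algebra_simps)
    finally show ?thesis .
  qed
  then have "cmod (f x) * (x\<^sup>2 * exp (- (b / 2) * x\<^sup>2)) \<le> cmod (f x) * (4 / b * exp (- (b / 2 / 2) * x\<^sup>2))" for x
    by (intro mult_left_mono) auto
  moreover have "integrable lborel (\<lambda>x. 4 / b * (cmod (f x) * exp (- (b / 2 / 2) * x\<^sup>2)))"
    using f b unfolding gauss_int_def by (intro integrable_mult_right) (metis half_gt_zero)
  ultimately show "integrable lborel (\<lambda>x. cmod (of_real (x\<^sup>2) * f x) * exp (- (b / 2) * x\<^sup>2))"
    by (elim Bochner_Integration.integrable_bound) (use b in \<open>auto intro!: AE_I2 simp: norm_mult norm_power abs_mult mult_ac\<close>)
qed

lemma gauss_int_cmult: "gauss_int f \<Longrightarrow> gauss_int (\<lambda>x. c * f x)"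
  by (auto simp: gauss_int_def norm_mult mult.assoc)

lemma gauss_int_gf_integrable:
  assumes f: "gauss_int f" and a: "a > 0" shows "integrable lborel (\<lambda>x. gf a p x * f x)"
proof -
  have [measurable]: "f \<in> borel_measurable lborel" using f by (auto simp: gauss_int_def)
  obtain C where C: "C \<ge> 0" "\<And>x. cmod (gf a p x) \<le> C * exp (- ((a/2) / 2) * x\<^sup>2)" using gf_bound[of "a/2" a p] a by auto
  have i: "integrable lborel (\<lambda>x. C * (cmod (f x) * exp (- ((a/2) / 2) * x\<^sup>2)))"
    using f a unfolding gauss_int_def by (intro integrable_mult_right) (metis half_gt_zero)
  have "cmod (gf a p x * f x) \<le> C * (cmod (f x) * exp (- ((a/2) / 2) * x\<^sup>2))" for x
    using mult_right_mono[OF C(2)[of x], of "cmod (f x)"] by (simp add: norm_mult mult_ac)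
  then show ?thesis
    by (intro Bochner_Integration.integrable_bound[OF i]) (auto intro!: AE_I2 intro: order_trans[OF _ abs_ge_self])
qed

text \<open>Half of the Gaussian absorbs any exponential e^(c|x|), so \<open>gf a 1\<close> times
  \<open>f\<close> meets the growth condition of \<open>moments_unique\<close>; its moments are the
  integrals against \<open>gf a (monom 1 n)\<close>.\<close>

lemma gauss_int_unique:
  assumes f: "gauss_int f" and a: "a > 0" and z: "\<And>p. (\<integral>x. gf a p x * f x \<partial>lborel) = 0"
  shows "AE x in lborel. f x = 0"
proof -
  have [measurable]: "f \<in> borel_measurable lborel" using f by (auto simp: gauss_int_def)
  have "AE x in lborel. gf a 1 x * f x = 0"
  proof (rule moments_unique)
    fix c :: real
    have i: "integrable lborel (\<lambda>x. exp (c\<^sup>2 / a) * (cmod (f x) * exp (- ((a/2) / 2) * x\<^sup>2)))"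
      using f a unfolding gauss_int_def by (intro integrable_mult_right) (metis half_gt_zero)
    have "cmod (gf a 1 x * f x) * exp (c * \<bar>x\<bar>) \<le> exp (c\<^sup>2 / a) * (cmod (f x) * exp (- ((a/2) / 2) * x\<^sup>2))" for x
    proof -
      \<comment> \<open>Completing the square; the leftover constant is the factor exp(c^2/a) in the
        bound.\<close>
      have "0 \<le> (c / sqrt a - sqrt a * \<bar>x\<bar> / 2)\<^sup>2" by simp
      also have "\<dots> = c\<^sup>2 / a - c * \<bar>x\<bar> + a * x\<^sup>2 / 4"
        using a by (simp add: power2_diff power_divide power_mult_distrib)
      finally have "- (a / 2) * x\<^sup>2 + c * \<bar>x\<bar> \<le> c\<^sup>2 / a + - ((a/2) / 2) * x\<^sup>2" by simp
      then have "exp (- (a / 2) * x\<^sup>2) * exp (c * \<bar>x\<bar>) \<le> exp (c\<^sup>2 / a) * exp (- ((a/2) / 2) * x\<^sup>2)"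
        unfolding exp_add[symmetric] by simp
      then have "cmod (f x) * (exp (- (a / 2) * x\<^sup>2) * exp (c * \<bar>x\<bar>)) \<le> cmod (f x) * (exp (c\<^sup>2 / a) * exp (- ((a/2) / 2) * x\<^sup>2))"
        by (rule mult_left_mono) simp
      then show ?thesis by (simp add: gf_def norm_mult mult_ac)
    qed
    then show "integrable lborel (\<lambda>x. cmod (gf a 1 x * f x) * exp (c * \<bar>x\<bar>))"
      by (intro Bochner_Integration.integrable_bound[OF i]) (auto intro!: AE_I2)
    fix n
    have "gf a 1 x * f x * of_real x ^ n = gf a (monom 1 n) x * f x" for x
      by (simp add: gf_def poly_monom)
    then show "(\<integral>x. gf a 1 x * f x * of_real x ^ n \<partial>lborel) = 0" by (simp only: z)
  qed measurable
  then show ?thesis by eventually_elim (simp add: gf_def)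
qed

section \<open>Hermite functions\<close>

text \<open>The recursion is the creation operator in polynomial form. \<open>hp 1 n\<close> is the
  physicists' Hermite polynomial H_n, and for positive \<open>r\<close> the polynomial
  \<open>hp r n\<close> is r^(n/2) H_n(sqrt(r) x).\<close>

fun hp :: "real \<Rightarrow> nat \<Rightarrow> complex poly" where
  "hp r 0 = 1"
| "hp r (Suc n) = smult (of_real (2 * r)) (pCons 0 (hp r n)) - pderiv (hp r n)"

text \<open>Commuting the derivative past one creation step 2rx - d/dx adds 2r, so n + 1 steps add
  up to the stated factor.\<close>

lemma pderiv_hp: "pderiv (hp r (Suc n)) = smult (of_real (2 * r * real (Suc n))) (hp r n)"
proof (induction n)
  case 0
  then show ?case by (simp add: pderiv_diff pderiv_smult pderiv_pCons)
next
  case (Suc n)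
  have "pderiv (hp r (Suc (Suc n))) = smult (of_real (2 * r)) (hp r (Suc n) + pCons 0 (pderiv (hp r (Suc n))))
      - pderiv (pderiv (hp r (Suc n)))"
    by (simp only: hp.simps(2)[of r "Suc n"] pderiv_diff pderiv_smult pderiv_pCons)
  also have "\<dots> = smult (of_real (2 * r)) (hp r (Suc n)) + smult (of_real (2 * r * real (Suc n)))
      (smult (of_real (2 * r)) (pCons 0 (hp r n)) - pderiv (hp r n))"
    by (simp only: Suc.IH pderiv_smult) (simp add: smult_add_right smult_diff_right algebra_simps)
  also have "\<dots> = smult (of_real (2 * r * real (Suc (Suc n)))) (hp r (Suc n))"
    by (simp only: hp.simps(2)[symmetric] smult_add_left[symmetric] of_real_add[symmetric]) (simp add: algebra_simps)
  finally show ?case .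
qed

lemma X_hp_Suc: "smult (of_real (2 * r)) (pCons 0 (hp r (Suc n))) =
    hp r (Suc (Suc n)) + smult (of_real (2 * r * real (Suc n))) (hp r n)"
  unfolding pderiv_hp[symmetric] by simp

lemma X_hp_0: "smult (of_real (2 * r)) (pCons 0 (hp r 0)) = hp r 1"
  by simp

text \<open>For positive \<open>r\<close>, the squared L^2 norm of \<open>gf r (hp r n)\<close>, by
  \<open>integral_hp_hp\<close>.\<close>

definition hN :: "real \<Rightarrow> nat \<Rightarrow> real" where
  "hN r n = (2 * r) ^ n * fact n * sqrt (pi / r)"

lemma hN_pos: "r > 0 \<Longrightarrow> hN r n > 0"
  by (simp add: hN_def)

lemma hN_Suc: "hN r (Suc n) = 2 * r * real (Suc n) * hN r n"
  by (simp add: hN_def)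

lemma integral_gf_diff: "a > 0 \<Longrightarrow> (\<integral>x. gf a (p - q) x \<partial>lborel) = (\<integral>x. gf a p x \<partial>lborel) - (\<integral>x. gf a q x \<partial>lborel)"
  by (simp add: gf_diff gf_integrable)

lemma integral_gf_smult: "(\<integral>x. gf a (smult c p) x \<partial>lborel) = c * (\<integral>x. gf a p x \<partial>lborel)"
  by (simp add: gf_smult)

text \<open>Integration by parts: the two integrands differ by a total derivative, so the creation
  step on one factor becomes a derivative of the other. With \<open>pderiv_hp\<close> this lowers
  both indices at once.\<close>

lemma integral_hp_raise:
  assumes r: "r > 0"
  shows "(\<integral>x. gf (2 * r) (hp r (Suc m) * q) x \<partial>lborel) = (\<integral>x. gf (2 * r) (hp r m * pderiv q) x \<partial>lborel)"
proof -
  have "hp r (Suc m) * q = hp r m * pderiv q - gD (2 * r) (hp r m * q)"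
    by (simp add: gD_def pderiv_mult algebra_simps)
  then show ?thesis using r by (simp add: integral_gf_diff integral_gf_gD)
qed

lemma integral_hp_hp:
  assumes r: "r > 0"
  shows "(\<integral>x. gf (2 * r) (hp r m * hp r n) x \<partial>lborel) = (if m = n then of_real (hN r n) else 0)"
proof (induction m arbitrary: n)
  case 0
  show ?case
  proof (cases n)
    case 0
    have "(\<integral>x. gf (2 * r) 1 x \<partial>lborel) = fourier (gf (2 * r) 1) 0" by (simp add: fourier_def)
    also have "\<dots> = of_real (sqrt (2 * pi / (2 * r)))" using r by (subst fourier_gauss) (auto simp: gf_def)
    finally show ?thesis using 0 by (simp add: hN_def)
  next
    case (Suc k)
    have "(\<integral>x. gf (2 * r) (hp r (Suc k) * 1) x \<partial>lborel) = (\<integral>x. gf (2 * r) (hp r k * pderiv 1) x \<partial>lborel)"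
      by (rule integral_hp_raise[OF r])
    then show ?thesis using Suc by (simp del: hp.simps(2))
  qed
next
  case (Suc m)
  show ?case
  proof (cases n)
    case 0
    then show ?thesis using integral_hp_raise[OF r, of m 1] by (simp del: hp.simps(2))
  next
    case (Suc k)
    have "(\<integral>x. gf (2 * r) (hp r (Suc m) * hp r n) x \<partial>lborel) = of_real (2 * r * real (Suc k)) * (if m = k then of_real (hN r k) else 0)"
      unfolding integral_hp_raise[OF r] Suc pderiv_hp mult_smult_right integral_gf_smult Suc.IH ..
    then show ?thesis unfolding Suc hN_Suc by simp
  qed
qed

definition hf :: "real \<Rightarrow> nat \<Rightarrow> real \<Rightarrow> complex" where
  "hf r n x = of_real (1 / sqrt (hN r n)) * gf r (hp r n) x"

lemma hf_eq_gf: "hf r n = gf r (smult (of_real (1 / sqrt (hN r n))) (hp r n))"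
  by (intro ext) (simp only: hf_def gf_smult)

lemma real_coeffs_hp: "coeff (hp r n) i \<in> \<real>"
proof (induction n arbitrary: i)
  case 0
  then show ?case by (cases i) (auto simp: coeff_1)
next
  case (Suc n)
  then show ?case by (cases i) (auto simp: coeff_pderiv intro!: Reals_diff Reals_mult)
qed

lemma cnj_hf [simp]: "cnj (hf r n x) = hf r n x"
proof -
  have "poly (hp r n) (of_real x) \<in> \<real>"
    unfolding poly_altdef by (intro sum_in_Reals Reals_mult real_coeffs_hp Reals_power) auto
  then have "cnj (poly (hp r n) (of_real x)) = poly (hp r n) (of_real x)" by (simp add: Reals_cnj_iff)
  then show ?thesis by (simp add: hf_def gf_def)
qed

lemma hf_L2: "r > 0 \<Longrightarrow> hf r n \<in> L2"
  unfolding hf_eq_gf by (rule gf_L2)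

lemma ip_hf: "ipL (hf r n) f = (\<integral>x. hf r n x * f x \<partial>lborel)"
  by (simp add: ip_def)

lemma ip_hf_hf:
  assumes r: "r > 0" shows "ipL (hf r m) (hf r n) = (if m = n then 1 else 0)"
proof -
  have "hf r m x * hf r n x = of_real (1 / sqrt (hN r m)) * of_real (1 / sqrt (hN r n)) * gf (2 * r) (hp r m * hp r n) x" for x
    using gf_times[of r "hp r m" x r "hp r n"] by (simp add: hf_def mult_ac)
  then have "ipL (hf r m) (hf r n) = of_real (1 / sqrt (hN r m)) * of_real (1 / sqrt (hN r n)) * (if m = n then of_real (hN r n) else 0)"
    unfolding ip_hf by (simp add: integral_hp_hp[OF r])
  also have "\<dots> = (if m = n then 1 else 0)"
    using hN_pos[OF r, of n] by (simp flip: of_real_mult)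
  finally show ?thesis .
qed

text \<open>The recurrence writes x \<open>hp r n\<close> through the neighbours
  \<open>hp r (n + 1)\<close> and \<open>hp r (n - 1)\<close>, so induction on \<open>p\<close> with
  \<open>n\<close> arbitrary spreads the vanishing from Hermite functions to all
  polynomials.\<close>

lemma hf_total_gf:
  assumes f: "gauss_int f" and r: "r > 0" and z: "\<And>n. (\<integral>x. hf r n x * f x \<partial>lborel) = 0"
  shows "(\<integral>x. gf r (p * hp r n) x * f x \<partial>lborel) = 0"
proof -
  let ?I = "\<lambda>p. \<integral>x. gf r p x * f x \<partial>lborel"
  note i = gauss_int_gf_integrable[OF f r]
  have add: "?I (p + q) = ?I p + ?I q" for p q
    unfolding gf_add distrib_right by (intro Bochner_Integration.integral_add i)
  have sm: "?I (smult c p) = c * ?I p" for c p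
    by (simp add: gf_smult mult.assoc)
  have h0: "?I (hp r n) = 0" for n
    using z[of n] hN_pos[OF r, of n] by (simp add: hf_def mult.assoc)
  show ?thesis
  proof (induction p arbitrary: n)
    case (pCons c p)
    have X: "of_real (2 * r) * ?I (pCons 0 p * hp r n) = 0"
    proof -
      have e: "smult (of_real (2 * r)) (pCons 0 p * hp r n) = p * smult (of_real (2 * r)) (pCons 0 (hp r n))"
        by simp
      show ?thesis
      proof (cases n)
        case 0
        show ?thesis unfolding sm[symmetric] e unfolding 0 X_hp_0 by (rule pCons.IH)
      next
        case (Suc k)
        show ?thesis unfolding sm[symmetric] e unfolding Suc X_hp_Suc distrib_left add mult_smult_right sm pCons.IH by simp
      qed
    qed
    have "pCons c p * hp r n = smult c (hp r n) + pCons 0 p * hp r n" by simp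
    then have "?I (pCons c p * hp r n) = c * ?I (hp r n) + ?I (pCons 0 p * hp r n)" by (simp only: add sm)
    then show ?case using X r by (simp add: h0)
  qed simp
qed

lemma hf_total:
  assumes f: "gauss_int f" and r: "r > 0" and z: "\<And>n. (\<integral>x. hf r n x * f x \<partial>lborel) = 0"
  shows "AE x in lborel. f x = 0"
  by (rule gauss_int_unique[OF f r]) (use hf_total_gf[OF f r z, of _ 0] in simp)

lemma hilbert_basis_hf: assumes r: "r > 0" shows "hilbert_basis lborel (hf r)"
proof
  fix f assume f: "f \<in> sqi lborel" and "\<And>n. ipL (hf r n) f = 0"
  then show "AE x in lborel. f x = 0"
    unfolding ip_hf by (intro hf_total[OF _ r] gauss_int_L2) (auto simp: L2_eq_sqi)
qed (use hf_L2[OF r] ip_hf_hf[OF r] in \<open>auto simp: L2_eq_sqi\<close>)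

text \<open>\<open>x\<psi>\<^sub>n = ((n+1)/2r)\<^bsup>1/2\<^esup> \<psi>\<^sub>n\<^sub>+\<^sub>1 + (n/2r)\<^bsup>1/2\<^esup> \<psi>\<^sub>n\<^sub>-\<^sub>1\<close>; the second term vanishes for \<open>n = 0\<close>, whatever \<open>\<psi>\<^sub>n\<^sub>-\<^sub>1\<close> then denotes.\<close>

lemma hf_X:
  assumes r: "r > 0"
  shows "of_real x * hf r n x = of_real (sqrt (real (Suc n) / (2 * r))) * hf r (Suc n) x +
    of_real (sqrt (real n / (2 * r))) * hf r (n - 1) x"
proof -
  have g: "of_real (2 * r) * (of_real x * gf r (hp r n) x) = gf r (hp r (Suc n)) x + of_real (2 * r * real n) * gf r (hp r (n - 1)) x"
  proof -
    have "of_real (2 * r) * (of_real x * gf r (hp r n) x) = gf r (smult (of_real (2 * r)) (pCons 0 (hp r n))) x"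
      by (simp only: gf_smult gf_X)
    also have "smult (of_real (2 * r)) (pCons 0 (hp r n)) = hp r (Suc n) + smult (of_real (2 * r * real n)) (hp r (n - 1))"
    proof (cases n)
      case 0
      then show ?thesis by simp
    next
      case (Suc k)
      show ?thesis unfolding Suc X_hp_Suc by simp
    qed
    finally show ?thesis by (simp only: gf_add gf_smult)
  qed
  define s where "s = sqrt (hN r n)"
  have s: "s > 0" using hN_pos[OF r] by (simp add: s_def)
  have s1: "sqrt (hN r (Suc n)) = sqrt (2 * r * real (Suc n)) * s" by (simp add: hN_Suc real_sqrt_mult s_def)
  \<comment> \<open>By \<open>hN_Suc\<close>, consecutive norms have ratio sqrt(2r(n+1)); this turns
    the recurrence coefficients 1 and 2rn into the symmetric square roots.\<close>
  have c1: "1 / s = 2 * r * (sqrt (real (Suc n) / (2 * r)) / sqrt (hN r (Suc n)))"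
  proof -
    have "sqrt (real (Suc n) / (2 * r)) / sqrt (hN r (Suc n)) = sqrt (real (Suc n) / (2 * r) / (2 * r * real (Suc n))) / s"
      unfolding s1 real_sqrt_divide[of "real (Suc n) / (2 * r)"] by simp
    also have "real (Suc n) / (2 * r) / (2 * r * real (Suc n)) = (1 / (2 * r))\<^sup>2"
    proof -
      have "m / (2 * r) / (2 * r * m) = (1 / (2 * r))\<^sup>2" if "m > 0" for m
        using r that by (simp add: power2_eq_square field_simps)
      from this[of "real (Suc n)"] show ?thesis by (simp del: of_nat_Suc)
    qed
    finally show ?thesis using r by (simp add: real_sqrt_divide real_sqrt_mult)
  qed
  have c2: "2 * r * real n / s = 2 * r * (sqrt (real n / (2 * r)) / sqrt (hN r (n - 1)))"
  proof (cases n)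
    case (Suc k)
    have s2: "s = sqrt (2 * r * real n) * sqrt (hN r (n - 1))" by (simp add: Suc hN_Suc real_sqrt_mult s_def)
    have "real n = sqrt (real n / (2 * r)) * sqrt (2 * r * real n)"
      using r by (simp flip: real_sqrt_mult add: power2_eq_square[symmetric])
    then have "real n / s = sqrt (real n / (2 * r)) / sqrt (hN r (n - 1))"
      unfolding s2 using r Suc by (metis mult_divide_mult_cancel_right mult.commute of_nat_0_less_iff real_sqrt_eq_zero_cancel_iff less_numeral_extra(3) mult_pos_pos zero_less_Suc zero_less_numeral less_irrefl)
    then show ?thesis by (metis times_divide_eq_right)
  qed simp
  have "of_real (2 * r) * (of_real x * hf r n x) = of_real (1 / s) * (of_real (2 * r) * (of_real x * gf r (hp r n) x))"
    by (simp add: hf_def s_def)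
  also have "\<dots> = of_real (1 / s) * gf r (hp r (Suc n)) x + of_real (2 * r * real n / s) * gf r (hp r (n - 1)) x"
    unfolding g by (simp add: distrib_left)
  also have "\<dots> = of_real (2 * r) * (of_real (sqrt (real (Suc n) / (2 * r))) * hf r (Suc n) x +
    of_real (sqrt (real n / (2 * r))) * hf r (n - 1) x)"
  proof -
    have k: "complex_of_real (2 * r * (A / B)) = of_real (2 * r) * (of_real A * of_real (1 / B))" for A B :: real
      by simp
    show ?thesis unfolding c1 c2 hf_def k by (simp only: distrib_left mult.assoc)
  qed
  finally show ?thesis using r by (simp del: of_real_mult)
qed

lemma gD_hp: "gD r (hp r n) = smult (of_real r) (pCons 0 (hp r n)) - hp r (Suc n)"
proof -
  have "smult (of_real (2 * r)) (pCons 0 (hp r n)) = smult (of_real r) (pCons 0 (hp r n)) + smult (of_real r) (pCons 0 (hp r n))"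
    by (simp only: smult_add_left[symmetric] of_real_add[symmetric]) simp
  then show ?thesis by (simp add: gD_def)
qed

lemma gD_smult: "gD r (smult c p) = smult c (gD r p)"
  by (simp add: gD_def pderiv_smult smult_diff_right mult.commute)

lemma gD_diff: "gD r (p - q) = gD r p - gD r q"
  by (simp add: gD_def pderiv_diff smult_diff_right)

text \<open>The oscillator equation at the level of polynomials: \<open>gD_hp\<close> is applied,
  the derivative of \<open>hp r (Suc n)\<close> is taken by \<open>pderiv_hp\<close>, and
  \<open>gD_hp\<close> then eliminates that polynomial.\<close>

lemma gD_gD_hp: "gD r (gD r (hp r n)) =
    smult (of_real (r\<^sup>2)) (pCons 0 (pCons 0 (hp r n))) - smult (of_real (r * (2 * real n + 1))) (hp r n)"
proof -
  have "gD r (gD r (hp r n)) = smult (of_real r) (hp r n + pCons 0 (gD r (hp r n))) - gD r (hp r (Suc n))"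
    by (subst gD_hp) (simp only: gD_diff gD_smult gD_pCons)
  also have "gD r (hp r (Suc n)) = smult (of_real (2 * r * real (Suc n))) (hp r n) - smult (of_real r) (pCons 0 (hp r (Suc n)))"
    by (simp only: gD_def pderiv_hp)
  also have "hp r (Suc n) = smult (of_real r) (pCons 0 (hp r n)) - gD r (hp r n)"
    unfolding gD_hp by simp
  finally show ?thesis
    by (rule ssubst) (auto simp: poly_eq_iff coeff_pCons algebra_simps power2_eq_square split: nat.split)
qed

lemma hf_deriv2:
  "gf r (gD r (gD r (smult (of_real (1 / sqrt (hN r n))) (hp r n)))) x =
     (of_real (r\<^sup>2 * x\<^sup>2) - of_real (r * (2 * real n + 1))) * hf r n x"
proof -
  define c where "c = complex_of_real (1 / sqrt (hN r n))"
  show ?thesis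
    unfolding gD_smult gD_gD_hp gf_smult gf_diff gf_X hf_def c_def[symmetric]
    by (simp add: algebra_simps power2_eq_square)
qed

text \<open>The transform carries rx - d/dx to -ir(\<xi>/r - d/d\<xi>), the creation operator of
  width 1/r times -ir; each step contributes this factor.\<close>

lemma fourier_hp:
  assumes r: "r > 0"
  shows "fourier (gf r (hp r n)) \<xi> = of_real (sqrt (2 * pi / r)) * (- \<i> * of_real r) ^ n * gf (1 / r) (hp (1 / r) n) \<xi>"
proof (induction n arbitrary: \<xi>)
  case 0
  then show ?case using fourier_gauss[OF r] by simp
next
  case (Suc n)
  let ?c = "of_real (sqrt (2 * pi / r)) * (- \<i> * of_real r) ^ n"
  have IH: "fourier (gf r (hp r n)) \<xi> = gf (1 / r) (smult ?c (hp (1 / r) n)) \<xi>" for \<xi>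
    by (simp only: Suc.IH gf_smult)
  have "hp r (Suc n) = smult (of_real r) (pCons 0 (hp r n)) - gD r (hp r n)"
    unfolding gD_hp by simp
  then have "fourier (gf r (hp r (Suc n))) \<xi> = of_real r * fourier (gf r (pCons 0 (hp r n))) \<xi> - fourier (gf r (gD r (hp r n))) \<xi>"
    by (simp only: fourier_gf_diff[OF r] fourier_gf_smult)
  also have "\<dots> = of_real r * (\<i> * gf (1 / r) (gD (1 / r) (smult ?c (hp (1 / r) n))) \<xi>) - \<i> * of_real \<xi> * (?c * gf (1 / r) (hp (1 / r) n) \<xi>)"
    unfolding fourier_gf_X[OF r IH] fourier_gf_gD[OF r] Suc.IH ..
  also have "\<dots> = ?c * (- \<i> * of_real r) * gf (1 / r) (hp (1 / r) (Suc n)) \<xi>"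
    unfolding gD_smult gD_hp gf_smult gf_diff gf_X using r by (simp add: algebra_simps del: hp.simps)
  finally show ?case by (simp del: hp.simps add: mult_ac)
qed

lemma hN_inverse: assumes r: "r > 0" shows "sqrt (hN (1 / r) n) = sqrt r / r ^ n * sqrt (hN r n)"
proof -
  have "hN (1 / r) n = r / (r ^ n)\<^sup>2 * hN r n"
  proof -
    have "sqrt (pi / (1 / r)) = r * sqrt (pi / r)"
      using r by (simp add: real_sqrt_divide real_sqrt_mult real_div_sqrt field_simps)
    then show ?thesis using r
      by (simp add: hN_def power_divide power_mult_distrib power2_eq_square field_simps)
  qed
  then show ?thesis using r by (simp add: real_sqrt_mult real_sqrt_divide)
qed

lemma fourier_hf:
  assumes r: "r > 0"
  shows "fourier (hf r n) \<xi> = of_real (sqrt (2 * pi)) * (- \<i>) ^ n * hf (1 / r) n \<xi>"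
proof -
  define s where "s = sqrt (hN r n)"
  have s: "s > 0" using hN_pos[OF r] by (simp add: s_def)
  have "fourier (hf r n) \<xi> = of_real (1 / s) * (of_real (sqrt (2 * pi / r)) * (- \<i> * of_real r) ^ n * gf (1 / r) (hp (1 / r) n) \<xi>)"
    unfolding hf_def[abs_def] fourier_cmult fourier_hp[OF r] s_def by simp
  also have "\<dots> = of_real (sqrt (2 * pi)) * (- \<i>) ^ n * (of_real (1 / (sqrt r / r ^ n * s)) * gf (1 / r) (hp (1 / r) n) \<xi>)"
    unfolding power_mult_distrib using r s by (simp add: real_sqrt_divide field_simps)
  finally show ?thesis unfolding hf_def hN_inverse[OF r] s_def .
qed

lemma inv_fourier_hf:
  assumes r: "r > 0"
  shows "inv_fourier (hf r n) x = of_real (1 / sqrt (2 * pi)) * \<i> ^ n * hf (1 / r) n x"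
proof -
  have par: "hf a n (- x) = (-1) ^ n * hf a n x" for a
  proof -
    \<comment> \<open>Parity is proved jointly for the polynomial and its derivative because the
      recursion of \<open>hp\<close> involves both.\<close>
    have pd: "poly (hp a n) (- z) = (-1) ^ n * poly (hp a n) z \<and>
       poly (pderiv (hp a n)) (- z) = - ((-1) ^ n) * poly (pderiv (hp a n)) z" for z
    proof (induction n)
      case (Suc n)
      have "pderiv (hp a (Suc n)) = smult (of_real (2 * a * real (Suc n))) (hp a n)" by (rule pderiv_hp)
      with Suc show ?case by (simp add: algebra_simps)
    qed simp
    have "poly (hp a n) (of_real (- x)) = (-1) ^ n * poly (hp a n) (of_real x)"
      using pd[of "of_real x"] by simp
    then show ?thesis by (simp add: hf_def gf_def)
  qed
  have "inv_fourier (hf r n) x = of_real (sqrt (2 * pi)) / (2 * of_real pi) * ((- \<i>) ^ n * (-1) ^ n) * hf (1 / r) n x"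
    unfolding inv_fourier_eq fourier_hf[OF r] par by simp
  also have "(- \<i>) ^ n * (-1) ^ n = \<i> ^ n" by (simp flip: power_mult_distrib)
  also have "of_real (sqrt (2 * pi)) / (2 * of_real pi) = complex_of_real (1 / sqrt (2 * pi))"
  proof -
    have "sqrt (2 * pi) / (2 * pi) = 1 / sqrt (2 * pi)" by (simp add: field_simps)
    then show ?thesis by (metis of_real_divide of_real_mult of_real_numeral)
  qed
  finally show ?thesis .
qed

section \<open>The Fourier transform\<close>

text \<open>Width 1 is the positive width fixed by r -> 1/r, so the Fourier transform is diagonal in
  this basis.\<close>

interpretation hf_basis: hilbert_basis lborel "hf 1"
  by (rule hilbert_basis_hf) simp

abbreviation cF :: "nat \<Rightarrow> complex" where "cF n \<equiv> of_real (sqrt (2 * pi)) * (- \<i>) ^ n"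
abbreviation cI :: "nat \<Rightarrow> complex" where "cI n \<equiv> of_real (1 / sqrt (2 * pi)) * \<i> ^ n"

definition phase_syn :: "(nat \<Rightarrow> complex) \<Rightarrow> (real \<Rightarrow> complex) \<Rightarrow> real \<Rightarrow> complex" where
  "phase_syn c f = hf_basis.syn (\<lambda>n. c n * ipL (hf 1 n) f)"

lemma phase_syn_props:
  assumes "\<And>n. cmod (c n) = 1" "f \<in> L2"
  shows "phase_syn c f \<in> L2" "ipL (hf 1 n) (phase_syn c f) = c n * ipL (hf 1 n) f"
proof -
  have "summable (\<lambda>n. (cmod (c n * ipL (hf 1 n) f))\<^sup>2)"
    using assms hf_basis.coeff_summable[of f] by (simp add: norm_mult L2_eq_sqi)
  from hf_basis.syn_sqi[OF this] hf_basis.ip_e_syn[OF this]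
  show "phase_syn c f \<in> L2" "ipL (hf 1 n) (phase_syn c f) = c n * ipL (hf 1 n) f"
    by (simp_all add: phase_syn_def L2_eq_sqi)
qed

text \<open>\<open>FV\<close> is the unitary Fourier transform \<open>(2\<pi>)\<^bsup>-1/2\<^esup>\<F>\<close> on \<open>L\<^sup>2\<close>, and \<open>FW\<close> its inverse.\<close>

definition FV :: "(real \<Rightarrow> complex) \<Rightarrow> real \<Rightarrow> complex" where "FV = phase_syn (\<lambda>n. (- \<i>) ^ n)"
definition FW :: "(real \<Rightarrow> complex) \<Rightarrow> real \<Rightarrow> complex" where "FW = phase_syn (\<lambda>n. \<i> ^ n)"

lemma FV_L2: "f \<in> L2 \<Longrightarrow> FV f \<in> L2"
  unfolding FV_def by (rule phase_syn_props) (simp add: norm_power)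

lemma FW_L2: "f \<in> L2 \<Longrightarrow> FW f \<in> L2"
  unfolding FW_def by (rule phase_syn_props) (simp add: norm_power)

lemma ip_hf_FV: "f \<in> L2 \<Longrightarrow> ipL (hf 1 n) (FV f) = (- \<i>) ^ n * ipL (hf 1 n) f"
  unfolding FV_def by (rule phase_syn_props(2)) (simp add: norm_power)

lemma ip_hf_FW: "f \<in> L2 \<Longrightarrow> ipL (hf 1 n) (FW f) = \<i> ^ n * ipL (hf 1 n) f"
  unfolding FW_def by (rule phase_syn_props(2)) (simp add: norm_power)

lemma i_power_mult: "(- \<i>) ^ n * \<i> ^ n = 1" "\<i> ^ n * (- \<i>) ^ n = 1"
  by (simp_all flip: power_mult_distrib)

lemma L2_eqI_hf:
  assumes "f \<in> L2" "g \<in> L2" "\<And>n. ipL (hf 1 n) f = ipL (hf 1 n) g"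
  shows "AE x in lborel. f x = g x"
  using assms hf_basis.eqI_AE[of f g] by (simp add: L2_eq_sqi)

text \<open>The factors (-i)^n have modulus 1, so they cancel in Parseval's series.\<close>

interpretation four: diagonalization lborel FV FW
proof
  fix f g :: "real \<Rightarrow> complex" assume fg: "f \<in> L2" "g \<in> L2"
  have "(\<lambda>n. cnj (ipL (hf 1 n) (FV f)) * ipL (hf 1 n) (FV g)) sums ipL (FV f) (FV g)"
    using fg FV_L2 by (intro hf_basis.parseval) (auto simp: L2_eq_sqi)
  moreover have "cnj (ipL (hf 1 n) (FV f)) * ipL (hf 1 n) (FV g) = cnj (ipL (hf 1 n) f) * ipL (hf 1 n) g" for n
  proof -
    have "cnj (ipL (hf 1 n) (FV f)) * ipL (hf 1 n) (FV g) =
       (\<i> ^ n * (- \<i>) ^ n) * (cnj (ipL (hf 1 n) f) * ipL (hf 1 n) g)"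
      using fg by (simp add: ip_hf_FV)
    then show ?thesis by (simp only: i_power_mult mult_1_left)
  qed
  moreover have "(\<lambda>n. cnj (ipL (hf 1 n) f) * ipL (hf 1 n) g) sums ipL f g"
    using fg by (intro hf_basis.parseval) (auto simp: L2_eq_sqi)
  ultimately show "ipL (FV f) (FV g) = ipL f g" by (simp add: sums_unique2)
next
  fix F :: "real \<Rightarrow> complex" assume "F \<in> sqi lborel"
  then have F: "F \<in> L2" by (simp add: L2_eq_sqi)
  show "AE x in lborel. FV (FW F) x = F x"
    using F by (intro L2_eqI_hf FV_L2 FW_L2) (simp_all add: ip_hf_FV ip_hf_FW FW_L2 i_power_mult flip: mult.assoc)
qed (auto simp: L2_eq_sqi[symmetric] FV_L2 FW_L2)

text \<open>No Plancherel estimate is needed: the partial sums of the Hermite expansion are an admissible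
  approximating sequence, and Hermite coefficients determine the limit.\<close>

lemma L2_extension_iff:
  assumes meas: "\<And>s. s \<in> L2 \<Longrightarrow> integrable lborel s \<Longrightarrow> T s \<in> borel_measurable lborel"
    and coef: "\<And>s n. s \<in> L2 \<Longrightarrow> integrable lborel s \<Longrightarrow> ipL (hf 1 n) (T s) = d n * ipL (hf 1 n) s"
    and lin: "\<And>c N. T (hf_basis.psum c N) = hf_basis.psum (\<lambda>n. d n * c n) N"
  shows "(f, g) \<in> L2_extension T \<longleftrightarrow> f \<in> L2 \<and> g \<in> L2 \<and> (\<forall>n. ipL (hf 1 n) g = d n * ipL (hf 1 n) f)"
proof (intro iffI conjI allI)
  assume "(f, g) \<in> L2_extension T"
  then obtain s where f: "f \<in> L2" and g: "g \<in> L2" and s: "\<And>n. s n \<in> L2" "\<And>n. integrable lborel (s n)"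
    and c: "L2_conv s f" "L2_conv (\<lambda>n. T (s n)) g" by (auto simp: L2_extension_def)
  show "f \<in> L2" "g \<in> L2" by fact+
  fix n
  have h: "hf 1 n \<in> L2" by (rule hf_L2) simp
  have [measurable]: "s k \<in> borel_measurable lborel" for k using s by (simp add: L2_def)
  have "(\<lambda>k. ipL (hf 1 n) (s k)) \<longlonglongrightarrow> ipL (hf 1 n) f"
    by (rule L2_conv_ip[OF _ f h c(1)]) measurable
  then have "(\<lambda>k. d n * ipL (hf 1 n) (s k)) \<longlonglongrightarrow> d n * ipL (hf 1 n) f"
    by (intro tendsto_mult_left)
  moreover have "(\<lambda>k. ipL (hf 1 n) (T (s k))) \<longlonglongrightarrow> ipL (hf 1 n) g"
    by (rule L2_conv_ip[OF meas[OF s] g h c(2)])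
  ultimately show "ipL (hf 1 n) g = d n * ipL (hf 1 n) f"
    unfolding coef[OF s] by (rule LIMSEQ_unique[rotated])
next
  assume fg: "f \<in> L2 \<and> g \<in> L2 \<and> (\<forall>n. ipL (hf 1 n) g = d n * ipL (hf 1 n) f)"
  let ?s = "hf_basis.psum (\<lambda>n. ipL (hf 1 n) f)"
  have s: "hf_basis.psum c N \<in> L2" for c N using hf_basis.psum_sqi by (simp add: L2_eq_sqi)
  have "integrable lborel (?s N)" for N
    unfolding hf_basis.psum_def[abs_def] hf_eq_gf
    by (intro Bochner_Integration.integrable_sum integrable_mult_right gf_integrable) simp
  moreover have "L2_conv ?s f"
    using fg hf_basis.sconv_psum[of f] s by (subst L2_conv_iff_sconv) (auto simp: L2_eq_sqi)
  moreover have "L2_conv (\<lambda>N. T (?s N)) g"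
    unfolding lin using fg hf_basis.sconv_psum[of g] s by (subst L2_conv_iff_sconv) (auto simp: L2_eq_sqi)
  ultimately show "(f, g) \<in> L2_extension T"
    using fg s unfolding L2_extension_def by blast
qed

section \<open>The Fourier operators and the frequency mask on L^2\<close>

lemma fourier_measurable [measurable]:
  assumes [measurable]: "s \<in> borel_measurable lborel"
  shows "fourier s \<in> borel_measurable lborel"
  unfolding fourier_def[abs_def] by measurable

text \<open>The multiplication formula, by Fubini. The sign \<sigma> covers the transform (1) and
  its inverse (-1) together.\<close>

lemma fourier_exchange:
  assumes s: "integrable lborel s" and h: "integrable lborel h"
  shows "(\<integral>x. h x * fourier s (\<sigma> * x) \<partial>lborel) = (\<integral>y. s y * fourier h (\<sigma> * y) \<partial>lborel)"
proof -
  note [measurable] = borel_measurable_integrable[OF s] borel_measurable_integrable[OF h]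
  let ?f = "\<lambda>x y. h x * (s y * exp (- \<i> * of_real ((\<sigma> * x) * y)))"
  have "integrable (lborel \<Otimes>\<^sub>M lborel) (case_prod ?f)"
  proof (rule lborel_pair.Fubini_integrable)
    show "case_prod ?f \<in> borel_measurable (lborel \<Otimes>\<^sub>M lborel)" by measurable
    have "(\<integral>y. norm (case_prod ?f (x, y)) \<partial>lborel) = cmod (h x) * (\<integral>y. cmod (s y) \<partial>lborel)" for x
      by (simp only: split norm_mult norm_iexp mult_1_right integral_mult_right_zero)
    then show "integrable lborel (\<lambda>x. \<integral>y. norm (case_prod ?f (x, y)) \<partial>lborel)"
      using h by (simp only: integrable_mult_left integrable_norm)
    show "AE x in lborel. integrable lborel (\<lambda>y. case_prod ?f (x, y))"
      using fourier_integrable[OF s] by (auto intro!: AE_I2 simp del: of_real_mult)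
  qed
  from lborel_pair.Fubini_integral[OF this]
  have e1: "(\<integral>y. (\<integral>x. ?f x y \<partial>lborel) \<partial>lborel) = (\<integral>x. (\<integral>y. ?f x y \<partial>lborel) \<partial>lborel)" .
  have e2: "(\<integral>y. ?f x y \<partial>lborel) = h x * fourier s (\<sigma> * x)" for x
    by (simp only: fourier_def integral_mult_right_zero)
  have e3: "(\<integral>x. ?f x y \<partial>lborel) = s y * fourier h (\<sigma> * y)" for y
  proof -
    have "?f x y = s y * (h x * exp (- \<i> * of_real (\<sigma> * y * x)))" for x by (simp add: mult_ac)
    then show ?thesis by (simp only: fourier_def integral_mult_right_zero)
  qed
  show ?thesis using e1 unfolding e2 e3 by (rule sym)
qed

lemma hf_integrable: "r > 0 \<Longrightarrow> integrable lborel (hf r n)"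
  unfolding hf_eq_gf by (rule gf_integrable)

lemma ip_hf_fourier:
  assumes "integrable lborel s"
  shows "ipL (hf 1 n) (fourier s) = cF n * ipL (hf 1 n) s"
proof -
  have "ipL (hf 1 n) (fourier s) = (\<integral>y. s y * fourier (hf 1 n) y \<partial>lborel)"
    unfolding ip_hf using fourier_exchange[OF assms hf_integrable[of 1 n], of 1] by simp
  also have "\<dots> = (\<integral>y. cF n * (hf 1 n y * s y) \<partial>lborel)"
    by (simp add: fourier_hf mult_ac)
  finally show ?thesis by (simp only: ip_hf integral_mult_right_zero)
qed

lemma ip_hf_inv_fourier:
  assumes "integrable lborel s"
  shows "ipL (hf 1 n) (inv_fourier s) = cI n * ipL (hf 1 n) s"
proof -
  have "ipL (hf 1 n) (inv_fourier s) = (\<integral>x. hf 1 n x * fourier s (- 1 * x) / (2 * of_real pi) \<partial>lborel)"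
    unfolding ip_hf inv_fourier_eq by simp
  also have "\<dots> = (\<integral>x. hf 1 n x * fourier s (- 1 * x) \<partial>lborel) / (2 * of_real pi)"
    by simp
  also have "\<dots> = (\<integral>y. s y * fourier (hf 1 n) (- 1 * y) \<partial>lborel) / (2 * of_real pi)"
    by (subst fourier_exchange[OF assms hf_integrable]) simp_all
  also have "\<dots> = (\<integral>y. s y * inv_fourier (hf 1 n) y \<partial>lborel)"
    unfolding inv_fourier_eq by simp
  also have "\<dots> = (\<integral>y. cI n * (hf 1 n y * s y) \<partial>lborel)"
    by (simp add: inv_fourier_hf mult_ac)
  finally show ?thesis by (simp only: ip_hf integral_mult_right_zero)
qed

lemma fourier_psum: "fourier (hf_basis.psum c N) = hf_basis.psum (\<lambda>n. cF n * c n) N"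
proof
  fix \<xi>
  have i: "integrable lborel (hf_basis.psum c N)" for N
    unfolding hf_basis.psum_def[abs_def]
    by (intro Bochner_Integration.integrable_sum integrable_mult_right hf_integrable) simp
  show "fourier (hf_basis.psum c N) \<xi> = hf_basis.psum (\<lambda>n. cF n * c n) N \<xi>"
  proof (induction N)
    case 0
    then show ?case by (simp add: hf_basis.psum_def[abs_def] fourier_def)
  next
    case (Suc N)
    have "hf_basis.psum c (Suc N) = (\<lambda>x. hf_basis.psum c N x + c N * hf 1 N x)"
      by (simp add: hf_basis.psum_def[abs_def])
    then have A: "fourier (hf_basis.psum c (Suc N)) \<xi> = fourier (hf_basis.psum c N) \<xi> + c N * fourier (hf 1 N) \<xi>"
      by (simp add: fourier_add i hf_integrable fourier_cmult)
    show ?case unfolding A Suc.IH by (simp add: fourier_hf hf_basis.psum_def mult_ac)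
  qed
qed

lemma inv_fourier_psum: "inv_fourier (hf_basis.psum c N) = hf_basis.psum (\<lambda>n. cI n * c n) N"
proof
  fix x
  have "inv_fourier (hf_basis.psum c N) x = (\<Sum>n<N. c n * inv_fourier (hf 1 n) x)"
    unfolding inv_fourier_eq fourier_psum by (simp add: fourier_hf hf_basis.psum_def sum_divide_distrib mult_ac)
  then show "inv_fourier (hf_basis.psum c N) x = hf_basis.psum (\<lambda>n. cI n * c n) N x"
    by (simp add: inv_fourier_hf hf_basis.psum_def mult_ac)
qed

lemma inv_fourier_measurable [measurable]:
  assumes [measurable]: "s \<in> borel_measurable lborel"
  shows "inv_fourier s \<in> borel_measurable lborel"
  unfolding inv_fourier_eq[abs_def] by measurable

lemma fourier_op_iff: "(f, g) \<in> fourier_op \<longleftrightarrow>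
    f \<in> L2 \<and> g \<in> L2 \<and> (AE x in lborel. g x = of_real (sqrt (2 * pi)) * FV f x)"
proof -
  have "(f, g) \<in> fourier_op \<longleftrightarrow> f \<in> L2 \<and> g \<in> L2 \<and>
     (\<forall>n. ipL (hf 1 n) g = cF n * ipL (hf 1 n) f)"
    unfolding fourier_op_def
    by (rule L2_extension_iff) (auto simp: L2_def ip_hf_fourier fourier_psum)
  moreover have "(\<forall>n. ipL (hf 1 n) g = cF n * ipL (hf 1 n) f) \<longleftrightarrow>
     (AE x in lborel. g x = of_real (sqrt (2 * pi)) * FV f x)" if f: "f \<in> L2" and g: "g \<in> L2"
  proof -
    let ?g = "\<lambda>x. of_real (sqrt (2 * pi)) * FV f x"
    have L: "?g \<in> L2" by (intro L2_cmult FV_L2 f)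
    have "ipL (hf 1 n) ?g = cF n * ipL (hf 1 n) f" for n
      by (simp add: ip_cmult_right ip_hf_FV f)
    then show ?thesis
      using L2_eqI_hf[OF g L] ip_cong_AE[of "hf 1 _" lborel g "hf 1 _" ?g] g L hf_L2[of 1]
      by (auto simp: L2_def)
  qed
  ultimately show ?thesis by blast
qed

text \<open>Phrased through \<open>FV g\<close> rather than an inverse of \<open>FV\<close>, so that
  in \<open>freq_mask_op\<close> both ends carry the same factor sqrt(2 pi), which then
  cancels.\<close>

lemma inv_fourier_op_iff: "(f, g) \<in> inv_fourier_op \<longleftrightarrow>
    f \<in> L2 \<and> g \<in> L2 \<and> (AE x in lborel. f x = of_real (sqrt (2 * pi)) * FV g x)"
proof -
  have "(f, g) \<in> inv_fourier_op \<longleftrightarrow> f \<in> L2 \<and> g \<in> L2 \<and>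
     (\<forall>n. ipL (hf 1 n) g = cI n * ipL (hf 1 n) f)"
    unfolding inv_fourier_op_def
    by (rule L2_extension_iff) (auto simp: L2_def ip_hf_inv_fourier inv_fourier_psum)
  moreover have "(\<forall>n. ipL (hf 1 n) g = cI n * ipL (hf 1 n) f) \<longleftrightarrow>
     (AE x in lborel. f x = of_real (sqrt (2 * pi)) * FV g x)" if f: "f \<in> L2" and g: "g \<in> L2"
  proof -
    let ?f = "\<lambda>x. of_real (sqrt (2 * pi)) * FV g x"
    have L: "?f \<in> L2" by (intro L2_cmult FV_L2 g)
    have e: "ipL (hf 1 n) ?f = of_real (sqrt (2 * pi)) * (- \<i>) ^ n * ipL (hf 1 n) g" for n
      by (simp add: ip_cmult_right ip_hf_FV g)
    have "(a = cI n * b) = (b = of_real (sqrt (2 * pi)) * (- \<i>) ^ n * a)" for a b n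
    proof -
      have 1: "cF n * cI n = 1"
      proof -
        have "cF n * cI n =
          of_real (sqrt (2 * pi) * (1 / sqrt (2 * pi))) * ((- \<i>) ^ n * \<i> ^ n)"
          by (simp only: of_real_mult mult_ac)
        then show ?thesis unfolding i_power_mult by simp
      qed
      have "(a = d * b) = (b = e * a)" if "e * d = 1" for d e :: complex
      proof -
        have "e * (d * b) = b" "d * (e * a) = a"
          using that by (simp_all add: mult.commute[of d] flip: mult.assoc)
        then show ?thesis by auto
      qed
      from this[OF 1] show ?thesis .
    qed
    then have "(\<forall>n. ipL (hf 1 n) g = cI n * ipL (hf 1 n) f) \<longleftrightarrow>
       (\<forall>n. ipL (hf 1 n) f = ipL (hf 1 n) ?f)" unfolding e by simp
    then show ?thesis
      using L2_eqI_hf[OF f L] ip_cong_AE[of "hf 1 _" lborel f "hf 1 _" ?f] f L hf_L2[of 1]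
      by (auto simp: L2_def)
  qed
  ultimately show ?thesis by blast
qed

lemma freq_mask_op_eq: "freq_mask_op m = four.dg m"
proof (intro set_eqI iffI)
  fix z assume z: "z \<in> freq_mask_op m"
  then obtain f p q g where z: "z = (f, g)" "(f, p) \<in> fourier_op" "(p, q) \<in> mult_op m" "(q, g) \<in> inv_fourier_op"
    by (auto simp: freq_mask_op_def)
  then have "AE x in lborel. p x = of_real (sqrt (2 * pi)) * FV f x"
     "AE x in lborel. q x = of_real (sqrt (2 * pi)) * FV g x" "AE x in lborel. q x = m x * p x"
    by (auto simp: fourier_op_iff inv_fourier_op_iff mult_op_def)
  then have "AE x in lborel. FV g x = m x * FV f x"
    by eventually_elim auto
  then show "z \<in> four.dg m" using z by (auto simp: four.dg_iff fourier_op_iff inv_fourier_op_iff)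
next
  fix z assume z: "z \<in> four.dg m"
  obtain f g where fg: "z = (f, g)" by (rule prod.exhaust)
  with z have f: "f \<in> L2" and g: "g \<in> L2" and ae: "AE x in lborel. FV g x = m x * FV f x"
    by (auto simp: four.dg_iff)
  let ?p = "\<lambda>x. of_real (sqrt (2 * pi)) * FV f x" and ?q = "\<lambda>x. of_real (sqrt (2 * pi)) * FV g x"
  have L: "?p \<in> L2" "?q \<in> L2" by (intro L2_cmult FV_L2 f g)+
  have "AE x in lborel. ?q x = m x * ?p x" using ae by eventually_elim simp
  then have "(?p, ?q) \<in> mult_op m" using L by (simp add: mult_op_def)
  moreover have "(f, ?p) \<in> fourier_op" "(?q, g) \<in> inv_fourier_op"
    using f g L by (simp_all add: fourier_op_iff inv_fourier_op_iff)
  ultimately show "z \<in> freq_mask_op m" unfolding freq_mask_op_def fg by blast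
qed

lemma L2_conv_const: "L2_conv (\<lambda>n. f) f"
  by (simp add: L2_conv_def)

lemma fourier_op_gf:
  assumes "a > 0" "b > 0" "\<And>x. fourier (gf a p) x = gf b q x"
  shows "(gf a p, gf b q) \<in> fourier_op"
proof -
  have "fourier (gf a p) = gf b q" using assms(3) by (rule ext)
  then show ?thesis
    using assms unfolding fourier_op_def L2_extension_def
    by (auto intro!: exI[of _ "\<lambda>n. gf a p"] L2_conv_const gf_L2 gf_integrable)
qed

lemma inv_fourier_op_gf:
  assumes "a > 0" "b > 0" "\<And>x. inv_fourier (gf a p) x = gf b q x"
  shows "(gf a p, gf b q) \<in> inv_fourier_op"
proof -
  have "inv_fourier (gf a p) = gf b q" using assms(3) by (rule ext)
  then show ?thesis
    using assms unfolding inv_fourier_op_def L2_extension_def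
    by (auto intro!: exI[of _ "\<lambda>n. gf a p"] L2_conv_const gf_L2 gf_integrable)
qed

section \<open>The Laplacian\<close>

text \<open>The second derivative of \<open>hf r n\<close>, written by means of the oscillator
  equation; see \<open>hf2_eq\<close>.\<close>

definition hf2 :: "real \<Rightarrow> nat \<Rightarrow> real \<Rightarrow> complex" where
  "hf2 r n x = (of_real (r\<^sup>2 * x\<^sup>2) - of_real (r * (2 * real n + 1))) * hf r n x"

definition hfp :: "real \<Rightarrow> nat \<Rightarrow> complex poly" where
  "hfp r n = smult (of_real (1 / sqrt (hN r n))) (hp r n)"

lemma hf_eq: "hf r n = gf r (hfp r n)"
  unfolding hfp_def by (rule hf_eq_gf)

lemma hf2_eq: "hf2 r n = gf r (gD r (gD r (hfp r n)))"
  unfolding hfp_def by (intro ext) (simp only: hf_deriv2 hf2_def)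

lemma hf2_L2: "r > 0 \<Longrightarrow> hf2 r n \<in> L2"
  unfolding hf2_eq by (rule gf_L2)

lemma cnj_hf2 [simp]: "cnj (hf2 r n x) = hf2 r n x"
  by (simp add: hf2_def)

lemma FV_gf:
  assumes "a > 0" "b > 0" "\<And>x. fourier (gf a p) x = gf b q x"
  shows "AE x in lborel. of_real (sqrt (2 * pi)) * FV (gf a p) x = gf b q x"
  using fourier_op_gf[OF assms] by (auto simp: fourier_op_iff elim: AE_mp)

lemma FV_hf:
  assumes r: "r > 0"
  shows "AE x in lborel. FV (hf r n) x = (- \<i>) ^ n * hf (1 / r) n x"
    "AE x in lborel. FV (hf2 r n) x = - ((- \<i>) ^ n * (of_real (x\<^sup>2) * hf (1 / r) n x))"
proof -
  let ?s = "complex_of_real (sqrt (2 * pi))"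
  let ?q = "smult (?s * (- \<i>) ^ n) (hfp (1 / r) n)"
  have F: "fourier (gf r (hfp r n)) x = gf (1 / r) ?q x" for x
    unfolding hf_eq[symmetric] fourier_hf[OF r] unfolding hf_eq gf_smult ..
  have "AE x in lborel. ?s * FV (hf r n) x = gf (1 / r) ?q x"
    unfolding hf_eq by (rule FV_gf[OF _ _ F]) (use r in auto)
  then show "AE x in lborel. FV (hf r n) x = (- \<i>) ^ n * hf (1 / r) n x"
    by eventually_elim (simp add: gf_smult hf_eq)
  have F2: "fourier (gf r (gD r (gD r (hfp r n)))) x = gf (1 / r) (smult (- 1) (pCons 0 (pCons 0 ?q))) x" for x
  proof -
    have "\<i> * a * (\<i> * a * b) = (\<i> * \<i>) * (a * (a * b))" for a b by (simp only: mult_ac)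
    then show ?thesis unfolding fourier_gf_gD[OF r] F gf_smult gf_X by simp
  qed
  have "AE x in lborel. ?s * FV (hf2 r n) x = gf (1 / r) (smult (- 1) (pCons 0 (pCons 0 ?q))) x"
    unfolding hf2_eq by (rule FV_gf[OF _ _ F2]) (use r in auto)
  then show "AE x in lborel. FV (hf2 r n) x = - ((- \<i>) ^ n * (of_real (x\<^sup>2) * hf (1 / r) n x))"
  proof eventually_elim
    case (elim x)
    then have "?s * FV (hf2 r n) x = ?s * - ((- \<i>) ^ n * (of_real (x\<^sup>2) * hf (1 / r) n x))"
      by (simp only: gf_smult gf_X hf_eq) (simp add: power2_eq_square mult_ac)
    moreover have "?s \<noteq> 0" by simp
    ultimately show ?case using mult_left_cancel by blast
  qed
qed

text \<open>Testing against Hermite functions alone suffices. On the Fourier side they become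
  Hermite functions of width 1/r, and although x^2 \<open>FV f\<close> need not lie in L^2, it lies
  in the class that \<open>hf_total\<close> covers.\<close>

lemma weak_laplacian_iff:
  assumes r: "r > 0" and f: "f \<in> L2" and g: "g \<in> L2"
  shows "(\<forall>n. ipL (hf r n) g = ipL (hf2 r n) f) \<longleftrightarrow>
    (AE x in lborel. FV g x = - of_real (x\<^sup>2) * FV f x)"
proof -
  have r': "1 / r > 0" using r by simp
  note Ff = FV_L2[OF f] and Fg = FV_L2[OF g]
  note gi = gauss_int_L2[OF Ff] gauss_int_L2[OF Fg]
  have [measurable]: "FV f \<in> borel_measurable lborel" "FV g \<in> borel_measurable lborel"
    using Ff Fg by (auto simp: L2_def)
  have [measurable]: "FV (hf r n) \<in> borel_measurable lborel" "FV (hf2 r n) \<in> borel_measurable lborel"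
    "hf a n \<in> borel_measurable borel" for n a
    using FV_L2[OF hf_L2[OF r]] FV_L2[OF hf2_L2[OF r]] by (auto simp: L2_def hf_eq)
  let ?c = "\<lambda>n. cnj ((- \<i>) ^ n)"
  have e1: "ipL (hf r n) g = ?c n * (\<integral>x. hf (1 / r) n x * FV g x \<partial>lborel)" for n
  proof -
    have "ipL (hf r n) g = ipL (FV (hf r n)) (FV g)"
      using hf_L2[OF r] g by (simp add: four.ip_V)
    also have "\<dots> = ipL (\<lambda>x. (- \<i>) ^ n * hf (1 / r) n x) (FV g)"
      using FV_hf(1)[OF r, of n] by (intro ip_cong_AE) auto
    also have "\<dots> = ?c n * (\<integral>x. hf (1 / r) n x * FV g x \<partial>lborel)"
      unfolding ip_cmult_left ip_hf ..
    finally show ?thesis .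
  qed
  have e2: "ipL (hf2 r n) f = ?c n * (\<integral>x. hf (1 / r) n x * (- of_real (x\<^sup>2) * FV f x) \<partial>lborel)" for n
  proof -
    have "ipL (hf2 r n) f = ipL (FV (hf2 r n)) (FV f)"
      using hf2_L2[OF r] f by (simp add: four.ip_V)
    also have "\<dots> = ipL (\<lambda>x. (- \<i>) ^ n * (- (of_real (x\<^sup>2) * hf (1 / r) n x))) (FV f)"
      using FV_hf(2)[OF r, of n] by (intro ip_cong_AE) auto
    also have "\<dots> = ?c n * (\<integral>x. hf (1 / r) n x * (- of_real (x\<^sup>2) * FV f x) \<partial>lborel)"
      unfolding ip_cmult_left by (simp add: ip_def mult_ac)
    finally show ?thesis .
  qed
  have gs: "gauss_int (\<lambda>x. - of_real (x\<^sup>2) * FV f x)"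
    using gauss_int_cmult[OF gauss_int_sq[OF gi(1)], of "-1"] by simp
  have i: "integrable lborel (\<lambda>x. hf (1 / r) n x * FV g x)"
     "integrable lborel (\<lambda>x. hf (1 / r) n x * (- of_real (x\<^sup>2) * FV f x))" for n
    unfolding hf_eq by (intro gauss_int_gf_integrable gi gs r')+
  have "(\<forall>n. ipL (hf r n) g = ipL (hf2 r n) f) \<longleftrightarrow>
    (\<forall>n. (\<integral>x. hf (1 / r) n x * (FV g x - (- of_real (x\<^sup>2) * FV f x)) \<partial>lborel) = 0)"
  proof -
    have "?c n \<noteq> 0" for n by simp
    then show ?thesis
      unfolding e1 e2 right_diff_distrib Bochner_Integration.integral_diff[OF i] by (simp only: mult_left_cancel right_minus_eq not_False_eq_True)
  qed
  also have "\<dots> \<longleftrightarrow> (AE x in lborel. FV g x - (- of_real (x\<^sup>2) * FV f x) = 0)"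
  proof
    assume "\<forall>n. (\<integral>x. hf (1 / r) n x * (FV g x - (- of_real (x\<^sup>2) * FV f x)) \<partial>lborel) = 0"
    then show "AE x in lborel. FV g x - (- of_real (x\<^sup>2) * FV f x) = 0"
      by (intro hf_total[OF gauss_int_diff[OF gi(2) gs] r']) blast
  next
    assume ae: "AE x in lborel. FV g x - (- of_real (x\<^sup>2) * FV f x) = 0"
    show "\<forall>n. (\<integral>x. hf (1 / r) n x * (FV g x - (- of_real (x\<^sup>2) * FV f x)) \<partial>lborel) = 0"
      by (intro allI integral_eq_zero_AE) (use ae in \<open>eventually_elim, simp\<close>)
  qed
  finally show ?thesis by (simp only: right_minus_eq)
qed

section \<open>Schwartz test functions\<close>

lemma D1_gf: "D1 (gf a p) = gf a (gD a p)"
  unfolding D1_def[abs_def] by (intro ext vector_derivative_at gf_deriv)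

lemma gf_schwartz: assumes a: "a > 0" shows "gf a p \<in> schwartz"
proof -
  have iter: "(D1 ^^ n) (gf a p) = gf a ((gD a ^^ n) p)" for n
    by (induction n) (auto simp: D1_gf)
  have X: "of_real (x ^ k) * gf a q x = gf a (monom 1 k * q) x" for x k q
    by (simp add: gf_def poly_monom)
  have b: "bounded (range (gf a q))" for q
  proof -
    \<comment> \<open>The value \<open>b = 0\<close> in \<open>gf_bound\<close> discards the decay
      and leaves a uniform bound.\<close>
    obtain C where "\<forall>x. cmod (gf a q x) \<le> C * exp (- (0 / 2) * x\<^sup>2)" using gf_bound[OF a, of q] by blast
    then show ?thesis by (intro boundedI[where B = C]) auto
  qed
  show ?thesis
    unfolding schwartz_def
    using gf_deriv by (auto simp: iter X b simp del: of_real_power intro: differentiableI_vector)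
qed

lemma schwartz_facts:
  assumes u: "u \<in> schwartz"
  shows "(u has_vector_derivative D1 u x) (at x)" "D1 u \<in> schwartz" "u \<in> L2" "continuous_on UNIV u"
    "\<exists>C. \<forall>x. cmod (u x) \<le> C"
proof -
  have d: "((D1 ^^ n) u) differentiable (at x)" and b: "bounded (range (\<lambda>x. of_real (x ^ k) * (D1 ^^ n) u x))" for n x k
    using u by (auto simp: schwartz_def)
  have dx: "(u has_vector_derivative D1 u x) (at x)" for x
    using d[of 0 x] by (simp add: D1_def vector_derivative_works)
  show "(u has_vector_derivative D1 u x) (at x)" by (rule dx)
  show "D1 u \<in> schwartz"
    unfolding schwartz_def using d[of "Suc _"] b[of _ "Suc _"] by (simp add: funpow_Suc_right del: funpow.simps)
  show c: "continuous_on UNIV u"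
    using dx by (intro continuous_at_imp_continuous_on) (auto intro: has_vector_derivative_continuous)
  have [measurable]: "u \<in> borel_measurable borel" by (rule borel_measurable_continuous_onI[OF c])
  obtain A where A: "\<And>x. cmod (u x) \<le> A" using b[of 0 0] by (auto simp: bounded_iff)
  then show "\<exists>C. \<forall>x. cmod (u x) \<le> C" by blast
  \<comment> \<open>The two bounds give (1 + x^2)|u| at most A + B; using A for one factor of |u|^2
    and this decay for the other gives an integrable majorant.\<close>
  obtain B where B: "\<And>x. cmod (of_real (x ^ 2) * u x) \<le> B" using b[of 2 0] by (auto simp: bounded_iff)
  have "integrable lborel (\<lambda>x::real. (A * (A + B)) * inverse (1 + x\<^sup>2))"
    using integrable_inverse_1_plus_square by (intro integrable_mult_right) (simp add: set_integrable_def)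
  then show "u \<in> L2"
    unfolding L2_eq_sqi
  proof (rule sqi_bound[rotated])
    fix x
    have "(1 + x\<^sup>2) * cmod (u x) \<le> A + B"
      using A[of x] B[of x] by (simp add: ring_distribs norm_mult norm_power)
    moreover have p: "1 + x\<^sup>2 > 0" by (simp add: add_pos_nonneg)
    ultimately have "cmod (u x) \<le> (A + B) * inverse (1 + x\<^sup>2)" by (simp add: field_simps)
    then have "cmod (u x) * cmod (u x) \<le> A * ((A + B) * inverse (1 + x\<^sup>2))"
      using A[of x] by (intro mult_mono) (auto intro: order_trans[OF norm_ge_zero])
    then show "(cmod (u x))\<^sup>2 \<le> (A * (A + B)) * inverse (1 + x\<^sup>2)" by (simp add: power2_eq_square mult_ac)
  qed simp
qed

lemma schwartz_parts:
  assumes u: "u \<in> schwartz" and r: "r > 0"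
  shows "(\<integral>x. gf r p x * (D1 ^^ 2) u x \<partial>lborel) = (\<integral>x. gf r (gD r (gD r p)) x * u x \<partial>lborel)"
proof -
  note u0 = schwartz_facts[OF u]
  note u1 = schwartz_facts[OF u0(2)]
  note u2 = schwartz_facts[OF u1(2)]
  let ?f = "\<lambda>x. gf r p x * D1 (D1 u) x - gf r (gD r (gD r p)) x * u x"
  have lim: "((\<lambda>x. gf r q x * v x) \<longlongrightarrow> 0) F" if v: "v \<in> schwartz" and F: "F = at_top \<or> F = at_bot" for q v F
  proof -
    obtain C where C: "\<And>x. cmod (v x) \<le> C" using schwartz_facts(5)[OF v] by blast
    have "((\<lambda>x. cmod (gf r q x) * C) \<longlongrightarrow> 0) F"
      using gf_tendsto[OF r F, of q] by (intro tendsto_mult_left_zero tendsto_norm_zero)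
    then show ?thesis
      by (rule Lim_null_comparison[rotated]) (auto simp: norm_mult intro!: always_eventually mult_left_mono C)
  qed
  have i: "integrable lborel (\<lambda>x. gf r q x * v x)" if "v \<in> L2" for q v
    using gf_L2[OF r] that unfolding L2_eq_sqi by (rule sqi_mult_integrable)
  have "(\<integral>x. ?f x \<partial>lborel) = 0"
  proof (rule integral_derivative_eq_0)
    \<comment> \<open>The antiderivative is the Wronskian of the two functions, so both integrations
      by parts are done at once.\<close>
    show "((\<lambda>x. gf r p x * D1 u x - gf r (gD r p) x * u x) has_vector_derivative ?f x) (at x)" for x
      by (rule has_vector_derivative_eq_rhs[OF has_vector_derivative_diff[OF
            has_vector_derivative_mult[OF gf_deriv u1(1)] has_vector_derivative_mult[OF gf_deriv u0(1)]]]) simp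
    show "isCont ?f x" for x
      using u0(4) u2(4) gf_isCont by (intro continuous_intros) (auto simp: continuous_on_eq_continuous_at)
    show "integrable lborel ?f" by (intro Bochner_Integration.integrable_diff i u0 u2)
    have "((\<lambda>x. gf r p x * D1 u x - gf r (gD r p) x * u x) \<longlongrightarrow> 0 - 0) F" if "F = at_top \<or> F = at_bot" for F
      by (intro tendsto_diff lim u0(2) u that)
    then show "((\<lambda>x. gf r p x * D1 u x - gf r (gD r p) x * u x) \<longlongrightarrow> 0) at_top"
      "((\<lambda>x. gf r p x * D1 u x - gf r (gD r p) x * u x) \<longlongrightarrow> 0) at_bot" by simp_all
  qed
  then show ?thesis
    using Bochner_Integration.integral_diff[OF i[OF u2(3)] i[OF u0(3)], of p "gD r (gD r p)"]
    by (simp add: numeral_2_eq_2)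
qed

text \<open>A weak Laplacian is tested on Hermite functions, which are Schwartz. Conversely, for
  Schwartz \<open>u\<close> the pair of the conjugates of \<open>u\<close> and \<open>u''\<close>
  passes the Hermite test itself, and unitarity moves the factor -\<xi>^2 from \<open>f\<close> to
  \<open>u\<close>.\<close>

lemma laplacian_eq: "laplacian = four.dg (\<lambda>\<xi>. - of_real (\<xi>\<^sup>2))"
proof (intro set_eqI iffI)
  fix z assume z: "z \<in> laplacian"
  obtain f g where fg: "z = (f, g)" by (rule prod.exhaust)
  with z have f: "f \<in> L2" and g: "g \<in> L2"
    and w: "\<And>u. u \<in> schwartz \<Longrightarrow> (\<integral>x. g x * u x \<partial>lborel) = (\<integral>x. f x * (D1 ^^ 2) u x \<partial>lborel)"
    by (auto simp: laplacian_def)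
  have "ipL (hf 1 n) g = ipL (hf2 1 n) f" for n
  proof -
    have "hf 1 n \<in> schwartz" unfolding hf_eq by (rule gf_schwartz) simp
    moreover have "(D1 ^^ 2) (hf 1 n) = hf2 1 n" by (simp add: numeral_2_eq_2 hf_eq D1_gf hf2_eq)
    ultimately show ?thesis using w[of "hf 1 n"] by (simp add: ip_def mult.commute)
  qed
  then have "AE x in lborel. FV g x = - of_real (x\<^sup>2) * FV f x"
    using weak_laplacian_iff[of 1 f g] f g by simp
  then show "z \<in> four.dg (\<lambda>\<xi>. - of_real (\<xi>\<^sup>2))" using f g by (simp add: fg four.dg_iff)
next
  fix z assume z: "z \<in> four.dg (\<lambda>\<xi>. - of_real (\<xi>\<^sup>2))"
  obtain f g where fg: "z = (f, g)" by (rule prod.exhaust)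
  with z have f: "f \<in> L2" and g: "g \<in> L2" and ae: "AE x in lborel. FV g x = - of_real (x\<^sup>2) * FV f x"
    by (auto simp: four.dg_iff)
  have [measurable]: "FV f \<in> borel_measurable lborel" "FV g \<in> borel_measurable lborel"
    using FV_L2[OF f] FV_L2[OF g] by (auto simp: L2_def)
  have "(\<integral>x. g x * u x \<partial>lborel) = (\<integral>x. f x * (D1 ^^ 2) u x \<partial>lborel)" if u: "u \<in> schwartz" for u
  proof -
    let ?v = "\<lambda>x. cnj (u x)" and ?v2 = "\<lambda>x. cnj ((D1 ^^ 2) u x)"
    note u2 = schwartz_facts(2)[OF schwartz_facts(2)[OF u]]
    have v: "?v \<in> L2" "?v2 \<in> L2"
      using schwartz_facts(3)[OF u] schwartz_facts(3)[OF u2] by (auto simp: L2_eq_sqi numeral_2_eq_2 intro: sqi_cnj)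
    have [measurable]: "FV ?v \<in> borel_measurable lborel" "FV ?v2 \<in> borel_measurable lborel"
      using FV_L2[OF v(1)] FV_L2[OF v(2)] by (auto simp: L2_def)
    have "ipL (hf 1 n) ?v2 = ipL (hf2 1 n) ?v" for n
    proof -
      have "ipL (hf 1 n) ?v2 = cnj (\<integral>x. gf 1 (hfp 1 n) x * (D1 ^^ 2) u x \<partial>lborel)"
        unfolding ip_def hf_eq[symmetric] by (simp flip: Bochner_Integration.integral_cnj)
      also have "\<dots> = cnj (\<integral>x. hf2 1 n x * u x \<partial>lborel)"
        by (subst schwartz_parts[OF u]) (simp_all add: hf2_eq)
      also have "\<dots> = ipL (hf2 1 n) ?v"
        unfolding ip_def by (simp flip: Bochner_Integration.integral_cnj)
      finally show ?thesis .
    qed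
    then have ae2: "AE x in lborel. FV ?v2 x = - of_real (x\<^sup>2) * FV ?v x"
      using weak_laplacian_iff[of 1 ?v ?v2] v by simp
    have "(\<integral>x. g x * u x \<partial>lborel) = ipL ?v g" by (simp add: ip_def mult.commute)
    also have "\<dots> = ipL (FV ?v) (FV g)" using v g by (simp add: four.ip_V)
    also have "\<dots> = ipL (FV ?v) (\<lambda>x. - of_real (x\<^sup>2) * FV f x)"
      using ae by (intro ip_cong_AE) auto
    also have "\<dots> = ipL (\<lambda>x. - of_real (x\<^sup>2) * FV ?v x) (FV f)"
      by (simp add: ip_def mult_ac)
    also have "\<dots> = ipL (FV ?v2) (FV f)"
      using ae2 by (intro ip_cong_AE) auto
    also have "\<dots> = ipL ?v2 f" using v f by (simp add: four.ip_V)
    also have "\<dots> = (\<integral>x. f x * (D1 ^^ 2) u x \<partial>lborel)" by (simp add: ip_def mult.commute)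
    finally show ?thesis .
  qed
  then show "z \<in> laplacian" using f g by (simp add: fg laplacian_def)
qed

lemma laplacian_iff:
  assumes r: "r > 0"
  shows "(f, g) \<in> laplacian \<longleftrightarrow> f \<in> L2 \<and> g \<in> L2 \<and> (\<forall>n. ipL (hf r n) g = ipL (hf2 r n) f)"
  using weak_laplacian_iff[OF r, of f g] by (auto simp: laplacian_eq four.dg_iff)

lemma exp_laplacian:
  assumes "\<beta> > 0"
  shows "is_exp_of (\<beta> \<cdot>\<^sub>o laplacian) (four.dg (\<lambda>\<xi>. of_real (exp (- \<beta> * \<xi>\<^sup>2))))"
proof -
  have "\<beta> \<cdot>\<^sub>o laplacian = four.dg (\<lambda>\<xi>. of_real (- \<beta> * \<xi>\<^sup>2))"
    unfolding laplacian_eq using assms by (subst four.dg_scale) (auto intro!: four.dg_cong)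
  then show ?thesis
    using four.is_function_of_dg[of "\<lambda>\<xi>. - \<beta> * \<xi>\<^sup>2" exp] by simp
qed

section \<open>The harmonic oscillator\<close>

lemma sqi_count_space: "c \<in> sqi (count_space (UNIV :: nat set)) \<longleftrightarrow> summable (\<lambda>n. (cmod (c n))\<^sup>2)"
  by (simp add: sqi_def integrable_count_space_nat_iff)

lemma diagonalization_hf:
  assumes r: "r > 0"
  shows "diagonalization (count_space UNIV) (\<lambda>f n. ipL (hf r n) f) (hilbert_basis.syn lborel (hf r))"
proof -
  interpret hilbert_basis lborel "hf r" by (rule hilbert_basis_hf[OF r])
  show ?thesis
  proof
    fix f assume f: "f \<in> L2"
    show V: "(\<lambda>n. ipL (hf r n) f) \<in> sqi (count_space UNIV)"
      using coeff_summable f by (simp add: sqi_count_space L2_eq_sqi)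
    fix g assume g: "g \<in> L2"
    have W: "(\<lambda>n. ipL (hf r n) g) \<in> sqi (count_space UNIV)"
      using coeff_summable g by (simp add: sqi_count_space L2_eq_sqi)
    show "ip (count_space UNIV) (\<lambda>n. ipL (hf r n) f) (\<lambda>n. ipL (hf r n) g) = ipL f g"
      unfolding ip_def[of "count_space UNIV"] integral_count_space_nat[OF ip_integrable[OF V W]]
      using parseval[of f g] f g by (simp add: sums_iff L2_eq_sqi)
  next
    fix F assume "F \<in> sqi (count_space (UNIV :: nat set))"
    then have F: "summable (\<lambda>n. (cmod (F n))\<^sup>2)" by (simp add: sqi_count_space)
    show "syn F \<in> L2" using syn_sqi[OF F] by (simp add: L2_eq_sqi)
    show "AE n in count_space UNIV. ipL (hf r n) (syn F) = F n"
      by (simp add: ip_e_syn[OF F])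
  qed
qed

text \<open>For positive \<open>r\<close> this is \<open>dg\<close> for the coefficient map, on its
  maximal domain. Counting measure has no nonempty null sets, so the condition holds for every
  \<open>n\<close>.\<close>

definition dgh :: "real \<Rightarrow> (nat \<Rightarrow> complex) \<Rightarrow> oper" where
  "dgh r m = {(f, g) \<in> L2 \<times> L2. \<forall>n. ipL (hf r n) g = m n * ipL (hf r n) f}"

lemma dgh_iff: "(f, g) \<in> dgh r m \<longleftrightarrow> f \<in> L2 \<and> g \<in> L2 \<and> (\<forall>n. ipL (hf r n) g = m n * ipL (hf r n) f)"
  by (simp add: dgh_def)

lemma dgh_eq_dg:
  assumes r: "r > 0"
  shows "dgh r m = diagonalization.dg (count_space UNIV) (\<lambda>f n. ipL (hf r n) f) m"
  unfolding dgh_def diagonalization.dg_def[OF diagonalization_hf[OF r]] by (simp add: AE_count_space)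

lemma dgh_scale: "r > 0 \<Longrightarrow> c \<noteq> 0 \<Longrightarrow> c \<cdot>\<^sub>o dgh r m = dgh r (\<lambda>n. of_real c * m n)"
  by (simp add: dgh_eq_dg diagonalization.dg_scale[OF diagonalization_hf])

lemma is_exp_of_dgh:
  assumes "r > 0" shows "is_exp_of (dgh r (\<lambda>n. of_real (a n))) (dgh r (\<lambda>n. of_real (exp (a n))))"
  unfolding dgh_eq_dg[OF assms]
  by (rule diagonalization.is_function_of_dg[OF diagonalization_hf[OF assms]]) auto

lemma L2_eqI_hf_gen:
  assumes "r > 0" "f \<in> L2" "g \<in> L2" "\<And>n. ipL (hf r n) f = ipL (hf r n) g"
  shows "AE x in lborel. f x = g x"
  using assms hilbert_basis.eqI_AE[OF hilbert_basis_hf[OF assms(1)], of f g] by (simp add: L2_eq_sqi)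

lemma hf_sq:
  assumes r: "r > 0"
  shows "of_real (x\<^sup>2) * hf r n x =
    of_real (sqrt (real (Suc n) / (2 * r))) * (of_real x * hf r (Suc n) x) +
    of_real (sqrt (real n / (2 * r))) * (of_real x * hf r (n - 1) x)"
proof -
  have "of_real (x\<^sup>2) * hf r n x = of_real x * (of_real x * hf r n x)" by (simp add: power2_eq_square)
  also have "\<dots> = of_real x * (of_real (sqrt (real (Suc n) / (2 * r))) * hf r (Suc n) x +
    of_real (sqrt (real n / (2 * r))) * hf r (n - 1) x)"
    by (simp only: hf_X[OF r, of x n])
  finally show ?thesis by (simp only: distrib_left mult.left_commute)
qed

text \<open>The Jacobi matrix of multiplication by x on Hermite coefficients. At
  \<open>n = 0\<close> the truncated index \<open>n - 1\<close> is harmless, since its factor is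
  sqrt 0.\<close>

definition jac :: "real \<Rightarrow> (nat \<Rightarrow> complex) \<Rightarrow> nat \<Rightarrow> complex" where
  "jac r c n = of_real (sqrt (real (Suc n) / (2 * r))) * c (Suc n) + of_real (sqrt (real n / (2 * r))) * c (n - 1)"

text \<open>Each multiplication by \<open>x\<close> costs one power of \<open>n + 1\<close> in the weight.\<close>

lemma jac_summable:
  assumes r: "r > 0" and s: "summable (\<lambda>n. real (Suc n) ^ Suc p * (cmod (c n))\<^sup>2)"
  shows "summable (\<lambda>n. real (Suc n) ^ p * (cmod (jac r c n))\<^sup>2)"
proof -
  define w where "w n = real (Suc n) ^ Suc p * (cmod (c n))\<^sup>2" for n
  have w0: "w n \<ge> 0" for n by (simp add: w_def)
  have ws: "summable w" using s by (simp add: w_def[abs_def])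
  have ws1: "summable (\<lambda>n. w (Suc n))" using ws by (simp add: summable_Suc_iff)
  have "summable (\<lambda>n. w (Suc n - 1))" using ws by simp
  then have ws2: "summable (\<lambda>n. w (n - 1))" using summable_Suc_iff[of "\<lambda>n. w (n - 1)"] by simp
  show ?thesis
  proof (rule summable_comparison_test'[where N = 0])
    show "summable (\<lambda>n. 1 / r * (w (Suc n) + 2 ^ p * w (n - 1)))"
      by (intro summable_mult summable_add ws1 ws2)
    fix n
    have "(cmod (jac r c n))\<^sup>2 \<le> 2 * (cmod (of_real (sqrt (real (Suc n) / (2 * r))) * c (Suc n)))\<^sup>2 +
        2 * (cmod (of_real (sqrt (real n / (2 * r))) * c (n - 1)))\<^sup>2"
      unfolding jac_def by (rule sum_norm_squared_le)
    also have "\<dots> = 1 / r * (real (Suc n) * (cmod (c (Suc n)))\<^sup>2 + real n * (cmod (c (n - 1)))\<^sup>2)"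
      using r by (simp add: norm_mult power_mult_distrib field_simps del: of_nat_Suc)
    finally have "real (Suc n) ^ p * (cmod (jac r c n))\<^sup>2 \<le>
      real (Suc n) ^ p * (1 / r * (real (Suc n) * (cmod (c (Suc n)))\<^sup>2 + real n * (cmod (c (n - 1)))\<^sup>2))"
      by (rule mult_left_mono) simp
    also have "\<dots> = 1 / r * (real (Suc n) ^ Suc p * (cmod (c (Suc n)))\<^sup>2 + real (Suc n) ^ p * real n * (cmod (c (n - 1)))\<^sup>2)"
      by (simp add: algebra_simps del: of_nat_Suc)
    also have "\<dots> \<le> 1 / r * (w (Suc n) + 2 ^ p * w (n - 1))"
    proof (intro mult_left_mono add_mono)
      show "real (Suc n) ^ Suc p * (cmod (c (Suc n)))\<^sup>2 \<le> w (Suc n)"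
        unfolding w_def by (intro mult_right_mono power_mono) auto
      show "real (Suc n) ^ p * real n * (cmod (c (n - 1)))\<^sup>2 \<le> 2 ^ p * w (n - 1)"
      proof (cases n)
        case 0
        then show ?thesis using w0 by simp
      next
        case (Suc k)
        \<comment> \<open>For n at least 1, n + 1 is at most 2n; this is the origin of the factor
          2^p.\<close>
        have "real (Suc n) ^ p \<le> (2 * real n) ^ p" using Suc by (intro power_mono) auto
        then have "real (Suc n) ^ p * (real n * (cmod (c (n - 1)))\<^sup>2) \<le> (2 * real n) ^ p * (real n * (cmod (c (n - 1)))\<^sup>2)"
          by (rule mult_right_mono) simp
        then show ?thesis using Suc by (simp add: w_def power_mult_distrib mult_ac del: of_nat_Suc)
      qed
    qed (use r in auto)
    finally show "norm (real (Suc n) ^ p * (cmod (jac r c n))\<^sup>2) \<le> 1 / r * (w (Suc n) + 2 ^ p * w (n - 1))" by simp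
  qed
qed

lemma hf_sq_L2:
  assumes r: "r > 0" shows "(\<lambda>x. of_real (x\<^sup>2) * hf r n x) \<in> L2" "(\<lambda>x. of_real x * hf r n x) \<in> L2"
proof -
  have "(\<lambda>x. of_real (x\<^sup>2) * hf r n x) = gf r (pCons 0 (pCons 0 (hfp r n)))" "(\<lambda>x. of_real x * hf r n x) = gf r (pCons 0 (hfp r n))"
    by (auto simp: fun_eq_iff gf_X hf_eq power2_eq_square)
  then show "(\<lambda>x. of_real (x\<^sup>2) * hf r n x) \<in> L2" "(\<lambda>x. of_real x * hf r n x) \<in> L2"
    using gf_L2[OF r] by auto
qed

text \<open>Powers of x stay on the basis function, so the formulas hold for every \<open>f\<close>
  in L^2, whether or not x f is square integrable.\<close>

lemma ip_X_hf:
  assumes r: "r > 0" and f: "f \<in> L2"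
  shows "ipL (\<lambda>x. of_real x * hf r n x) f = jac r (\<lambda>n. ipL (hf r n) f) n"
    and "ipL (\<lambda>x. of_real (x\<^sup>2) * hf r n x) f = jac r (jac r (\<lambda>n. ipL (hf r n) f)) n"
proof -
  have lin: "ipL (\<lambda>x. of_real a * u x + of_real b * v x) f = of_real a * ipL u f + of_real b * ipL v f"
    if "u \<in> L2" "v \<in> L2" for a b u v
    using that f by (subst ip_add_left) (auto simp: L2_eq_sqi sqi_cmult ip_cmult_left)
  show 1: "ipL (\<lambda>x. of_real x * hf r n x) f = jac r (\<lambda>n. ipL (hf r n) f) n" for n
    unfolding hf_X[OF r] jac_def by (rule lin) (intro hf_L2 r)+
  show "ipL (\<lambda>x. of_real (x\<^sup>2) * hf r n x) f = jac r (jac r (\<lambda>n. ipL (hf r n) f)) n"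
    unfolding hf_sq[OF r] jac_def[of r "jac r _"] by (subst lin) (simp_all add: hf_sq_L2[OF r] 1)
qed

text \<open>The key domain statement. Two applications of \<open>jac_summable\<close> make the
  formal coefficients of x^2 f square summable; Riesz-Fischer gives \<open>h\<close> with these
  coefficients, and \<open>hf_total\<close> identifies \<open>h\<close> with x^2 f.\<close>

lemma sq_mult_L2:
  assumes r: "r > 0" and f: "f \<in> L2"
    and s: "summable (\<lambda>n. (real (Suc n) * cmod (ipL (hf r n) f))\<^sup>2)"
  shows "(\<lambda>x. of_real (x\<^sup>2) * f x) \<in> L2"
proof -
  have [measurable]: "f \<in> borel_measurable borel" using f by (simp add: L2_def)
  let ?c = "\<lambda>n. ipL (hf r n) f"
  have "summable (\<lambda>n. real (Suc n) ^ Suc 1 * (cmod (?c n))\<^sup>2)"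
    using s by (simp add: power_mult_distrib power2_eq_square mult_ac)
  from jac_summable[OF r this] have "summable (\<lambda>n. real (Suc n) ^ Suc 0 * (cmod (jac r ?c n))\<^sup>2)" by simp
  from jac_summable[OF r this] have sm: "summable (\<lambda>n. (cmod (jac r (jac r ?c) n))\<^sup>2)" by simp
  obtain h where h: "h \<in> L2" "\<And>n. ipL (hf r n) h = jac r (jac r ?c) n"
    using hilbert_basis.riesz_fischer[OF hilbert_basis_hf[OF r] sm] by (auto simp: L2_eq_sqi)
  have g: "gauss_int (\<lambda>x. of_real (x\<^sup>2) * f x)" "gauss_int h"
    by (rule gauss_int_sq[OF gauss_int_L2[OF f]], rule gauss_int_L2[OF h(1)])
  have "(\<integral>x. hf r n x * (of_real (x\<^sup>2) * f x - h x) \<partial>lborel) = 0" for n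
  proof -
    have i: "integrable lborel (\<lambda>x. hf r n x * (of_real (x\<^sup>2) * f x))" "integrable lborel (\<lambda>x. hf r n x * h x)"
      unfolding hf_eq by (intro gauss_int_gf_integrable g r)+
    have "(\<integral>x. hf r n x * (of_real (x\<^sup>2) * f x) \<partial>lborel) = ipL (\<lambda>x. of_real (x\<^sup>2) * hf r n x) f"
      by (simp add: ip_def mult_ac)
    also have "\<dots> = ipL (hf r n) h" unfolding ip_X_hf(2)[OF r f] h ..
    finally show ?thesis
      unfolding right_diff_distrib Bochner_Integration.integral_diff[OF i] by (simp add: ip_hf)
  qed
  then have "AE x in lborel. of_real (x\<^sup>2) * f x - h x = 0"
    by (rule hf_total[OF gauss_int_diff[OF g] r])
  then have "AE x in lborel. of_real (x\<^sup>2) * f x = h x" by eventually_elim simp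
  then show ?thesis
    using h(1) unfolding L2_eq_sqi by (elim sqi_cong_AE[rotated 2]) measurable
qed

lemma ip_sq_hf2:
  assumes r: "r > 0" and f: "f \<in> L2"
  shows "of_real (r\<^sup>2) * ipL (\<lambda>x. of_real (x\<^sup>2) * hf r n x) f - ipL (hf2 r n) f =
    of_real (r * (2 * real n + 1)) * ipL (hf r n) f"
proof -
  have e: "hf2 r n = (\<lambda>x. of_real (r\<^sup>2) * (of_real (x\<^sup>2) * hf r n x) - of_real (r * (2 * real n + 1)) * hf r n x)"
    by (simp add: fun_eq_iff hf2_def left_diff_distrib mult.assoc)
  have "ipL (hf2 r n) f = of_real (r\<^sup>2) * ipL (\<lambda>x. of_real (x\<^sup>2) * hf r n x) f -
      of_real (r * (2 * real n + 1)) * ipL (hf r n) f"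
    unfolding e using f hf_sq_L2[OF r] hf_L2[OF r]
    by (subst ip_diff_left) (auto simp: L2_eq_sqi sqi_cmult ip_cmult_left simp del: of_real_mult of_real_power)
  then show ?thesis by simp
qed

lemma mult_op_sq_ip:
  assumes "(f, h) \<in> mult_op (\<lambda>x. of_real (x\<^sup>2))"
  shows "ipL (hf r n) h = ipL (\<lambda>x. of_real (x\<^sup>2) * hf r n x) f"
proof -
  have [measurable]: "f \<in> borel_measurable borel" "h \<in> borel_measurable borel" "hf r n \<in> borel_measurable borel"
    using assms by (auto simp: mult_op_def L2_def hf_eq)
  have "ipL (hf r n) h = ipL (hf r n) (\<lambda>x. of_real (x\<^sup>2) * f x)"
    using assms by (intro ip_cong_AE) (auto simp: mult_op_def)
  then show ?thesis by (simp add: ip_def mult_ac)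
qed

text \<open>The difference lives on the intersection of two domains. The hard inclusion gets there
  from coefficients: if (2n+1) c_n is square summable, then \<open>sq_mult_L2\<close> yields x^2 f
  in L^2, and the value of the Laplacian is solved for.\<close>

lemma oscillator_eq:
  assumes r: "r > 0"
  shows "r \<cdot>\<^sub>o mult_op (\<lambda>x. of_real (x\<^sup>2)) -\<^sub>o (1 / r) \<cdot>\<^sub>o laplacian = dgh r (\<lambda>n. of_real (2 * real n + 1))"
proof (intro set_eqI iffI)
  fix z assume "z \<in> r \<cdot>\<^sub>o mult_op (\<lambda>x. of_real (x\<^sup>2)) -\<^sub>o (1 / r) \<cdot>\<^sub>o laplacian"
  then obtain f g h k h' k' where z: "z = (f, g)" and L: "f \<in> L2" "g \<in> L2" "h \<in> L2" "k \<in> L2"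
    and m: "(f, h') \<in> mult_op (\<lambda>x. of_real (x\<^sup>2))" "(f, k') \<in> laplacian"
    and ae: "AE x in lborel. g x = h x - k x" "AE x in lborel. h x = of_real r * h' x" "AE x in lborel. k x = of_real (1 / r) * k' x"
    by (auto simp: op_diff_def op_scale_def)
  have L': "h' \<in> L2" "k' \<in> L2" using m by (auto simp: mult_op_def laplacian_def)
  have g: "AE x in lborel. g x = of_real r * h' x - of_real (1 / r) * k' x" using ae by eventually_elim simp
  have "ipL (hf r n) g = of_real (2 * real n + 1) * ipL (hf r n) f" for n
  proof -
    have "ipL (hf r n) g = ipL (hf r n) (\<lambda>x. of_real r * h' x - of_real (1 / r) * k' x)"
      using g L L' hf_L2[OF r] by (intro ip_cong_AE) (auto simp: L2_def)
    also have "\<dots> = of_real r * ipL (hf r n) h' - of_real (1 / r) * ipL (hf r n) k'"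
      using L' hf_L2[OF r] by (subst ip_diff_right) (auto simp: L2_eq_sqi sqi_cmult ip_cmult_right simp del: of_real_divide)
    also have "\<dots> = of_real (1 / r) * (of_real (r\<^sup>2) * ipL (\<lambda>x. of_real (x\<^sup>2) * hf r n x) f - ipL (hf2 r n) f)"
      using m(2) r unfolding mult_op_sq_ip[OF m(1)] by (simp add: laplacian_iff[OF r] field_simps power2_eq_square)
    also have "\<dots> = of_real (2 * real n + 1) * ipL (hf r n) f"
      unfolding ip_sq_hf2[OF r L(1)] using r by simp
    finally show ?thesis .
  qed
  then show "z \<in> dgh r (\<lambda>n. of_real (2 * real n + 1))" using z L by (simp add: dgh_iff)
next
  fix z assume z: "z \<in> dgh r (\<lambda>n. of_real (2 * real n + 1))"
  obtain f g where fg: "z = (f, g)" by (rule prod.exhaust)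
  with z have f: "f \<in> L2" and g: "g \<in> L2"
    and c: "\<And>n. ipL (hf r n) g = of_real (2 * real n + 1) * ipL (hf r n) f" by (auto simp: dgh_iff)
  have "summable (\<lambda>n. (real (Suc n) * cmod (ipL (hf r n) f))\<^sup>2)"
  proof (rule summable_comparison_test'[where N = 0])
    show "summable (\<lambda>n. (cmod (ipL (hf r n) g))\<^sup>2)"
      using hilbert_basis.coeff_summable[OF hilbert_basis_hf[OF r]] g by (simp add: L2_eq_sqi)
    fix n
    have "cmod (ipL (hf r n) g) = (2 * real n + 1) * cmod (ipL (hf r n) f)"
      unfolding c norm_mult norm_of_real by simp
    then have "real (Suc n) * cmod (ipL (hf r n) f) \<le> cmod (ipL (hf r n) g)"
      by (simp add: mult_right_mono)
    then show "norm ((real (Suc n) * cmod (ipL (hf r n) f))\<^sup>2) \<le> (cmod (ipL (hf r n) g))\<^sup>2"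
      by (simp add: power_mono del: of_nat_Suc)
  qed
  from sq_mult_L2[OF r f this] have h: "(\<lambda>x. of_real (x\<^sup>2) * f x) \<in> L2" (is "?h \<in> _") .
  have m: "(f, ?h) \<in> mult_op (\<lambda>x. of_real (x\<^sup>2))" using f h by (simp add: mult_op_def)
  \<comment> \<open>The solution of g = r h - k/r for k.\<close>
  let ?k = "\<lambda>x. of_real (r\<^sup>2) * ?h x - of_real r * g x"
  have k: "?k \<in> L2" using h g by (intro L2_diff L2_cmult)
  have lap: "(f, ?k) \<in> laplacian"
    unfolding laplacian_iff[OF r]
  proof (intro conjI allI f k)
    fix n
    have "ipL (hf r n) ?k = of_real (r\<^sup>2) * ipL (hf r n) ?h - of_real r * ipL (hf r n) g"
      using h g hf_L2[OF r] by (subst ip_diff_right) (auto simp: L2_eq_sqi sqi_cmult ip_cmult_right simp del: of_real_power)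
    also have "\<dots> = of_real (r\<^sup>2) * ipL (\<lambda>x. of_real (x\<^sup>2) * hf r n x) f - of_real (r * (2 * real n + 1)) * ipL (hf r n) f"
      unfolding c mult_op_sq_ip[OF m] by simp
    also have "\<dots> = ipL (hf2 r n) f"
      using ip_sq_hf2[OF r f, of n] by (simp add: diff_eq_eq eq_diff_eq add.commute)
    finally show "ipL (hf r n) ?k = ipL (hf2 r n) f" .
  qed
  have 1: "(f, \<lambda>x. of_real r * ?h x) \<in> r \<cdot>\<^sub>o mult_op (\<lambda>x. of_real (x\<^sup>2))"
    unfolding op_scale_def using f m L2_cmult[OF h, of "of_real r"] by auto
  have 2: "(f, \<lambda>x. of_real (1 / r) * ?k x) \<in> (1 / r) \<cdot>\<^sub>o laplacian"
    unfolding op_scale_def using f lap L2_cmult[OF k, of "of_real (1 / r)"] by auto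
  have "g x = of_real r * ?h x - of_real (1 / r) * ?k x" for x
    using r by (simp add: field_simps power2_eq_square)
  then have "AE x in lborel. g x = of_real r * ?h x - of_real (1 / r) * ?k x" by simp
  with 1 2 show "z \<in> r \<cdot>\<^sub>o mult_op (\<lambda>x. of_real (x\<^sup>2)) -\<^sub>o (1 / r) \<cdot>\<^sub>o laplacian"
    using f g unfolding op_diff_def fg by blast
qed

text \<open>Pairing the eigenvalue equation with \<open>hf 1 m\<close> gives (2n+1) c_m = (2m+1)
  c_m.\<close>

lemma hermite_function_coeff:
  assumes "hermite_function n u"
  shows "u \<in> L2" and "m \<noteq> n \<Longrightarrow> ipL (hf 1 m) u = 0"
proof -
  obtain h k k' where u: "u \<in> L2"
    and m: "(u, h) \<in> mult_op (\<lambda>x. of_real (x\<^sup>2))" "(u, k') \<in> laplacian"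
    and ae: "AE x in lborel. of_nat (2 * n + 1) * u x = k x + h x" "AE x in lborel. k x = of_real (- 1) * k' x"
    using assms by (auto simp: hermite_function_def eigenpair_def op_add_def op_scale_def)
  show "u \<in> L2" by fact
  have L: "h \<in> L2" and k': "k' \<in> L2" using m by (auto simp: laplacian_def mult_op_def)
  have g: "AE x in lborel. of_nat (2 * n + 1) * u x = h x - k' x" using ae by eventually_elim simp
  assume mn: "m \<noteq> n"
  have "of_nat (2 * n + 1) * ipL (hf 1 m) u = ipL (hf 1 m) (\<lambda>x. h x - k' x)"
    unfolding ip_cmult_right[symmetric]
    using g u L k' hf_L2[of 1] by (intro ip_cong_AE) (auto simp: L2_def)
  also have "\<dots> = ipL (hf 1 m) h - ipL (hf 1 m) k'"
    using L k' hf_L2[of 1] by (intro ip_diff_right) (auto simp: L2_eq_sqi)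
  also have "\<dots> = of_real (1 * (2 * real m + 1)) * ipL (hf 1 m) u"
    using m(2) ip_sq_hf2[of 1 u m] u unfolding mult_op_sq_ip[OF m(1)] by (simp add: laplacian_iff[of 1])
  finally have "(of_nat (2 * n + 1) - complex_of_real (2 * real m + 1)) * ipL (hf 1 m) u = 0"
    by (simp add: left_diff_distrib)
  moreover have "of_nat (2 * n + 1) - complex_of_real (2 * real m + 1) \<noteq> 0"
    using mn by (simp add: complex_eq_iff)
  ultimately show "ipL (hf 1 m) u = 0" by simp
qed

section \<open>Gaussian masks\<close>

text \<open>The trivial unitary map, through which multiplication operators inherit the results on
  adjoints and everywhere-definedness.\<close>

interpretation idd: diagonalization lborel "\<lambda>f. f" "\<lambda>f. f"
  by unfold_locales (auto simp: L2_eq_sqi)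

lemma mult_op_eq_dg: "mult_op m = idd.dg m"
  by (simp add: mult_op_def idd.dg_def)

lemma inv_fourier_gf_X:
  assumes a: "a > 0" and F: "\<And>x. inv_fourier (gf a p) x = gf b q x"
  shows "inv_fourier (gf a (pCons 0 p)) x = - \<i> * gf b (gD b q) x"
proof -
  have F': "fourier (gf a p) = (\<lambda>\<xi>. 2 * of_real pi * gf b q (- \<xi>))"
  proof
    fix \<xi> show "fourier (gf a p) \<xi> = 2 * of_real pi * gf b q (- \<xi>)"
      using F[of "- \<xi>"] by (simp add: inv_fourier_eq field_simps)
  qed
  have "(uminus has_vector_derivative - 1) (at y)" for y :: real
    by (auto intro!: derivative_eq_intros)
  from vector_diff_chain_at[OF this gf_deriv, of b q "- x"]
  have "((\<lambda>\<xi>. gf b q (- \<xi>)) has_vector_derivative - gf b (gD b q) x) (at (- x))"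
    by (simp add: o_def)
  then have "((\<lambda>\<xi>. 2 * of_real pi * gf b q (- \<xi>)) has_vector_derivative 2 * of_real pi * (- gf b (gD b q) x)) (at (- x))"
    by (rule has_vector_derivative_mult_right)
  moreover have "((\<lambda>\<xi>. 2 * of_real pi * gf b q (- \<xi>)) has_vector_derivative - \<i> * fourier (gf a (pCons 0 p)) (- x)) (at (- x))"
    using fourier_gf_deriv[OF a, of p "- x"] unfolding F' .
  ultimately have "2 * of_real pi * (- gf b (gD b q) x) = - \<i> * fourier (gf a (pCons 0 p)) (- x)"
    by (rule vector_derivative_unique_at)
  then have "\<i> * (2 * of_real pi * gf b (gD b q) x) = \<i> * (\<i> * fourier (gf a (pCons 0 p)) (- x))" by simp
  then have "fourier (gf a (pCons 0 p)) (- x) = - \<i> * (2 * of_real pi * gf b (gD b q) x)"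
    unfolding mult.assoc[symmetric] by simp
  then show ?thesis by (simp add: inv_fourier_eq)
qed

lemma inv_fourier_gf_gD: "a > 0 \<Longrightarrow> inv_fourier (gf a (gD a p)) x = - \<i> * of_real x * inv_fourier (gf a p) x"
  by (simp add: inv_fourier_eq fourier_gf_gD)

lemma inv_fourier_gf_add: "a > 0 \<Longrightarrow> inv_fourier (gf a (p + q)) x = inv_fourier (gf a p) x + inv_fourier (gf a q) x"
  by (simp add: inv_fourier_eq fourier_gf_add add_divide_distrib)

lemma inv_fourier_gf_smult: "inv_fourier (gf a (smult c p)) x = c * inv_fourier (gf a p) x"
  by (simp add: inv_fourier_eq fourier_gf_smult)

section \<open>Diagonalization of the concentration operator\<close>

locale gaussian_masks =
  fixes \<alpha> \<beta> :: real
  assumes \<alpha>: "\<alpha> > 0" and \<beta>: "\<beta> > 0"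
begin

definition r :: real where "r = sqrt (\<alpha> * (1 + \<alpha> * \<beta>) / \<beta>)"
definition \<rho> :: real where "\<rho> = (r - \<alpha>) / (r + \<alpha>)"

lemma r_pos: "r > 0"
  using \<alpha> \<beta> by (simp add: r_def add_pos_pos)

lemma r_sq: "\<beta> * r\<^sup>2 = \<alpha> + \<alpha>\<^sup>2 * \<beta>"
proof -
  have "r\<^sup>2 = \<alpha> * (1 + \<alpha> * \<beta>) / \<beta>" using \<alpha> \<beta> by (simp add: r_def)
  then have "\<beta> * r\<^sup>2 = \<alpha> * (1 + \<alpha> * \<beta>)" using \<beta> by simp
  then show ?thesis by (simp add: algebra_simps power2_eq_square)
qed

lemma \<alpha>_less_r: "\<alpha> < r"
proof (rule power_less_imp_less_base)
  have "\<beta> * \<alpha>\<^sup>2 < \<beta> * r\<^sup>2" unfolding r_sq using \<alpha> by simp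
  then show "\<alpha>\<^sup>2 < r\<^sup>2" using \<beta> by simp
qed (use r_pos in simp)

lemma r_alpha: "(r - \<alpha>) * (1 + 2 * \<beta> * (r + \<alpha>)) = r + \<alpha>"
proof -
  have "(r - \<alpha>) * (1 + 2 * \<beta> * (r + \<alpha>)) = r - \<alpha> + 2 * (\<beta> * r\<^sup>2) - 2 * \<beta> * \<alpha>\<^sup>2"
    by (simp add: algebra_simps power2_eq_square)
  also have "\<dots> = r + \<alpha>" unfolding r_sq by simp
  finally show ?thesis .
qed

lemma inverse_t: "1 / (1 / (r + \<alpha>) + 2 * \<beta>) = r - \<alpha>"
proof -
  have "1 + 2 * \<beta> * (r + \<alpha>) > 0" "r + \<alpha> > 0" using r_pos \<alpha> \<beta> by (auto intro: add_pos_pos)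
  then show ?thesis using r_alpha by (simp add: field_simps)
qed

text \<open>The left side is the coefficient that appears in \<open>mask_chain\<close> when
  \<open>gD\<close> is moved from width 1/s to t = 1/s + 2\<beta>.\<close>

lemma \<rho>_eq: "1 - 2 * \<beta> * (r - \<alpha>) = \<rho>"
proof -
  have "\<rho> * (r + \<alpha>) = r - \<alpha>" using r_pos \<alpha> by (simp add: \<rho>_def)
  moreover have "(1 - 2 * \<beta> * (r - \<alpha>)) * (r + \<alpha>) = r - \<alpha>"
    using r_alpha by (simp add: algebra_simps)
  ultimately have "(1 - 2 * \<beta> * (r - \<alpha>)) * (r + \<alpha>) = \<rho> * (r + \<alpha>)" by simp
  then show ?thesis using r_pos \<alpha> by simp
qed

text \<open>From arsinh y = ln(y + sqrt(y^2 + 1)), the square of \<open>exp ?c\<close> is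
  \<open>1 + 2 * \<beta> * (r + \<alpha>)\<close>, the reciprocal of \<rho> by
  \<open>r_alpha\<close>.\<close>

lemma \<rho>_exp: "sqrt \<rho> * \<rho> ^ n = exp (- arsinh (sqrt (\<alpha> * \<beta>)) * (2 * real n + 1))"
proof -
  let ?c = "arsinh (sqrt (\<alpha> * \<beta>))" and ?x = "\<alpha> * \<beta>"
  have x: "?x > 0" using \<alpha> \<beta> by simp
  have "exp ?c = sqrt ?x + sqrt (?x + 1)"
    using x by (simp add: arsinh_real_def add_pos_pos)
  then have "(exp ?c)\<^sup>2 = ?x + (?x + 1) + 2 * (sqrt ?x * sqrt (?x + 1))"
    using x by (simp add: power2_sum)
  also have "sqrt ?x * sqrt (?x + 1) = \<beta> * r"
  proof -
    have "\<beta> * r = sqrt (\<beta>\<^sup>2 * (\<alpha> * (1 + \<alpha> * \<beta>) / \<beta>))" unfolding real_sqrt_mult r_def using \<beta> by simp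
    also have "\<beta>\<^sup>2 * (\<alpha> * (1 + \<alpha> * \<beta>) / \<beta>) = ?x * (?x + 1)" using \<beta> by (simp add: power2_eq_square field_simps)
    finally show ?thesis by (simp add: real_sqrt_mult)
  qed
  finally have e: "(exp ?c)\<^sup>2 = 1 + 2 * \<beta> * (r + \<alpha>)" by (simp add: algebra_simps)
  have "\<rho> * (exp ?c)\<^sup>2 = 1"
    unfolding e \<rho>_def using r_alpha r_pos \<alpha> by simp
  then have "\<rho> = 1 / (exp ?c)\<^sup>2" by (simp add: field_simps)
  then have \<rho>: "\<rho> = (exp (- ?c))\<^sup>2" by (simp add: exp_minus inverse_eq_divide power_divide)
  have "sqrt \<rho> * \<rho> ^ n = exp (- ?c) * exp (- ?c) ^ (2 * n)"
    unfolding \<rho> by (simp add: power_mult)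
  also have "\<dots> = exp (- ?c) ^ (2 * n + 1)" by simp
  also have "\<dots> = exp (- ?c * (2 * real n + 1))"
    unfolding exp_of_nat_mult[symmetric] by (simp add: algebra_simps)
  finally show ?thesis .
qed

text \<open>
  With \<open>s = r + \<alpha>\<close> and \<open>t = 1/s + 2\<beta>\<close>, so that \<open>1/t = r - \<alpha>\<close>, the operator is a Fourier transform that takes width
  \<open>s\<close> to \<open>1/s\<close>, followed by an inverse one that takes width \<open>t\<close> to \<open>r - \<alpha>\<close>. Commuting the creation operator \<open>rx - \<partial>\<close>
  through both transforms yields the factor \<open>\<rho>\<close>.
\<close>

lemma mask_chain:
  "\<exists>q. (\<forall>x. fourier (gf (r + \<alpha>) (hp r n)) x = gf (1 / (r + \<alpha>)) q x) \<and>
     (\<forall>x. inv_fourier (gf (1 / (r + \<alpha>) + 2 * \<beta>) q) x = gf (r - \<alpha>) (smult (of_real (sqrt \<rho> * \<rho> ^ n)) (hp r n)) x)"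
proof (induction n)
  case 0
  let ?s = "r + \<alpha>" and ?t = "1 / (r + \<alpha>) + 2 * \<beta>"
  have s: "?s > 0" and t: "?t > 0" using r_pos \<alpha> \<beta> by (auto intro: add_pos_pos)
  let ?q = "smult (of_real (sqrt (2 * pi / ?s))) 1"
  have "fourier (gf ?s (hp r 0)) x = gf (1 / ?s) ?q x" for x
    unfolding gf_smult hp.simps by (rule fourier_gauss[OF s])
  moreover have "inv_fourier (gf ?t ?q) x = gf (r - \<alpha>) (smult (of_real (sqrt \<rho> * \<rho> ^ 0)) (hp r 0)) x" for x
  proof -
    have "sqrt (2 * pi / ?s) * sqrt (2 * pi / ?t) = sqrt ((2 * pi)\<^sup>2 * (1 / ?t / ?s))"
      by (simp add: power2_eq_square flip: real_sqrt_mult)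
    also have "\<dots> = 2 * pi * sqrt \<rho>" unfolding inverse_t \<rho>_def by (subst real_sqrt_mult) (subst real_sqrt_abs, simp)
    finally have c: "sqrt (2 * pi / ?s) * sqrt (2 * pi / ?t) / (2 * pi) = sqrt \<rho>" by simp
    have "inv_fourier (gf ?t ?q) x = of_real (sqrt (2 * pi / ?s)) * (of_real (sqrt (2 * pi / ?t)) * gf (1 / ?t) 1 (- x)) / (2 * of_real pi)"
      unfolding inv_fourier_gf_smult unfolding inv_fourier_eq fourier_gauss[OF t] by simp
    also have "\<dots> = of_real (sqrt (2 * pi / ?s) * sqrt (2 * pi / ?t) / (2 * pi)) * gf (1 / ?t) 1 x"
      by (simp add: gf_def)
    finally show ?thesis unfolding c inverse_t gf_smult by simp
  qed
  ultimately show ?case by blast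
next
  case (Suc n)
  let ?s = "r + \<alpha>" and ?t = "1 / (r + \<alpha>) + 2 * \<beta>" and ?u = "r - \<alpha>" and ?p = "hp r n"
  let ?k = "complex_of_real (sqrt \<rho> * \<rho> ^ n)"
  have s: "?s > 0" and t: "?t > 0" using r_pos \<alpha> \<beta> by (auto intro: add_pos_pos)
  obtain q where q: "\<And>x. fourier (gf ?s ?p) x = gf (1 / ?s) q x"
    "\<And>x. inv_fourier (gf ?t q) x = gf ?u (smult ?k ?p) x" using Suc.IH by blast
  let ?q1 = "smult (\<i> * of_real ?u) (gD (1 / ?s) q) - smult \<i> (pCons 0 q)"
  \<comment> \<open>Conjugation by the first mask turns rx - d/dx into (r - \<alpha>)x - d/dx,
    acting at width s.\<close>
  have p1: "hp r (Suc n) = smult (of_real ?u) (pCons 0 ?p) - gD ?s ?p"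
    by (auto simp: gD_def poly_eq_iff coeff_pCons algebra_simps split: nat.split)
  have "fourier (gf ?s (hp r (Suc n))) x = gf (1 / ?s) ?q1 x" for x
    unfolding p1 fourier_gf_diff[OF s] fourier_gf_smult fourier_gf_X[OF s q(1)] fourier_gf_gD[OF s] q(1) gf_diff gf_smult gf_X
    by (simp add: mult_ac)
  moreover have "inv_fourier (gf ?t ?q1) x = gf ?u (smult (of_real (sqrt \<rho> * \<rho> ^ Suc n)) (hp r (Suc n))) x" for x
  proof -
    \<comment> \<open>Passing to width t shifts \<open>gD\<close> by 2\<beta>x, and
      \<open>\<rho>_eq\<close> evaluates the resulting coefficient of
      \<open>pCons 0 q\<close>.\<close>
    have q1: "?q1 = smult (\<i> * of_real ?u) (gD ?t q) + smult (- \<i> * of_real \<rho>) (pCons 0 q)"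
    proof -
      have "gD (1 / ?s) q = gD ?t q + smult (of_real (2 * \<beta>)) (pCons 0 q)"
        by (auto simp: gD_def poly_eq_iff coeff_pCons algebra_simps split: nat.split)
      then have "?q1 = smult (\<i> * of_real ?u) (gD ?t q) + smult (\<i> * of_real ?u * of_real (2 * \<beta>) - \<i>) (pCons 0 q)"
        by (simp only: smult_add_right smult_smult smult_diff_left add_diff_eq)
      also have "\<i> * of_real ?u * of_real (2 * \<beta>) - \<i> = - \<i> * of_real (1 - 2 * \<beta> * ?u)"
        by (simp add: algebra_simps)
      finally show ?thesis unfolding \<rho>_eq .
    qed
    have "inv_fourier (gf ?t ?q1) x = \<i> * of_real ?u * (- \<i> * of_real x * gf ?u (smult ?k ?p) x) +
        (- \<i> * of_real \<rho>) * (- \<i> * gf ?u (gD ?u (smult ?k ?p)) x)"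
      unfolding q1 inv_fourier_gf_add[OF t] inv_fourier_gf_smult inv_fourier_gf_X[OF t q(2)] inv_fourier_gf_gD[OF t] q(2) ..
    also have "\<dots> = (\<i> * - \<i>) * (of_real ?u * (of_real x * gf ?u (smult ?k ?p) x)) + (- \<i> * - \<i>) * (of_real \<rho> * gf ?u (gD ?u (smult ?k ?p)) x)"
      by (simp only: mult_ac)
    also have "\<dots> = gf ?u (smult (of_real ?u) (pCons 0 (smult ?k ?p)) - smult (of_real \<rho>) (gD ?u (smult ?k ?p))) x"
      by (simp add: gf_diff gf_smult gf_X)
    also have "smult (of_real ?u) (pCons 0 (smult ?k ?p)) - smult (of_real \<rho>) (gD ?u (smult ?k ?p)) =
        smult ?k (smult (of_real (?u + \<rho> * ?u)) (pCons 0 ?p) - smult (of_real \<rho>) (pderiv ?p))"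
      by (auto simp: gD_def poly_eq_iff coeff_pCons pderiv_smult algebra_simps split: nat.split)
    \<comment> \<open>This restores the ratio 2r : 1 between the x term and the derivative, so the
      result is \<rho> times a creation step.\<close>
    also have "?u + \<rho> * ?u = \<rho> * (2 * r)"
      using r_pos \<alpha> by (simp add: \<rho>_def field_simps)
    also have "smult ?k (smult (of_real (\<rho> * (2 * r))) (pCons 0 ?p) - smult (of_real \<rho>) (pderiv ?p)) =
       smult (of_real (sqrt \<rho> * \<rho> ^ Suc n)) (hp r (Suc n))"
      by (auto simp: poly_eq_iff coeff_pCons algebra_simps split: nat.split)
    finally show ?thesis .
  qed
  ultimately show ?case by blast
qed

definition mS :: "real \<Rightarrow> complex" where "mS x = of_real (exp (- (\<alpha> / 2) * x\<^sup>2))"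
definition E :: "real \<Rightarrow> complex" where "E \<xi> = of_real (exp (- \<beta> * \<xi>\<^sup>2))"
definition G :: oper where "G = mult_op mS \<circ>\<^sub>o four.dg E \<circ>\<^sub>o mult_op mS"
definition lam :: "nat \<Rightarrow> real" where "lam n = exp (- arsinh (sqrt (\<alpha> * \<beta>)) * (2 * real n + 1))"

lemma mS_facts: "mS \<in> borel_measurable lborel" "cmod (mS x) \<le> 1" "cnj (mS x) = mS x"
  using \<alpha> by (auto simp: mS_def[abs_def])

lemma E_facts: "E \<in> borel_measurable lborel" "cmod (E x) \<le> 1" "cnj (E x) = E x"
  using \<beta> by (auto simp: E_def[abs_def])

lemma adj_mult_mS: "adj (mult_op mS) = mult_op mS"
  unfolding mult_op_eq_dg idd.adj_dg[OF mS_facts(1,2)] mS_facts(3) ..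

lemma adj_dg_E: "adj (four.dg E) = four.dg E"
  unfolding four.adj_dg[OF E_facts(1,2)] E_facts(3) ..

text \<open>Real bounded multipliers are self-adjoint, and the two adjacent frequency masks multiply
  to e^(-\<beta>\<xi>^2).\<close>

lemma concentration_eq:
  "concentration_op mS (\<lambda>\<xi>. of_real (exp (- (\<beta> / 2) * \<xi>\<^sup>2))) = G"
proof -
  let ?m = "\<lambda>\<xi>. complex_of_real (exp (- (\<beta> / 2) * \<xi>\<^sup>2))"
  have m: "?m \<in> borel_measurable lborel" "cmod (?m x) \<le> 1" "cnj (?m x) = ?m x" for x
    using \<beta> by auto
  have "?m x * ?m x = E x" for x
    by (simp add: E_def flip: of_real_mult exp_add)
  then have "four.dg ?m \<circ>\<^sub>o four.dg ?m = four.dg E"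
    unfolding four.dg_comp[OF m(1,2)] by simp
  then show ?thesis
    unfolding concentration_op_def adj_mult_mS freq_mask_op_eq four.adj_dg[OF m(1,2)] m(3) G_def
    by (metis O_assoc)
qed

lemma G_hf: "(hf r n, \<lambda>x. of_real (lam n) * hf r n x) \<in> G"
proof -
  let ?s = "r + \<alpha>" and ?t = "1 / (r + \<alpha>) + 2 * \<beta>" and ?u = "r - \<alpha>"
  let ?c = "complex_of_real (1 / sqrt (hN r n))"
  have s: "?s > 0" and t: "?t > 0" and u: "?u > 0" using r_pos \<alpha> \<beta> \<alpha>_less_r by (auto intro: add_pos_pos)
  obtain q where q: "\<And>x. fourier (gf ?s (hp r n)) x = gf (1 / ?s) q x"
    "\<And>x. inv_fourier (gf ?t q) x = gf ?u (smult (of_real (lam n)) (hp r n)) x"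
    using mask_chain[of n] unfolding \<rho>_exp lam_def by blast
  have 1: "(hf r n, gf ?s (smult ?c (hp r n))) \<in> mult_op mS"
  proof -
    have "gf ?s (smult ?c (hp r n)) x = mS x * hf r n x" for x
      using gf_mult_gauss[of \<alpha> x r "smult ?c (hp r n)"] by (simp only: mS_def hf_eq_gf)
    then show ?thesis using gf_L2[OF s] hf_L2[OF r_pos] by (simp add: mult_op_def)
  qed
  have 2: "(gf ?s (smult ?c (hp r n)), gf (1 / ?s) (smult ?c q)) \<in> fourier_op"
    using s by (intro fourier_op_gf) (auto simp only: fourier_gf_smult q gf_smult zero_less_divide_1_iff)
  have 3: "(gf (1 / ?s) (smult ?c q), gf ?t (smult ?c q)) \<in> mult_op E"
  proof -
    have "gf ?t (smult ?c q) x = E x * gf (1 / ?s) (smult ?c q) x" for x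
      using gf_mult_gauss[of "2 * \<beta>" x "1 / ?s" "smult ?c q"] by (simp add: E_def)
    then show ?thesis using gf_L2[OF t] gf_L2[of "1 / ?s"] s by (simp add: mult_op_def)
  qed
  let ?w = "smult ?c (smult (of_real (lam n)) (hp r n))"
  have 4: "(gf ?t (smult ?c q), gf ?u ?w) \<in> inv_fourier_op"
    using t u by (intro inv_fourier_op_gf) (auto simp only: inv_fourier_gf_smult q gf_smult)
  have w: "(\<lambda>x. of_real (lam n) * hf r n x) = gf r ?w"
    by (simp add: fun_eq_iff hf_def gf_smult)
  have 5: "(gf ?u ?w, gf r ?w) \<in> mult_op mS"
  proof -
    have "gf r ?w x = mS x * gf ?u ?w x" for x
      using gf_mult_gauss[of \<alpha> x ?u ?w] by (simp add: mS_def)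
    then show ?thesis using gf_L2[OF u] gf_L2[OF r_pos] by (simp add: mult_op_def)
  qed
  have "(gf ?s (smult ?c (hp r n)), gf ?u ?w) \<in> four.dg E"
    unfolding freq_mask_op_eq[symmetric] freq_mask_op_def using 2 3 4 by blast
  then show ?thesis unfolding w G_def using 1 5 by blast
qed

text \<open>The three self-adjoint factors are moved across one by one; the palindromic order of the
  product returns \<open>G\<close>.\<close>

lemma G_symmetric:
  assumes "(u, v) \<in> G" "(f, g) \<in> G" shows "ipL u g = ipL v f"
proof -
  obtain u1 u2 f1 f2 where u: "(u, u1) \<in> mult_op mS" "(u1, u2) \<in> four.dg E" "(u2, v) \<in> mult_op mS"
    and f: "(f, f1) \<in> mult_op mS" "(f1, f2) \<in> four.dg E" "(f2, g) \<in> mult_op mS"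
    using assms by (auto simp: G_def)
  have adj: "ipL a b' = ipL a' b" if "(a, a') \<in> A" "(b, b') \<in> A" "adj A = A" for a a' b b' A
  proof -
    have "(a, a') \<in> adj A" using that by simp
    then show ?thesis using that(2) by (auto simp: adj_def L2_inner_eq_ip)
  qed
  have "ipL u g = ipL u1 f2" by (rule adj[OF u(1) f(3) adj_mult_mS])
  also have "\<dots> = ipL u2 f1" by (rule adj[OF u(2) f(2) adj_dg_E])
  also have "\<dots> = ipL v f" by (rule adj[OF u(3) f(1) adj_mult_mS])
  finally show ?thesis .
qed

text \<open>Symmetry against the eigenvectors \<open>hf r n\<close> determines all coefficients of a
  value of \<open>G\<close>. For the converse, \<open>G\<close> is everywhere defined, so the value
  it assigns must agree with the prescribed one almost everywhere, and the last mask accepts any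
  representative.\<close>

lemma G_eq: "G = dgh r (\<lambda>n. of_real (lam n))"
proof (intro set_eqI iffI)
  have sub: "(f, g) \<in> dgh r (\<lambda>n. of_real (lam n))" if fg: "(f, g) \<in> G" for f g
  proof -
    have "f \<in> L2" "g \<in> L2" using fg by (auto simp: G_def mult_op_def)
    moreover have "ipL (hf r n) g = of_real (lam n) * ipL (hf r n) f" for n
      using G_symmetric[OF G_hf fg, of n] unfolding ip_cmult_left by simp
    ultimately show ?thesis by (simp add: dgh_iff)
  qed
  fix z
  show "z \<in> dgh r (\<lambda>n. of_real (lam n))" if "z \<in> G" using sub that by (cases z) auto
  assume z: "z \<in> dgh r (\<lambda>n. of_real (lam n))"
  obtain f g where fg: "z = (f, g)" by (rule prod.exhaust)
  have f: "f \<in> L2" and g: "g \<in> L2" using z by (auto simp: fg dgh_iff)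
  obtain f1 where f1: "(f, f1) \<in> mult_op mS"
    using idd.dg_total[OF mS_facts(1,2) f] by (auto simp: mult_op_eq_dg)
  then obtain f2 where f2: "(f1, f2) \<in> four.dg E"
    using four.dg_total[OF E_facts(1,2), of f1] by (auto simp: mult_op_def)
  then obtain g' where g': "(f2, g') \<in> mult_op mS"
    using idd.dg_total[OF mS_facts(1,2), of f2] by (auto simp: mult_op_eq_dg four.dg_iff)
  have "(f, g') \<in> G" unfolding G_def using f1 f2 g' by blast
  from sub[OF this] z have "ipL (hf r n) g' = ipL (hf r n) g" for n
    by (simp add: fg dgh_iff)
  moreover have "g' \<in> L2" using g' by (auto simp: mult_op_def)
  ultimately have "AE x in lborel. g' x = g x" using g by (intro L2_eqI_hf_gen[OF r_pos])
  then have "(f2, g) \<in> mult_op mS"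
    using idd.dg_closed_right[OF g'[unfolded mult_op_eq_dg] g] by (simp add: mult_op_eq_dg)
  then show "z \<in> G" unfolding G_def fg using f1 f2 by blast
qed

lemma G_is_exp:
  "is_exp_of ((- arsinh (sqrt (\<alpha> * \<beta>))) \<cdot>\<^sub>o (sqrt (\<alpha> * (1 + \<alpha> * \<beta>) / \<beta>) \<cdot>\<^sub>o mult_op (\<lambda>x. of_real (x\<^sup>2)) -\<^sub>o
     sqrt (\<beta> / (\<alpha> * (1 + \<alpha> * \<beta>))) \<cdot>\<^sub>o laplacian)) G"
proof -
  let ?c = "arsinh (sqrt (\<alpha> * \<beta>))"
  have c: "- ?c \<noteq> 0" using \<alpha> \<beta> by simp
  have ri: "sqrt (\<beta> / (\<alpha> * (1 + \<alpha> * \<beta>))) = 1 / r"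
    unfolding r_def by (simp add: real_sqrt_divide)
  show ?thesis
    using is_exp_of_dgh[OF r_pos, of "\<lambda>n. - ?c * (2 * real n + 1)"]
    unfolding ri r_def[symmetric] oscillator_eq[OF r_pos] dgh_scale[OF r_pos c] G_eq lam_def of_real_mult .
qed

end

section \<open>Rescaled Hermite functions and the eigenpairs\<close>

lemma hp_scale: "poly (hp (w\<^sup>2) n) (of_real x) = of_real w ^ n * poly (hp 1 n) (of_real (w * x))"
proof (induction n rule: less_induct)
  case (less n)
  consider "n = 0" | "n = 1" | k where "n = Suc (Suc k)" by (metis One_nat_def not0_implies_Suc)
  then show ?case
  proof cases
    case (3 k)
    \<comment> \<open>Eliminating the derivative leaves the three-term recurrence, which can be
      rescaled without differentiating a composition.\<close>
    have rec: "poly (hp a (Suc (Suc k))) z = of_real (2 * a) * z * poly (hp a (Suc k)) z - of_real (2 * a * real (Suc k)) * poly (hp a k) z" for a z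
      by (simp only: hp.simps(2)[of a "Suc k"] pderiv_hp poly_diff poly_smult poly_pCons) simp
    have IH: "poly (hp (w\<^sup>2) (Suc k)) (of_real x) = of_real w ^ Suc k * poly (hp 1 (Suc k)) (of_real (w * x))"
      "poly (hp (w\<^sup>2) k) (of_real x) = of_real w ^ k * poly (hp 1 k) (of_real (w * x))"
      using less.IH 3 by (simp_all del: hp.simps)
    show ?thesis unfolding 3 rec IH by (simp add: algebra_simps power2_eq_square del: hp.simps)
  qed (auto simp: power2_eq_square)
qed

lemma hf_scale:
  assumes w: "w > 0" shows "hf (w\<^sup>2) n x = of_real (sqrt w) * hf 1 n (w * x)"
proof -
  have "hN (w\<^sup>2) n = (w ^ n)\<^sup>2 / w * hN 1 n"
    using w by (simp add: hN_def real_sqrt_divide power_mult_distrib mult_ac flip: power_mult)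
  then have N: "sqrt (hN (w\<^sup>2) n) = w ^ n / sqrt w * sqrt (hN 1 n)"
    using w by (simp add: real_sqrt_mult real_sqrt_divide)
  have "gf (w\<^sup>2) (hp (w\<^sup>2) n) x = of_real w ^ n * gf 1 (hp 1 n) (w * x)"
    unfolding gf_def hp_scale by (simp add: power_mult_distrib)
  then show ?thesis unfolding hf_def N using w by (simp add: field_simps)
qed

text \<open>All coefficients but the n-th vanish, and normalization gives the remaining one modulus
  1.\<close>

lemma hermite_function_eq:
  assumes h: "hermite_function n u"
  shows "\<exists>c. cnj c * c = 1 \<and> (AE x in lborel. u x = c * hf 1 n x)"
proof -
  let ?c = "ipL (hf 1 n) u"
  have u: "u \<in> L2" using hermite_function_coeff(1)[OF h] .
  have ch: "(\<lambda>x. ?c * hf 1 n x) \<in> L2" by (intro L2_cmult hf_L2) simp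
  have ae: "AE x in lborel. u x = ?c * hf 1 n x"
  proof (rule L2_eqI_hf[OF u ch])
    fix m show "ipL (hf 1 m) u = ipL (hf 1 m) (\<lambda>x. ?c * hf 1 n x)"
      using hermite_function_coeff(2)[OF h, of m] by (simp add: ip_cmult_right ip_hf_hf)
  qed
  have "1 = ipL u u" using h by (simp add: hermite_function_def L2_inner_eq_ip)
  also have "\<dots> = ipL (\<lambda>x. ?c * hf 1 n x) (\<lambda>x. ?c * hf 1 n x)"
    using ae u ch by (intro ip_cong_AE) (auto simp: L2_def)
  also have "\<dots> = cnj ?c * ?c"
    by (simp add: ip_cmult_right ip_cmult_left ip_hf_hf)
  finally show ?thesis using ae by auto
qed

lemma (in gaussian_masks) scaled_hermite_function:
  assumes h: "hermite_function n u"
    and v: "\<And>x. v x = of_real ((\<alpha> * (1 + \<alpha> * \<beta>) / \<beta>) powr (1 / 8)) * u ((\<alpha> * (1 + \<alpha> * \<beta>) / \<beta>) powr (1 / 4) * x)"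
  shows "v \<in> L2" "\<exists>c. cnj c * c = 1 \<and> (AE x in lborel. v x = c * hf r n x)"
proof -
  let ?R = "\<alpha> * (1 + \<alpha> * \<beta>) / \<beta>"
  define w where "w = sqrt r"
  have R: "?R > 0" using \<alpha> \<beta> by (simp add: add_pos_pos)
  have w: "w > 0" "w\<^sup>2 = r" using r_pos by (simp_all add: w_def)
  \<comment> \<open>As \<open>r\<close> is the square root of \<open>?R\<close>, its square root
    \<open>w\<close> is the fourth root; the prefactor sqrt(w) makes the dilation by
    \<open>w\<close> unitary.\<close>
  have w4: "?R powr (1 / 4) = w" and w8: "?R powr (1 / 8) = sqrt w"
    unfolding w_def r_def by (simp_all only: powr_half_sqrt[symmetric] powr_ge_zero less_imp_le[OF R] powr_powr) simp_all
  obtain c where c: "cnj c * c = 1" "AE x in lborel. u x = c * hf 1 n x"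
    using hermite_function_eq[OF h] by blast
  have [measurable]: "u \<in> borel_measurable borel" "hf a n \<in> borel_measurable borel" for a
    using hermite_function_coeff(1)[OF h] by (auto simp: L2_def hf_eq)
  \<comment> \<open>\<open>u\<close> is known only almost everywhere, so the identity is transported
    along a nonzero dilation, which preserves null sets.\<close>
  have "AE x in lborel. u (0 + w * x) = c * hf 1 n (0 + w * x)"
    by (rule AE_borel_affine) (use w c(2) in auto)
  then have ae: "AE x in lborel. v x = c * hf r n x"
    by eventually_elim (simp only: v w4 w8 w(2)[symmetric] hf_scale[OF w(1)] add_0 mult.left_commute)
  show "\<exists>c. cnj c * c = 1 \<and> (AE x in lborel. v x = c * hf r n x)" using c ae by blast
  have "v \<in> borel_measurable lborel" unfolding v[abs_def] by measurable
  then show "v \<in> L2"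
    using sqi_cong_AE[OF L2_cmult[OF hf_L2[OF r_pos], unfolded L2_eq_sqi] _ ae] by (simp add: L2_eq_sqi)
qed

lemma ip_phase_hf:
  assumes r: "r > 0" and v: "v \<in> L2" and ae: "AE x in lborel. v x = c * hf r n x"
  shows "ipL (hf r m) v = (if m = n then c else 0)"
proof -
  have "ipL (hf r m) v = ipL (hf r m) (\<lambda>x. c * hf r n x)"
    using ae v hf_L2[OF r] L2_cmult[OF hf_L2[OF r, of n], of c] by (intro ip_cong_AE) (auto simp: L2_def)
  then show ?thesis by (simp add: ip_cmult_right ip_hf_hf[OF r])
qed

lemma orthonormal_basis_phase_hf:
  assumes r: "r > 0" and v: "\<And>n. v n \<in> L2" and c: "\<And>n. cnj (c n) * c n = 1"
    and ae: "\<And>n. AE x in lborel. v n x = c n * hf r n x"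
  shows "orthonormal_basis v"
  unfolding orthonormal_basis_def L2_inner_eq_ip
proof (intro conjI allI ballI impI)
  show "range v \<subseteq> L2" using v by auto
  have left: "ipL (v m) f = cnj (c m) * ipL (hf r m) f" if "f \<in> L2" for m f
  proof -
    have "ipL (v m) f = ipL (\<lambda>x. c m * hf r m x) f"
      using ae[of m] v[of m] that L2_cmult[OF hf_L2[OF r, of m], of "c m"] by (intro ip_cong_AE) (auto simp: L2_def)
    then show ?thesis by (simp add: ip_cmult_left)
  qed
  show "ipL (v m) (v n) = (if m = n then 1 else 0)" for m n
    unfolding left[OF v] ip_phase_hf[OF r v ae] using c by simp
  fix f assume f: "f \<in> L2" and z: "\<forall>n. ipL (v n) f = 0"
  have "ipL (hf r n) f = 0" for n
    using z c[of n] unfolding left[OF f] by (metis mult_eq_0_iff zero_neq_one)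
  then show "AE x in lborel. f x = 0"
    using L2_eqI_hf_gen[OF r f, of "\<lambda>x. 0"] by (simp add: L2_eq_sqi)
qed

theorem theorem2:
  fixes \<alpha> \<beta> :: real
    and m\<^sub>S m\<^sub>F_hat :: "real \<Rightarrow> complex"
    and \<phi> \<psi> :: "nat \<Rightarrow> real \<Rightarrow> complex"
    and ev :: "nat \<Rightarrow> real"
    and K :: oper
  assumes "\<alpha> > 0" and "\<beta> > 0"
    and "m\<^sub>S = (\<lambda>x. of_real (exp (- (\<alpha> / 2) * x\<^sup>2)))"
    and "m\<^sub>F_hat = (\<lambda>\<xi>. of_real (exp (- (\<beta> / 2) * \<xi>\<^sup>2)))"
    and "K = concentration_op m\<^sub>S m\<^sub>F_hat"
    and "\<And>n. hermite_function n (\<phi> n)"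
    and "\<And>n x. \<psi> n x = of_real ((\<alpha> * (1 + \<alpha> * \<beta>) / \<beta>) powr (1 / 8)) *
                        \<phi> n ((\<alpha> * (1 + \<alpha> * \<beta>) / \<beta>) powr (1 / 4) * x)"
    and "\<And>n. ev n = exp (- arsinh (sqrt (\<alpha> * \<beta>)) * (2 * real n + 1))"
  shows "(\<exists>H. is_exp_of (\<beta> \<cdot>\<^sub>o laplacian) H \<and>
            K = mult_op (\<lambda>x. of_real (exp (- (1 / 2) * \<alpha> * x\<^sup>2))) \<circ>\<^sub>o H \<circ>\<^sub>o
                mult_op (\<lambda>x. of_real (exp (- (1 / 2) * \<alpha> * x\<^sup>2)))) \<and>
         is_exp_of
           ((- arsinh (sqrt (\<alpha> * \<beta>))) \<cdot>\<^sub>o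
              (sqrt (\<alpha> * (1 + \<alpha> * \<beta>) / \<beta>) \<cdot>\<^sub>o mult_op (\<lambda>x. of_real (x\<^sup>2)) -\<^sub>o
               sqrt (\<beta> / (\<alpha> * (1 + \<alpha> * \<beta>))) \<cdot>\<^sub>o laplacian)) K \<and>
         orthonormal_basis \<psi> \<and>
         (\<forall>n. eigenpair K (of_real (ev n)) (\<psi> n)) \<and>
         (\<forall>\<mu> f. eigenpair K \<mu> f \<longrightarrow>
            (\<exists>n c. \<mu> = of_real (ev n) \<and> (AE x in lborel. f x = c * \<psi> n x)))"
proof -
  interpret gaussian_masks \<alpha> \<beta> using assms(1,2) by unfold_locales
  have K: "K = G"
    using concentration_eq assms(3-5) by (simp only: mS_def[abs_def])
  have ev: "ev n = lam n" for n by (simp add: assms(8) lam_def)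
  have mS': "mS = (\<lambda>x. of_real (exp (- (1 / 2) * \<alpha> * x\<^sup>2)))" by (simp add: mS_def fun_eq_iff)
  have \<psi>L: "\<psi> n \<in> L2" and "\<exists>c. cnj c * c = 1 \<and> (AE x in lborel. \<psi> n x = c * hf r n x)" for n
    using scaled_hermite_function[OF assms(6,7)] by auto
  then obtain c where c: "\<And>n. cnj (c n) * c n = 1" and ae: "\<And>n. AE x in lborel. \<psi> n x = c n * hf r n x"
    by metis
  note coef = ip_phase_hf[OF r_pos \<psi>L ae]
  have c0: "c n \<noteq> 0" for n using c[of n] by auto
  have "is_exp_of (\<beta> \<cdot>\<^sub>o laplacian) (four.dg E)"
    using exp_laplacian[OF \<beta>] by (simp only: E_def[abs_def])
  moreover have "K = mult_op (\<lambda>x. of_real (exp (- (1 / 2) * \<alpha> * x\<^sup>2))) \<circ>\<^sub>o four.dg E \<circ>\<^sub>o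
                mult_op (\<lambda>x. of_real (exp (- (1 / 2) * \<alpha> * x\<^sup>2)))"
    unfolding K G_def mS' ..
  moreover have "eigenpair K (of_real (ev n)) (\<psi> n)" for n
    unfolding eigenpair_def
  proof (intro conjI notI)
    show "(\<psi> n, \<lambda>x. of_real (ev n) * \<psi> n x) \<in> K"
      unfolding K G_eq dgh_iff ip_cmult_right coef ev using \<psi>L L2_cmult[OF \<psi>L] by auto
    assume "AE x in lborel. \<psi> n x = 0"
    then have "ipL (hf r n) (\<psi> n) = ipL (hf r n) (\<lambda>x. 0)"
      using \<psi>L[of n] hf_L2[OF r_pos, of n] by (intro ip_cong_AE) (auto simp: L2_def)
    then show False using c0 by (simp add: coef)
  qed
  moreover have "\<exists>n c. \<mu> = of_real (ev n) \<and> (AE x in lborel. f x = c * \<psi> n x)" if f: "eigenpair K \<mu> f" for \<mu> f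
  proof -
    have fL: "f \<in> L2" and e: "\<And>n. \<mu> * ipL (hf r n) f = of_real (lam n) * ipL (hf r n) f"
      and nz: "\<not> (AE x in lborel. f x = 0)"
      using f by (auto simp: eigenpair_def K G_eq dgh_iff ip_cmult_right)
    obtain n where n: "ipL (hf r n) f \<noteq> 0"
      using L2_eqI_hf_gen[OF r_pos fL, of "\<lambda>x. 0"] nz by (auto simp: L2_eq_sqi)
    have \<mu>: "\<mu> = of_real (lam n)" using e[of n] n by simp
    \<comment> \<open>Distinct eigenvalues force all coefficients but one to vanish, so every
      eigenspace is one-dimensional.\<close>
    have lam_inj: "lam m \<noteq> lam n" if "m \<noteq> n" for m
      using that \<alpha> \<beta> by (simp add: lam_def)
    have z: "ipL (hf r m) f = 0" if "m \<noteq> n" for m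
      using e[of m] lam_inj[OF that] unfolding \<mu> by simp
    \<comment> \<open>Division by the unimodular \<open>c n\<close> converts the coefficient for
      \<open>hf r n\<close> into the one for \<open>\<psi> n\<close>.\<close>
    have "AE x in lborel. f x = (ipL (hf r n) f / c n) * \<psi> n x"
    proof (rule L2_eqI_hf_gen[OF r_pos fL L2_cmult[OF \<psi>L]])
      fix m show "ipL (hf r m) f = ipL (hf r m) (\<lambda>x. (ipL (hf r n) f / c n) * \<psi> n x)"
        unfolding ip_cmult_right coef using z[of m] c0 by auto
    qed
    moreover have "\<mu> = of_real (ev n)" using \<mu> ev by simp
    ultimately show ?thesis by (intro exI conjI)
  qed
  ultimately show ?thesis
    using G_is_exp orthonormal_basis_phase_hf[OF r_pos \<psi>L c ae] unfolding K by blast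
qed

end
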